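(* Let $\alpha,\beta>0$, let $H_{1/2}=-\chi_{[-\frac12,0)}+\chi_{[0,\frac12)}$ be the Haar function and let $\mathcal{G}(H_{1/2};\alpha,\beta)=\{e^{-2\pi i m\beta x}H_{1/2}(x-n\alpha): m,n\in\mathbb Z\}$. Then the following statements hold. (i) If $\mathcal{G}(H_{1/2};\alpha,\beta)$ is a frame for $L^2(\mathbb R)$, then $\alpha\beta\le 1$ and $\alpha\le 1$. (ii) If $\alpha\beta\le 1$, $\alpha\le 1$ and $\alpha\beta\notin\mathbb Q$, then $\mathcal{G}(H_{1/2};\alpha,\beta)$ is a frame for $L^2(\mathbb R)$ if and only if $\beta\notin 2\mathbb N$. (iii) If $\alpha\beta\le 1$, $\alpha\le 1$ and $\alpha\beta\in\mathbb Q$, then $\mathcal{G}(H_{1/2};\alpha,\beta)$ is a frame for $L^2(\mathbb R)$ if and only if $$|\beta-2n|\ge \gcd(n,\alpha\beta)\quad\text{and}\quad |1/\alpha-2n|\ge \gcd\big(n,1/(\alpha\beta)\big)-\big(1/(\alpha\beta)-1\big)$$ for all $n\in\mathbb N$.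
   Context: $\mathbb N=\{1,2,\dots\}$ and $2\mathbb N=\{2n:n\in\mathbb N\}$. $\chi_E$ is the characteristic function of $E$. For positive rationals $x,y$, $\gcd(x,y)$ is the greatest positive rational number $r$ dividing both $x$ and $y$ (i.e. $x/r,y/r\in\mathbb Z$). A system $\mathcal{G}(g;\alpha,\beta)=\{e^{-2\pi i m\beta x}g(x-n\alpha):m,n\in\mathbb Z\}$ is a frame for $L^2(\mathbb R)$ if there are constants $A,B>0$ with $A\|f\|_2^2\le\sum_{m,n\in\mathbb Z}|\langle f,e^{-2\pi i m\beta\cdot}g(\cdot-n\alpha)\rangle|^2\le B\|f\|_2^2$ for all $f\in L^2(\mathbb R)$. *)

theory Defs
  imports "HOL-Analysis.Analysis"
begin

text \<open>Elements of \<open>L\<^sup>2(\<real>)\<close> are represented by functions; two representatives of the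
  same class agree almost everywhere and are not distinguished by the norm or the inner product.\<close>

definition L2 :: "(real \<Rightarrow> complex) set" where
  "L2 = {f. f \<in> borel_measurable lebesgue \<and> integrable lebesgue (\<lambda>x. (cmod (f x))\<^sup>2)}"

definition L2_norm :: "(real \<Rightarrow> complex) \<Rightarrow> real" where
  "L2_norm f = sqrt (LINT x|lebesgue. (cmod (f x))\<^sup>2)"

definition L2_inner :: "(real \<Rightarrow> complex) \<Rightarrow> (real \<Rightarrow> complex) \<Rightarrow> complex" where
  "L2_inner f g = (LINT x|lebesgue. f x * cnj (g x))"

text \<open>The sum of the frame coefficients is an unordered real sum, which takes the value 0 when
  it diverges. Summability is therefore required explicitly; it is what a finite upper bound
  means.\<close>

definition is_frame :: "('i \<Rightarrow> real \<Rightarrow> complex) \<Rightarrow> bool" where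
  "is_frame \<phi> \<longleftrightarrow> (\<forall>i. \<phi> i \<in> L2) \<and>
     (\<exists>A>0. \<exists>B>0. \<forall>f\<in>L2.
        (\<lambda>i. (cmod (L2_inner f (\<phi> i)))\<^sup>2) summable_on UNIV \<and>
        A * (L2_norm f)\<^sup>2 \<le> (\<Sum>\<^sub>\<infinity>i. (cmod (L2_inner f (\<phi> i)))\<^sup>2) \<and>
        (\<Sum>\<^sub>\<infinity>i. (cmod (L2_inner f (\<phi> i)))\<^sup>2) \<le> B * (L2_norm f)\<^sup>2)"

definition gabor :: "(real \<Rightarrow> complex) \<Rightarrow> real \<Rightarrow> real \<Rightarrow> int \<times> int \<Rightarrow> real \<Rightarrow> complex" where
  "gabor g \<alpha> \<beta> = (\<lambda>(m, n) x.
     exp (- 2 * complex_of_real pi * \<i> * of_int m * complex_of_real \<beta> * complex_of_real x)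
       * g (x - of_int n * \<alpha>))"

definition haar :: "real \<Rightarrow> complex" where
  "haar x = - indicator {-1/2..<0} x + indicator {0..<1/2} x"

text \<open>Greatest common divisor of two positive rationals, viewed as real numbers. The maximum
  exists for positive rational arguments; for other arguments the value is irrelevant.\<close>

definition rat_gcd :: "real \<Rightarrow> real \<Rightarrow> real" where
  "rat_gcd x y = (GREATEST r. r \<in> \<rat> \<and> 0 < r \<and> x / r \<in> \<int> \<and> y / r \<in> \<int>)"

end

theory Submission imports Defs
begin

text \<open>
  With \<open>a = \<alpha>\<beta>\<close> and \<open>b = \<beta>/2\<close>, Parseval on a period of length \<open>1/\<beta>\<close> turns the frame
  inequalities into uniform \<open>\<ell>\<^sup>2\<close>-bounds for the matrices whose row \<open>i\<close> sends \<open>c\<close> to the sum of \<open>c\<close>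
  over the integers in \<open>[s, s + b)\<close> minus the sum over those in \<open>[s - b, s)\<close>, where \<open>s = ia - y\<close>.

  Differences of consecutive rows express that \<open>X(s + b) + X(s - b) - 2 X(s)\<close> is small, where
  \<open>X(s)\<close> is the entry of \<open>c\<close> in the cell \<open>[s, s + a)\<close>, which contains at most one integer. So \<open>c\<close> is
  almost constant along the two partial moves \<open>j \<mapsto> T\<^sub>\<plusminus> j\<close> to the integer in the cell shifted by
  \<open>\<plusminus>b\<close>, and \<open>c\<close> is small as soon as every integer reaches an empty cell after boundedly many moves.
  Otherwise compactness gives a nonempty set \<open>S\<close> of positions in \<open>[0, a)\<close> that is invariant under
  both moves. If \<open>a < 1\<close>, the two moves are inverse to each other on \<open>S\<close>, and this forces all of them
  to advance by the same number \<open>n\<close> of integers or by the same number \<open>n\<close> of cells. Then \<open>S\<close> is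
  invariant under a rotation, and the arc that it avoids must be shorter than the gaps of a
  rotation orbit, which violates one of the two gcd conditions at \<open>n\<close>. Conversely, if a condition
  fails at \<open>n\<close>, the indicator of the multiples of \<open>n\<close>, or of the integers in every \<open>n\<close>-th cell, is a
  bounded kernel vector. The case \<open>a = 1\<close> is treated directly: there \<open>\<beta>\<close> is an odd integer.
\<close>

text \<open>Both gcd conditions compare an arc with the gap of a rotation. If all moves advance by
  \<open>n\<close> integers, positions rotate by \<open>n\<close> modulo \<open>a\<close>: the gap
  is gcd(\<open>n\<close>, \<open>a\<close>), and the avoided arc has length 2|b - n| = |\<beta> -
  2n|. If all advance by \<open>n\<close> cells, positions rotate by \<open>n a\<close> modulo 1 and
  avoid an arc of length 1 - a + |\<beta> - 2na|; division by \<open>a\<close> gives the second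
  condition. For irrational \<open>a\<close> the gaps are arbitrarily small, so 1 - a > 0 rules out
  the second case and the first leaves only \<beta> = 2n. Two obstacles shape the argument. A small
  second difference alone does not make \<open>c\<close> almost constant; it does here because the
  moves are partial injections, so they do not increase l2 norms and the squared norms cancel. And
  half-open cells make survival stable under limits from the right only; limits from the left are
  recovered by the reflection u -> a - u. The offset \<open>y\<close> never enters the dynamics of
  positions, which makes the bounds uniform over the fibres. At \<open>a = 1\<close> no cell is
  empty and every position is invariant, so that case needs its own argument.\<close>

section \<open>Survivors of the two moves\<close>

text \<open>An integer at position \<open>u\<close> in its cell of length \<open>a\<close> moves to the integer \<open>k\<close> further on,
  provided the cell shifted by \<open>d = \<plusminus>b\<close> contains that integer; if the new cell is \<open>l\<close> cells further
  on, the new position is \<open>u + k - l a\<close>.\<close>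

primrec survives :: "real \<Rightarrow> real \<Rightarrow> nat \<Rightarrow> real \<Rightarrow> bool" where
  "survives a b 0 u \<longleftrightarrow> 0 \<le> u \<and> u < a"
| "survives a b (Suc L) u \<longleftrightarrow> 0 \<le> u \<and> u < a \<and>
     (\<forall>d\<in>{b, -b}. \<exists>(k::int) (l::int). 0 \<le> u + k - d \<and> u + k - d < a \<and> survives a b L (u + k - l * a))"

text \<open>The depth-free form of \<open>survives\<close>. For \<open>a \<le> 1\<close> the
  integers \<open>k\<close> and \<open>l\<close> are unique, because both shifted positions lie in
  intervals of length \<open>a\<close>, so the quantifiers describe two partial maps.\<close>

definition invariant_set :: "real \<Rightarrow> real \<Rightarrow> real set \<Rightarrow> bool" where
  "invariant_set a b S \<longleftrightarrow> S \<subseteq> {0..<a} \<and>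
     (\<forall>u\<in>S. \<forall>d\<in>{b, -b}. \<exists>(k::int) (l::int). 0 \<le> u + k - d \<and> u + k - d < a \<and> u + k - l * a \<in> S)"

lemma survives_step:
  fixes a b u d :: real
  assumes "survives a b (Suc L) u" "d \<in> {b, -b}"
  obtains k l :: int where "0 \<le> u + k - d" "u + k - d < a" "survives a b L (u + k - l * a)"
proof -
  have "\<exists>(k::int) (l::int). 0 \<le> u + k - d \<and> u + k - d < a \<and> survives a b L (u + k - l * a)"
    using assms unfolding survives.simps by (elim conjE bspec)
  then show thesis using that by (elim exE conjE)
qed

lemma survives_range: "survives a b L u \<Longrightarrow> 0 \<le> u \<and> u < a"
  by (cases L) auto

lemma survives_Suc_imp: "survives a b (Suc L) u \<Longrightarrow> survives a b L u"
proof (induction L arbitrary: u)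
  case (Suc L)
  from Suc.prems have r: "0 \<le> u" "u < a" by auto
  have "\<exists>(k::int) (l::int). 0 \<le> u + k - d \<and> u + k - d < a \<and> survives a b L (u + k - l * a)"
    if d: "d \<in> {b, -b}" for d
  proof -
    obtain k l :: int where "0 \<le> u + k - d" "u + k - d < a" "survives a b (Suc L) (u + k - l * a)"
      by (rule survives_step[OF Suc.prems d])
    then show ?thesis using Suc.IH by blast
  qed
  then show ?case using r by simp
qed auto

lemma survives_mono: "survives a b L u \<Longrightarrow> K \<le> L \<Longrightarrow> survives a b K u"
  by (induction L rule: nat_induct) (auto simp: le_Suc_eq simp del: survives.simps dest: survives_Suc_imp)

text \<open>Survival to depth \<open>L\<close> is a finite set of conditions
  \<open>0 \<le> t < a\<close>. A small shift to the right makes the lower bounds strict and keeps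
  the upper ones, and strict bounds on both sides are symmetric under
  \<open>t \<mapsto> a - t\<close>, which exchanges the moves by \<open>b\<close> and
  \<open>-b\<close>.\<close>

lemma survives_reflect:
  fixes a b u :: real
  assumes "survives a b L u"
  shows "\<exists>e>0. \<forall>u'. u < u' \<and> u' < u + e \<longrightarrow> survives a b L (a - u')"
  using assms
proof (induction L arbitrary: u)
  case 0
  then show ?case by (intro exI[of _ "a - u"]) auto
next
  case (Suc L)
  from Suc.prems have r: "0 \<le> u" "u < a" by auto
  have "\<exists>e>0. \<forall>u'. u < u' \<and> u' < u + e \<longrightarrow>
      (\<exists>(k::int) (l::int). 0 \<le> a - u' + k + d \<and> a - u' + k + d < a \<and> survives a b L (a - u' + k - l * a))"
    if d: "d \<in> {b, -b}" for d
  proof -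
    obtain k l :: int where kl: "0 \<le> u + k - d" "u + k - d < a" "survives a b L (u + k - l * a)"
      by (rule survives_step[OF Suc.prems d])
    obtain e where e: "e > 0" "\<And>u'. u + k - l * a < u' \<Longrightarrow> u' < u + k - l * a + e \<Longrightarrow> survives a b L (a - u')"
      using Suc.IH[OF kl(3)] by blast
    show ?thesis
    proof (intro exI[of _ "min e (a - (u + k - d))"] conjI allI impI)
      show "0 < min e (a - (u + k - d))" using e kl by auto
      fix u' assume u': "u < u' \<and> u' < u + min e (a - (u + k - d))"
      have "survives a b L (a - (u' + k - l * a))"
        by (rule e(2)) (use u' in auto)
      then have "survives a b L (a - u' + of_int (- k) - of_int (- l) * a)"
        by (simp add: algebra_simps)
      moreover have "0 \<le> a - u' + of_int (- k) + d" "a - u' + of_int (- k) + d < a"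
        using u' kl by auto
      ultimately show "\<exists>(k::int) (l::int). 0 \<le> a - u' + k + d \<and> a - u' + k + d < a \<and>
          survives a b L (a - u' + k - l * a)"
        by blast
    qed
  qed
  from this[of b] this[of "-b"] obtain e1 e2 where e: "e1 > 0" "e2 > 0"
    "\<And>u'. u < u' \<Longrightarrow> u' < u + e1 \<Longrightarrow>
      (\<exists>(k::int) (l::int). 0 \<le> a - u' + k + b \<and> a - u' + k + b < a \<and> survives a b L (a - u' + k - l * a))"
    "\<And>u'. u < u' \<Longrightarrow> u' < u + e2 \<Longrightarrow>
      (\<exists>(k::int) (l::int). 0 \<le> a - u' + k - b \<and> a - u' + k - b < a \<and> survives a b L (a - u' + k - l * a))"
    by auto
  show ?case
  proof (intro exI[of _ "min (min e1 e2) (a - u)"] conjI allI impI)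
    show "0 < min (min e1 e2) (a - u)" using e(1,2) r by simp
    fix u' assume u': "u < u' \<and> u' < u + min (min e1 e2) (a - u)"
    then have "0 \<le> a - u' \<and> a - u' < a" using r by auto
    moreover
    have uu: "u < u'" "u' < u + e1" "u' < u + e2" using u' by auto
    have "\<exists>(k::int) (l::int). 0 \<le> a - u' + k - d \<and> a - u' + k - d < a \<and>
        survives a b L (a - u' + k - l * a)" if "d \<in> {b, -b}" for d
      using that
    proof
      assume "d = b"
      then show ?thesis using e(4)[OF uu(1,3)] by simp
    next
      assume "d \<in> {-b}"
      then have "- d = b" by simp
      then show ?thesis using e(3)[OF uu(1,2)] unfolding diff_conv_add_uminus[of _ d] by simp
    qed
    ultimately show "survives a b (Suc L) (a - u')" unfolding survives.simps by blast
  qed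
qed

text \<open>The candidates \<open>k\<close> and \<open>l\<close> at \<open>u\<close> are a ceiling
  and a floor that stay constant on a small interval to the right of \<open>u\<close>, so the moves
  at \<open>u\<close> are limits from the right of the moves at nearby survivors.\<close>

lemma survives_right_closed:
  fixes a b u :: real
  assumes "a \<le> 1" and "\<And>e. e > 0 \<Longrightarrow> \<exists>u'. u \<le> u' \<and> u' < u + e \<and> survives a b L u'"
  shows "survives a b L u"
  using assms(2)
proof (induction L arbitrary: u)
  case 0
  from 0[of 1] have "u < a" by auto
  moreover have "0 \<le> u"
  proof (rule ccontr)
    assume "\<not> 0 \<le> u" then show False using 0[of "-u"] by auto
  qed
  ultimately show ?case by simp
next
  case (Suc L)
  have r: "u < a" using Suc.prems[of 1] by auto
  have r0: "0 \<le> u"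
  proof (rule ccontr)
    assume "\<not> 0 \<le> u" then show False using Suc.prems[of "-u"] by auto
  qed
  have a0: "0 < a" using r r0 by simp
  have "\<exists>(k::int) (l::int). 0 \<le> u + k - d \<and> u + k - d < a \<and> survives a b L (u + k - l * a)"
    if d: "d \<in> {b, -b}" for d
  proof -
    define k :: int where "k = \<lceil>d - u\<rceil>"
    define l :: int where "l = \<lfloor>(u + k) / a\<rfloor>"
    have k: "0 \<le> u + k - d" "u + k - d < 1" unfolding k_def by linarith+
    have l: "0 \<le> u + k - l * a" "u + k - l * a < a"
      using floor_divide_lower[OF a0, of "u + k"] floor_divide_upper[OF a0, of "u + k"]
      unfolding l_def by (auto simp: algebra_simps)
    \<comment> \<open>The distance from \<open>u\<close> up to the first point where
      \<open>k\<close> or \<open>l\<close> would change.\<close>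
    define e0 where "e0 = min (1 - (u + k - d)) (a - (u + k - l * a))"
    have e0: "e0 > 0" using k l by (auto simp: e0_def)
    have key: "u' + k - d < a \<and> survives a b L (u' + k - l * a)"
      if u': "u \<le> u'" "u' < u + e0" "survives a b (Suc L) u'" for u' :: real
    proof -
      obtain k' l' :: int where k': "0 \<le> u' + k' - d" "u' + k' - d < a" "survives a b L (u' + k' - l' * a)"
        by (rule survives_step[OF u'(3) d])
      have "of_int k' < (of_int (k + 1) :: real)" using k' k u' assms(1) by auto
      moreover have "of_int k < (of_int (k' + 1) :: real)" using k' k u' unfolding e0_def by auto
      ultimately have [simp]: "k' = k" by linarith
      have rr: "0 \<le> u' + k - l' * a" "u' + k - l' * a < a" using survives_range[OF k'(3)] by auto
      have "l' = l"
      proof (rule ccontr)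
        assume "l' \<noteq> l"
        then consider "l' + 1 \<le> l" | "l + 1 \<le> l'" by linarith
        then show False
        proof cases
          case 1
          then have "of_int (l' + 1) * a \<le> l * a" using a0 by (intro mult_right_mono) linarith+
          then show False using rr l u' by (auto simp: algebra_simps)
        next
          case 2
          then have "of_int (l + 1) * a \<le> l' * a" using a0 by (intro mult_right_mono) linarith+
          then show False using rr l u' unfolding e0_def by (auto simp: algebra_simps)
        qed
      qed
      then show ?thesis using k' by simp
    qed
    have "survives a b L (u + k - l * a)"
    proof (rule Suc.IH)
      fix e :: real assume "e > 0"
      then obtain u' where u': "u \<le> u'" "u' < u + min e e0" "survives a b (Suc L) u'"
        using Suc.prems[of "min e e0"] e0 by auto
      then show "\<exists>u'. u + k - l * a \<le> u' \<and> u' < u + k - l * a + e \<and> survives a b L u'"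
        using key[of u'] by (intro exI[of _ "u' + k - l * a"]) auto
    qed
    moreover obtain u' where u': "u \<le> u'" "u' < u + e0" "survives a b (Suc L) u'"
      using Suc.prems[OF e0] by blast
    ultimately show ?thesis using key[OF u'] k by (intro exI[of _ k] exI[of _ l]) auto
  qed
  then show ?case using r r0 by simp
qed

text \<open>Survivors of growing depth accumulate at some \<open>x\<close>. If every depth has
  survivors arbitrarily close to \<open>x\<close> from the right or at \<open>x\<close>, then
  \<open>x\<close> works. Otherwise deep survivors near \<open>x\<close> lie strictly to its left,
  and their reflections approach \<open>a - x\<close> from the right.\<close>

lemma survives_all_obtain:
  fixes a b :: real
  assumes "a \<le> 1" and ex: "\<And>L. \<exists>u. survives a b L u"
  obtains u where "\<And>L. survives a b L u"
proof -
  obtain f where f: "\<And>L. survives a b L (f L)" using ex by metis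
  then have "\<And>L. f L \<in> {0..a}" by (meson atLeastAtMost_iff less_imp_le survives_range)
  then obtain x r where r: "strict_mono (r :: nat \<Rightarrow> nat)" "(f \<circ> r) \<longlonglongrightarrow> x"
    using compact_Icc[of 0 a] unfolding compact_def by (metis)
  have near: "\<exists>u. \<bar>u - x\<bar> < e \<and> survives a b L u" if "e > 0" for e L
  proof -
    obtain N where N: "\<And>n. n \<ge> N \<Longrightarrow> \<bar>f (r n) - x\<bar> < e"
      using r(2) \<open>e > 0\<close> unfolding LIMSEQ_def dist_real_def o_def by meson
    have "survives a b L (f (r (max N L)))"
      by (rule survives_mono[OF f]) (meson max.cobounded2 r(1) seq_suble order_trans)
    then show ?thesis using N[of "max N L"] by auto
  qed
  show thesis
  proof (cases "\<forall>L. \<forall>e>0. \<exists>u'. x \<le> u' \<and> u' < x + e \<and> survives a b L u'")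
    case True
    then have "survives a b L x" for L using survives_right_closed[OF assms(1)] by blast
    then show thesis using that by blast
  next
    case False
    then obtain K0 e0 where K0: "e0 > 0" "\<And>u'. x \<le> u' \<Longrightarrow> u' < x + e0 \<Longrightarrow> \<not> survives a b K0 u'"
      by blast
    have "survives a b L (a - x)" for L
    proof (rule survives_right_closed[OF assms(1)])
      fix e :: real assume "e > 0"
      then obtain u where u: "\<bar>u - x\<bar> < min e e0" "survives a b (max L K0) u"
        using near[of "min e e0"] K0(1) by auto
      have "\<not> x \<le> u" using K0(2)[of u] u survives_mono[OF u(2)] by auto
      then have ux: "u < x" by simp
      obtain e1 where e1: "e1 > 0" "\<And>u'. u < u' \<Longrightarrow> u' < u + e1 \<Longrightarrow> survives a b L (a - u')"
        using survives_reflect[OF survives_mono[OF u(2), of L]] by auto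
      \<comment> \<open>A point strictly between \<open>u\<close> and \<open>x\<close>, close enough
        to \<open>u\<close> for the reflection to survive.\<close>
      define u' where "u' = u + min e1 (x - u) / 2"
      have "u < u'" "u' < u + e1" "u' < x" using e1(1) ux unfolding u'_def min_def by (auto simp: field_simps)
      then show "\<exists>u'. a - x \<le> u' \<and> u' < a - x + e \<and> survives a b L u'"
        using e1(2)[of u'] u by (intro exI[of _ "a - u'"]) auto
    qed
    then show thesis using that by blast
  qed
qed

lemma int_mult_cancel_range:
  fixes k k' :: int and a u :: real
  assumes "0 \<le> u - k * a" "u - k * a < a" "0 \<le> u - k' * a" "u - k' * a < a"
  shows "k = k'"
proof (rule ccontr)
  have a0: "0 < a" using assms by linarith
  assume "k \<noteq> k'"
  then consider "k + 1 \<le> k'" | "k' + 1 \<le> k" by linarith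
  then show False
  proof cases
    case 1
    then have "of_int (k + 1) * a \<le> k' * a" using a0 by (intro mult_right_mono) linarith+
    then show False using assms by (auto simp: algebra_simps)
  next
    case 2
    then have "of_int (k' + 1) * a \<le> k * a" using a0 by (intro mult_right_mono) linarith+
    then show False using assms by (auto simp: algebra_simps)
  qed
qed

lemma int_unit_range:
  fixes k k' :: int and a u d :: real
  assumes "a \<le> 1" "0 \<le> u + k - d" "u + k - d < a" "0 \<le> u + k' - d" "u + k' - d < a"
  shows "k = k'"
  using assms by linarith

text \<open>The witnesses \<open>k\<close> and \<open>l\<close> could a priori depend on the depth.
  Their uniqueness makes one pair serve all depths, so the new position survives forever
  too.\<close>

lemma invariant_set_survivors:
  fixes a b :: real
  assumes "a \<le> 1"
  shows "invariant_set a b {u. \<forall>L. survives a b L u}"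
  unfolding invariant_set_def
proof (intro conjI ballI)
  show "{u. \<forall>L. survives a b L u} \<subseteq> {0..<a}" using survives_range by fastforce
  fix u d assume u: "u \<in> {u. \<forall>L. survives a b L u}" and d: "d \<in> {b, -b}"
  have ex: "\<exists>(k::int) (l::int). 0 \<le> u + k - d \<and> u + k - d < a \<and> survives a b L (u + k - l * a)" for L
  proof -
    have "survives a b (Suc L) u" using u by blast
    from survives_step[OF this d] show ?thesis by metis
  qed
  obtain k l :: int where kl: "0 \<le> u + k - d" "u + k - d < a" "survives a b 0 (u + k - l * a)"
    using ex by blast
  have "survives a b L (u + k - l * a)" for L
  proof -
    obtain k' l' :: int where kl': "0 \<le> u + k' - d" "u + k' - d < a" "survives a b L (u + k' - l' * a)"
      using ex by blast
    have k: "k' = k" using int_unit_range[OF assms] kl kl' by blast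
    moreover have "l' = l"
      using survives_range[OF kl(3)] survives_range[OF kl'(3)] unfolding k
      by (intro int_mult_cancel_range[of "u + k"]) auto
    ultimately show ?thesis using kl' by simp
  qed
  then show "\<exists>(k::int) (l::int). 0 \<le> u + k - d \<and> u + k - d < a \<and> u + k - l * a \<in> {u. \<forall>L. survives a b L u}"
    using kl by blast
qed

section \<open>Invariant sets are rigid\<close>

definition moves :: "real \<Rightarrow> real set \<Rightarrow> real \<Rightarrow> real \<Rightarrow> int \<Rightarrow> int \<Rightarrow> bool" where
  "moves a S d u k l \<longleftrightarrow> 0 \<le> u + k - d \<and> u + k - d < a \<and> u + k - l * a \<in> S"

text \<open>Both \<open>k + k'\<close> and \<open>(l + l') * a\<close> have the form
  \<open>p + q - r - t\<close> with four points of \<open>[0, a)\<close>, so both are below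
  \<open>2 * a\<close> in absolute value. The round trip starts and ends in \<open>[0, a)\<close>,
  and \<open>a < 1\<close> then couples the two displacements.\<close>

lemma return_bounds:
  fixes a d u :: real and k l k' l' :: int
  assumes S: "S \<subseteq> {0..<a}" and a: "a < 1" and u: "u \<in> S"
    and 1: "moves a S d u k l" and 2: "moves a S (-d) (u + k - l * a) k' l'"
  shows "k + k' = 0 \<and> l + l' = 0 \<or> k + k' = 1 \<and> l + l' = 1 \<or> k + k' = -1 \<and> l + l' = -1"
proof -
  have b: "0 \<le> u" "u < a" "0 \<le> u + k - d" "u + k - d < a" "0 \<le> u + k - l * a" "u + k - l * a < a"
    "0 \<le> u + k - l * a + k' + d" "u + k - l * a + k' + d < a"
    "0 \<le> u + k - l * a + k' - l' * a" "u + k - l * a + k' - l' * a < a"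
    using S u 1 2 unfolding moves_def by auto
  have a0: "0 < a" using b by linarith
  have la: "- (2 * a) < (l + l') * a" "(l + l') * a < 2 * a"
    using b by (auto simp: algebra_simps)
  have "l + l' < 2"
    using la(2) mult_less_cancel_right_pos[OF a0, of "of_int (l + l')" 2] by linarith
  moreover have "-2 < l + l'"
    using la(1) mult_less_cancel_right_pos[OF a0, of "-2" "of_int (l + l')"] by linarith
  ultimately have l: "l + l' = 0 \<or> l + l' = 1 \<or> l + l' = -1" by linarith
  have k: "k + k' = 0 \<or> k + k' = 1 \<or> k + k' = -1" using b a by linarith
  have f: "0 \<le> u + of_int (k + k') - of_int (l + l') * a" "u + of_int (k + k') - of_int (l + l') * a < a"
    using b by (auto simp: algebra_simps)
  define K M where "K = k + k'" and "M = l + l'"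
  show ?thesis using f k l b(1,2) a0 a unfolding K_def[symmetric] M_def[symmetric] by auto
qed

text \<open>The two moves preserve the order of the integers in \<open>S\<close>'s orbit. Were the round trip to
  displace one integer, it would displace all later ones by the same amount, so the position
  would drift by \<open>1 - a\<close> forever.\<close>

lemma return_drift_up:
  fixes a d u :: real and k l k' l' k2 l2 k2' l2' :: int
  assumes S: "S \<subseteq> {0..<a}" and a: "a < 1" and u: "u \<in> S"
    and 1: "moves a S d u k l" "moves a S (-d) (u + k - l * a) k' l'"
    and 2: "moves a S d (u + 1 - a) k2 l2" "moves a S (-d) (u + 1 - a + k2 - l2 * a) k2' l2'"
    and "k + k' = 1"
  shows "k2 + k2' \<ge> 1"
proof -
  have b: "0 \<le> u" "u < a" "0 \<le> u + k - d" "u + k - d < a" "0 \<le> u + k - l * a" "u + k - l * a < a"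
    "0 \<le> u + k - l * a + k' + d" "u + k - l * a + k' + d < a"
    using S u 1 unfolding moves_def by auto
  have c: "0 \<le> u + 1 - a + k2 - d" "u + 1 - a + k2 - d < a"
    "0 \<le> u + 1 - a + k2 - l2 * a" "u + 1 - a + k2 - l2 * a < a"
    "0 \<le> u + 1 - a + k2 - l2 * a + k2' + d" "u + 1 - a + k2 - l2 * a + k2' + d < a"
    using S 2 unfolding moves_def by auto
  have a0: "0 < a" using b by linarith
  \<comment> \<open>The move is strictly increasing: the integer one further on is sent beyond the
    image of the first, and hence also into a later cell.\<close>
  have "of_int k < (of_int (k2 + 1) :: real)" using b c by simp
  then have k: "k \<le> k2" by linarith
  have "l \<le> l2"
  proof (rule ccontr)
    assume "\<not> l \<le> l2"
    then have "of_int (l2 + 1) * a \<le> l * a" using a0 by (intro mult_right_mono) linarith+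
    then show False using b c k a by (auto simp: algebra_simps)
  qed
  then have "l * a \<le> l2 * a" using a0 by (intro mult_right_mono) linarith+
  moreover have "of_int k + of_int k' = (1 :: real)"
    using \<open>k + k' = 1\<close> by (metis of_int_1 of_int_add)
  ultimately have "(0 :: real) < of_int k2 + of_int k2'" using b c by linarith
  then show ?thesis by linarith
qed

lemma return_drift_down:
  fixes a d u :: real and k l k' l' k2 l2 k2' l2' :: int
  assumes S: "S \<subseteq> {0..<a}" and a: "a < 1" and u: "u \<in> S"
    and 1: "moves a S d u k l" "moves a S (-d) (u + k - l * a) k' l'"
    and 2: "moves a S d (u - 1 + a) k2 l2" "moves a S (-d) (u - 1 + a + k2 - l2 * a) k2' l2'"
    and "k + k' = -1"
  shows "k2 + k2' \<le> -1"
proof -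
  have b: "0 \<le> u" "u < a" "0 \<le> u + k - d" "u + k - d < a" "0 \<le> u + k - l * a" "u + k - l * a < a"
    "0 \<le> u + k - l * a + k' + d" "u + k - l * a + k' + d < a"
    using S u 1 unfolding moves_def by auto
  have c: "0 \<le> u - 1 + a + k2 - d" "u - 1 + a + k2 - d < a"
    "0 \<le> u - 1 + a + k2 - l2 * a" "u - 1 + a + k2 - l2 * a < a"
    "0 \<le> u - 1 + a + k2 - l2 * a + k2' + d" "u - 1 + a + k2 - l2 * a + k2' + d < a"
    using S 2 unfolding moves_def by auto
  have a0: "0 < a" using b by linarith
  have "of_int k2 < (of_int (k + 1) :: real)" using b c by simp
  then have k: "k2 \<le> k" by linarith
  have "l2 \<le> l"
  proof (rule ccontr)
    assume "\<not> l2 \<le> l"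
    then have "of_int (l + 1) * a \<le> l2 * a" using a0 by (intro mult_right_mono) linarith+
    then show False using b c k a by (auto simp: algebra_simps)
  qed
  then have "l2 * a \<le> l * a" using a0 by (intro mult_right_mono) linarith+
  moreover have "of_int k + of_int k' = (-1 :: real)"
    using \<open>k + k' = -1\<close> by (metis of_int_1 of_int_add of_int_minus)
  ultimately have "of_int k2 + of_int k2' < (0 :: real)" using b c by linarith
  then show ?thesis by linarith
qed

lemma invariant_set_movesE:
  fixes a b d u :: real
  assumes "invariant_set a b S" "u \<in> S" "d \<in> {b, -b}"
  obtains k l :: int where "moves a S d u k l"
proof -
  have "\<exists>(k::int) (l::int). moves a S d u k l"
    using assms unfolding invariant_set_def moves_def by blast
  then show thesis using that by blast
qed

lemma moves_in: "moves a S d u k l \<Longrightarrow> u + k - l * a \<in> S"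
  by (simp add: moves_def)

lemma no_drift:
  fixes a b d u :: real and e :: int
  assumes S: "invariant_set a b S" and a: "a < 1" and d: "d \<in> {b, -b}" and e: "e = 1 \<or> e = -1"
    and u: "u \<in> S" "moves a S d u k l" "moves a S (-d) (u + k - l * a) k' l'" "k + k' = e"
  shows False
proof -
  have Ssub: "S \<subseteq> {0..<a}" using S by (simp add: invariant_set_def)
  have d': "-d \<in> {b, -b}" using d by auto
  \<comment> \<open>The claim for \<open>n\<close> carries a whole round trip with displacement
    \<open>e\<close> at the drifted position, since the drift lemmas need one to produce the
    next.\<close>
  have "\<exists>(k::int) (l::int) (k'::int) (l'::int).
      u + n * (e * (1 - a)) \<in> S \<and> moves a S d (u + n * (e * (1 - a))) k l \<and>
      moves a S (-d) (u + n * (e * (1 - a)) + k - l * a) k' l' \<and> k + k' = e" for n :: nat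
  proof (induction n)
    case 0
    show ?case using u by auto
  next
    case (Suc n)
    define v where "v = u + n * (e * (1 - a))"
    obtain k l k' l' :: int where v: "v \<in> S" "moves a S d v k l" "moves a S (-d) (v + k - l * a) k' l'" "k + k' = e"
      using Suc unfolding v_def[symmetric] by blast
    define w where "w = v + k - l * a + k' - l' * a"
    have w: "w \<in> S" unfolding w_def by (rule moves_in[OF v(3)])
    obtain k2 l2 :: int where 2: "moves a S d w k2 l2"
      using invariant_set_movesE[OF S w d] .
    obtain k2' l2' :: int where 3: "moves a S (-d) (w + k2 - l2 * a) k2' l2'"
      using invariant_set_movesE[OF S moves_in[OF 2] d'] .
    have l: "l + l' = e"
      using return_bounds[OF Ssub a v(1-3)] v(4) e by auto
    have w': "w = v + of_int (k + k') - of_int (l + l') * a" unfolding w_def by (simp add: algebra_simps)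
    then have wv: "w = v + e * (1 - a)" unfolding l v(4) by (simp add: algebra_simps)
    have "k2 + k2' = e"
    proof (cases "e = 1")
      case True
      have weq: "w = v + 1 - a" using wv True by simp
      have "k2 + k2' \<ge> 1"
        using return_drift_up[OF Ssub a v(1-3), of k2 l2 k2' l2'] 2 3 v(4) True unfolding weq by simp
      then show ?thesis using return_bounds[OF Ssub a w 2 3] True by auto
    next
      case False
      then have weq: "w = v - 1 + a" and e': "e = -1" using wv e by auto
      have "k2 + k2' \<le> -1"
        using return_drift_down[OF Ssub a v(1-3), of k2 l2 k2' l2'] 2 3 v(4) e' unfolding weq by simp
      then show ?thesis using return_bounds[OF Ssub a w 2 3] e' by auto
    qed
    moreover have "w = u + Suc n * (e * (1 - a))" using wv unfolding v_def by (simp add: algebra_simps)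
    ultimately show ?case using w 2 3 by metis
  qed
  then have in_S: "0 \<le> u + n * (e * (1 - a)) \<and> u + n * (e * (1 - a)) < a" for n :: nat
    using Ssub by (meson atLeastLessThan_iff subsetD)
  obtain n :: nat where n: "1 < n * (1 - a)"
    using reals_Archimedean3[of "1 - a"] a by auto
  then show False using in_S[of 0] in_S[of n] e a by auto
qed

lemma moves_return:
  fixes a b d u :: real
  assumes S: "invariant_set a b S" and a: "a < 1" and d: "d \<in> {b, -b}"
    and u: "u \<in> S" "moves a S d u k l" "moves a S (-d) (u + k - l * a) k' l'"
  shows "k' = -k \<and> l' = -l"
proof -
  have Ssub: "S \<subseteq> {0..<a}" using S by (simp add: invariant_set_def)
  have "k + k' \<noteq> 1" "k + k' \<noteq> -1" using no_drift[OF S a d _ u] by auto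
  then show ?thesis using return_bounds[OF Ssub a u] by auto
qed

text \<open>By the previous lemma, with \<open>p = b - k\<close> and \<open>r = b - l a\<close>, all four of \<open>u\<close>, \<open>u - p\<close>,
  \<open>u + r - p\<close> and \<open>u + r\<close> lie in the interval of length \<open>a < 1\<close>.\<close>

lemma moves_box:
  fixes a b u :: real
  assumes S: "invariant_set a b S" and a: "a < 1" and u: "u \<in> S" "moves a S b u k l"
  shows "0 \<le> u \<and> u < a \<and> 0 \<le> u + k - b \<and> u + k - b < a \<and> 0 \<le> u + k - l * a \<and> u + k - l * a < a
    \<and> 0 \<le> u + b - l * a \<and> u + b - l * a < a"
proof -
  have Ssub: "S \<subseteq> {0..<a}" using S by (simp add: invariant_set_def)
  obtain k' l' :: int where 2: "moves a S (-b) (u + k - l * a) k' l'"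
    using invariant_set_movesE[OF S moves_in[OF u(2)], of "-b"] by auto
  have [simp]: "k' = -k" "l' = -l" using moves_return[OF S a _ u 2] by auto
  have "u + k - l * a \<in> S" using moves_in[OF u(2)] .
  then show ?thesis using Ssub u 2 unfolding moves_def by auto
qed

text \<open>With \<open>p\<close> and \<open>r\<close> as above, \<open>r - p\<close> and
  \<open>r + p\<close> are differences of points of \<open>[0, a)\<close>, so |p| + |r| < a. If two
  elements differed in both \<open>k\<close> and \<open>l\<close>, their values of \<open>p\<close>
  would be at least 1 apart and those of \<open>r\<close> at least \<open>a\<close>, although the
  total cannot reach \<open>2 * a < 1 + a\<close>.\<close>

lemma moves_dichotomy:
  fixes a b u u2 :: real
  assumes S: "invariant_set a b S" and a: "a < 1"
    and 1: "u \<in> S" "moves a S b u k l" and 2: "u2 \<in> S" "moves a S b u2 k2 l2"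
  shows "k = k2 \<or> l = l2"
proof (rule ccontr)
  have *: False if S: "invariant_set a b S"
    and u: "u \<in> S" "moves a S b u k l" "u2 \<in> S" "moves a S b u2 k2 l2" and k: "k < k2" and l: "l \<noteq> l2"
    for u u2 :: real and k k2 l l2 :: int
  proof -
    note b = moves_box[OF S a u(1,2)] moves_box[OF S a u(3,4)]
    have a0: "0 < a" using b by linarith
    have k': "(of_int k + 1 :: real) \<le> k2" using k by linarith
    from l consider "l + 1 \<le> l2" | "l2 + 1 \<le> l" by linarith
    then show False
    proof cases
      case 1
      then have "of_int (l + 1) * a \<le> l2 * a" using a0 by (intro mult_right_mono) linarith+
      then have "l * a + a \<le> l2 * a" by (simp add: algebra_simps)
      then show False using b k' a by linarith
    next
      case 2
      then have "of_int (l2 + 1) * a \<le> l * a" using a0 by (intro mult_right_mono) linarith+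
      then have "l2 * a + a \<le> l * a" by (simp add: algebra_simps)
      then show False using b k' a by linarith
    qed
  qed
  assume "\<not> (k = k2 \<or> l = l2)"
  then consider "k < k2" "l \<noteq> l2" | "k2 < k" "l2 \<noteq> l" by linarith
  then show False using *[OF S 1 2] *[OF S 2 1] by cases auto
qed

text \<open>\<open>S\<close> is invariant modulo \<open>c\<close> under the step \<open>t\<close> in
  both directions, hence under the step \<open>h\<close>. An orbit with step \<open>h\<close> cannot
  jump over the arc \<open>[y, c + x)\<close>, which contains no point of \<open>S\<close> modulo
  \<open>c\<close>, if that arc has length at least \<open>h\<close>.\<close>

lemma rotation_orbit_gap:
  fixes c t x y h :: real
  assumes S: "S \<subseteq> {x..<y}" and u: "u \<in> S"
    and cl: "\<And>u. u \<in> S \<Longrightarrow> \<exists>l::int. u + t - l * c \<in> S" "\<And>u. u \<in> S \<Longrightarrow> \<exists>l::int. u - t - l * c \<in> S"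
    and h: "h = of_int p * t + of_int q * c" "h > 0"
  shows "c + x - y < h"
proof (rule ccontr)
  assume "\<not> c + x - y < h"
  then have le: "h \<le> c + x - y" by simp
  have up: "\<exists>l::int. u + n * t - l * c \<in> S" for n :: nat
  proof (induction n)
    case (Suc n)
    then obtain l :: int where "u + n * t - l * c \<in> S" by blast
    from cl(1)[OF this] obtain l' :: int where "u + n * t - l * c + t - l' * c \<in> S" by blast
    moreover have "u + n * t - l * c + t - l' * c = u + Suc n * t - of_int (l + l') * c"
      by (simp add: algebra_simps)
    ultimately show ?case by metis
  qed (use u in \<open>auto intro: exI[of _ 0]\<close>)
  have dn: "\<exists>l::int. u - n * t - l * c \<in> S" for n :: nat
  proof (induction n)
    case (Suc n)
    then obtain l :: int where "u - n * t - l * c \<in> S" by blast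
    from cl(2)[OF this] obtain l' :: int where "u - n * t - l * c - t - l' * c \<in> S" by blast
    moreover have "u - n * t - l * c - t - l' * c = u - Suc n * t - of_int (l + l') * c"
      by (simp add: algebra_simps)
    ultimately show ?case by metis
  qed (use u in \<open>auto intro: exI[of _ 0]\<close>)
  have all: "\<exists>l::int. u + m * t - l * c \<in> S" for m :: int
  proof (cases "m \<ge> 0")
    case True
    then show ?thesis using up[of "nat m"] by simp
  next
    case False
    then show ?thesis using dn[of "nat (-m)"] by simp
  qed
  \<comment> \<open>The first step of the orbit that reaches \<open>y\<close>; it lands in
    \<open>[y, y + h)\<close>, inside the avoided arc, although it is congruent modulo
    \<open>c\<close> to a point of \<open>S\<close>.\<close>
  define i :: int where "i = \<lceil>(y - u) / h\<rceil>"
  have i: "y \<le> u + i * h" "u + i * h < y + h"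
    using ceiling_divide_upper[OF h(2), of "y - u"] ceiling_divide_lower[OF h(2), of "y - u"]
    unfolding i_def by (auto simp: algebra_simps)
  obtain l :: int where l: "u + of_int (i * p) * t - l * c \<in> S" using all by blast
  define z where "z = u + i * h"
  define w where "w = u + of_int (i * p) * t - l * c"
  have zw: "z - w = of_int (i * q + l) * c" unfolding z_def w_def h(1) by (simp add: algebra_simps)
  have w: "x \<le> w" "w < y" using S l unfolding w_def by auto
  have r: "0 < z - w" "z - w < c" using w i le unfolding z_def by linarith+
  then have c: "0 < c" by linarith
  have "0 < i * q + l" using r(1) c unfolding zw
    by (simp add: zero_less_mult_iff del: of_int_add of_int_mult)
  then have "1 * c \<le> of_int (i * q + l) * c" using c by (intro mult_right_mono) linarith+
  then show False using r(2) unfolding zw by simp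
qed

text \<open>Once \<open>k\<close> or \<open>l\<close> is constant on \<open>S\<close>, the forward
  move is a rotation, by \<open>n\<close> modulo \<open>a\<close> or by \<open>- n * a\<close>
  modulo 1. All its integer combinations are kept in the conclusion: the rational case uses the
  smallest positive one, the irrational case arbitrarily small ones.\<close>

theorem invariant_set_cases:
  fixes a b :: real
  assumes a: "a < 1" and b: "a \<le> 2 * b" and S: "invariant_set a b S" and u0: "u0 \<in> S"
  obtains n :: nat where "n \<ge> 1"
      "\<And>(p::int) (q::int). p * real n + q * a > 0 \<Longrightarrow> 2 * \<bar>b - n\<bar> < p * real n + q * a"
    | n :: nat where "n \<ge> 1"
      "\<And>(p::int) (q::int). p * (n * a) + q > 0 \<Longrightarrow> 2 * \<bar>b - n * a\<bar> + 1 - a < p * (n * a) + q"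
proof -
  have Ssub: "S \<subseteq> {0..<a}" using S by (simp add: invariant_set_def)
  have "\<exists>K L. \<forall>u\<in>S. moves a S b u (K u) (L u)"
  proof -
    have "\<forall>u\<in>S. \<exists>K L. moves a S b u K L"
      using invariant_set_movesE[OF S, of _ b] by blast
    then show ?thesis by metis
  qed
  then obtain K L where KL: "\<And>u. u \<in> S \<Longrightarrow> moves a S b u (K u) (L u)" by blast
  note box = moves_box[OF S a _ KL]
  have preim: "\<exists>u'\<in>S. w = u' + K u' - L u' * a" if w: "w \<in> S" for w
  proof -
    obtain k l :: int where 1: "moves a S (-b) w k l"
      using invariant_set_movesE[OF S w, of "-b"] by auto
    let ?u = "w + k - l * a"
    have u: "?u \<in> S" using moves_in[OF 1] .
    have "K ?u = -k \<and> L ?u = -l"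
      using moves_return[OF S a _ w 1, of "K ?u" "L ?u"] KL[OF u] by simp
    then show ?thesis using u by (intro bexI[of _ ?u]) auto
  qed
  have "(\<forall>u\<in>S. K u = K u0) \<or> (\<forall>u\<in>S. L u = L u0)"
    using moves_dichotomy[OF S a _ KL _ KL] u0 by metis
  then show thesis
  proof
    assume K: "\<forall>u\<in>S. K u = K u0"
    define n where "n = K u0"
    have n: "K u = n" if "u \<in> S" for u using K that n_def by simp
    \<comment> \<open>With \<open>p = b - n\<close>, the box of \<open>w\<close> puts
      \<open>w - p\<close> into \<open>[0, a)\<close> and the box of its preimage puts
      \<open>w + p\<close> there.\<close>
    have Sx: "S \<subseteq> {\<bar>b - n\<bar>..<a - \<bar>b - n\<bar>}"
    proof
      fix w assume w: "w \<in> S"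
      from preim[OF w] obtain u' :: real where u': "u' \<in> S" "w = u' + K u' - L u' * a" by blast
      show "w \<in> {\<bar>b - n\<bar>..<a - \<bar>b - n\<bar>}"
        using box[OF w w] box[OF u'(1) u'(1)] u'(2)
        unfolding n[OF w] n[OF u'(1)] atLeastLessThan_iff by (intro conjI; linarith)
    qed
    \<comment> \<open>Since the interval around \<open>u0\<close> is nonempty, |b - n| < a / 2, and
      \<open>a / 2 \<le> b\<close>.\<close>
    have "0 < (of_int n :: real)" using subsetD[OF Sx u0] b unfolding atLeastLessThan_iff by linarith
    then have n0: "0 < n" by simp
    have "2 * \<bar>b - n\<bar> < p * real_of_int n + q * a" if "p * real_of_int n + q * a > 0" for p q :: int
    proof -
      have "a + \<bar>b - n\<bar> - (a - \<bar>b - n\<bar>) < p * real_of_int n + q * a"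
      proof (rule rotation_orbit_gap[OF Sx u0 _ _ refl that])
        fix u assume u: "u \<in> S"
        show "\<exists>l::int. u + n - l * a \<in> S" using moves_in[OF KL[OF u]] n[OF u] by auto
        from preim[OF u] obtain u' :: real where u': "u' \<in> S" "u = u' + K u' - L u' * a" by blast
        then have "u - n - of_int (- L u') * a = u'" using n[OF u'(1)] by simp
        then show "\<exists>l::int. u - n - l * a \<in> S" using u'(1) by metis
      qed
      then show ?thesis by simp
    qed
    then show thesis using n0 that(1)[of "nat n"] by auto
  next
    assume L: "\<forall>u\<in>S. L u = L u0"
    define n where "n = L u0"
    have n: "L u = n" if "u \<in> S" for u using L that n_def by simp
    have Sx: "S \<subseteq> {\<bar>b - n * a\<bar>..<a - \<bar>b - n * a\<bar>}"
    proof
      fix w assume w: "w \<in> S"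
      from preim[OF w] obtain u' :: real where u': "u' \<in> S" "w = u' + K u' - L u' * a" by blast
      show "w \<in> {\<bar>b - n * a\<bar>..<a - \<bar>b - n * a\<bar>}"
        using box[OF w w] box[OF u'(1) u'(1)] u'(2)
        unfolding n[OF w] n[OF u'(1)] atLeastLessThan_iff by (intro conjI; linarith)
    qed
    have a0: "0 < a" using Ssub u0 by auto
    have "0 < n * a" using subsetD[OF Sx u0] b unfolding atLeastLessThan_iff by linarith
    then have n0: "0 < n" using a0 by (simp add: zero_less_mult_iff)
    have "2 * \<bar>b - n * a\<bar> + 1 - a < p * (n * a) + q" if h: "p * (n * a) + q > 0" for p q :: int
    proof -
      have "1 + \<bar>b - n * a\<bar> - (a - \<bar>b - n * a\<bar>) < p * (n * a) + q"
      proof (rule rotation_orbit_gap[OF Sx u0 _ _ _ h])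
        show "p * (n * a) + q = p * (n * a) + of_int q * 1" by simp
        fix u assume u: "u \<in> S"
        \<comment> \<open>A forward move by \<open>n\<close> cells lowers the position by
          \<open>n * a\<close> modulo 1, so adding \<open>n * a\<close> leads back to the
          preimage.\<close>
        from preim[OF u] obtain u' :: real where u': "u' \<in> S" "u = u' + K u' - L u' * a" by blast
        then have "u + n * a - of_int (K u') * 1 = u'" using n[OF u'(1)] by simp
        then show "\<exists>l::int. u + n * a - of_int l * 1 \<in> S" using u'(1) by metis
        have "u - n * a - of_int (- K u) * 1 \<in> S" using moves_in[OF KL[OF u]] n[OF u] by (simp add: algebra_simps)
        then show "\<exists>l::int. u - n * a - of_int l * 1 \<in> S" by blast
      qed
      then show ?thesis by simp
    qed
    then show thesis using n0 that(2)[of "nat n"] by auto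
  qed
qed

section \<open>Haar windows on sequences\<close>

text \<open>Sums with values in \<open>[0, \<infinity>]\<close> exist without summability conditions
  and interchange with each other and with integrals.\<close>

abbreviation esum :: "('i \<Rightarrow> ennreal) \<Rightarrow> ennreal" where
  "esum g \<equiv> \<integral>\<^sup>+i. g i \<partial>count_space UNIV"

definition sqn :: "complex \<Rightarrow> ennreal" where
  "sqn z = ennreal ((cmod z)\<^sup>2)"

definition window_sum :: "(int \<Rightarrow> complex) \<Rightarrow> real \<Rightarrow> real \<Rightarrow> complex" where
  "window_sum c p q = (\<Sum>k\<in>{\<lceil>p\<rceil>..<\<lceil>q\<rceil>}. c k)"

definition haar_row :: "real \<Rightarrow> real \<Rightarrow> real \<Rightarrow> (int \<Rightarrow> complex) \<Rightarrow> int \<Rightarrow> complex" where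
  "haar_row a b y c i =
     window_sum c (i * a - y) (i * a - y + b) - window_sum c (i * a - y - b) (i * a - y)"

lemma esum_mono: "(\<And>i. f i \<le> g i) \<Longrightarrow> esum f \<le> esum g"
  by (intro nn_integral_mono) auto

lemma esum_add: "esum (\<lambda>i. f i + g i) = esum f + esum g"
  by (intro nn_integral_add) auto

lemma esum_cmult: "esum (\<lambda>i. c * f i) = c * esum f"
  by (intro nn_integral_cmult) auto

lemma esum_shift: "esum (\<lambda>i::int. g (i + k)) = esum g"
  by (rule nn_integral_bij_count_space) (intro bij_betwI[where g="\<lambda>i. i - k"]; auto)

lemma esum_inj_le:
  assumes "inj_on T A"
  shows "esum (\<lambda>i. if i \<in> A then g (T i) else 0) \<le> esum g"
proof -
  have "esum (\<lambda>i. if i \<in> A then g (T i) else 0) = (\<integral>\<^sup>+i. g (T i) \<partial>count_space A)"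
    by (subst nn_integral_count_space_indicator) (auto intro!: nn_integral_cong simp: indicator_def)
  also have "\<dots> = (\<integral>\<^sup>+i. g i \<partial>count_space (T ` A))"
    by (rule nn_integral_bij_count_space) (use assms in \<open>simp add: bij_betw_def\<close>)
  also have "\<dots> \<le> esum g"
    by (subst nn_integral_count_space_indicator)
       (auto intro!: nn_integral_mono simp: indicator_def)
  finally show ?thesis .
qed

lemma sqn_le: "cmod z \<le> cmod w \<Longrightarrow> sqn z \<le> sqn w"
  unfolding sqn_def by (intro ennreal_leI power_mono) auto

lemma sqn_0[simp]: "sqn 0 = 0" by (simp add: sqn_def)

lemma sqn_mult: "sqn (z * w) = sqn z * sqn w"
  by (simp add: sqn_def norm_mult power_mult_distrib ennreal_mult)

lemma sqn_add_le: "sqn (z + w) \<le> 2 * sqn z + 2 * sqn w"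
proof -
  have "(cmod (z + w))\<^sup>2 \<le> (cmod z + cmod w)\<^sup>2" by (intro power_mono norm_triangle_ineq) auto
  also have "\<dots> \<le> 2 * (cmod z)\<^sup>2 + 2 * (cmod w)\<^sup>2"
    using sum_squares_bound[of "cmod z" "cmod w"] by (simp add: power2_sum)
  finally have "ennreal ((cmod (z + w))\<^sup>2) \<le> ennreal (2 * (cmod z)\<^sup>2 + 2 * (cmod w)\<^sup>2)"
    by (rule ennreal_leI)
  also have "\<dots> = 2 * sqn z + 2 * sqn w"
    by (simp add: sqn_def ennreal_plus ennreal_mult)
  finally show ?thesis by (simp add: sqn_def)
qed

lemma sqn_minus_commute: "sqn (z - w) = sqn (w - z)"
  by (simp add: sqn_def norm_minus_commute)

lemma sqn_diff_le: "sqn (z - w) \<le> 2 * sqn z + 2 * sqn w"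
  using sqn_add_le[of z "-w"] by (simp add: sqn_def)

lemma sqn_sum_le:
  assumes "finite A"
  shows "sqn (\<Sum>k\<in>A. f k) \<le> of_nat (card A) * (\<Sum>k\<in>A. sqn (f k))"
proof -
  have "(cmod (\<Sum>k\<in>A. f k))\<^sup>2 \<le> (\<Sum>k\<in>A. cmod (f k))\<^sup>2"
    by (intro power_mono norm_sum) auto
  also have "\<dots> \<le> card A * (\<Sum>k\<in>A. (cmod (f k))\<^sup>2)"
    using sum_squared_le_sum_of_squares[of "\<lambda>k. cmod (f k)" A] by (simp add: mult.commute)
  finally have "sqn (\<Sum>k\<in>A. f k) \<le> ennreal (card A * (\<Sum>k\<in>A. (cmod (f k))\<^sup>2))"
    unfolding sqn_def by (rule ennreal_leI)
  also have "\<dots> = of_nat (card A) * (\<Sum>k\<in>A. sqn (f k))"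
    by (simp add: sqn_def ennreal_mult sum_nonneg sum_ennreal ennreal_of_nat_eq_real_of_nat)
  finally show ?thesis .
qed

lemma window_sum_split:
  fixes p q r :: real
  assumes "p \<le> q" "q \<le> r"
  shows "window_sum c p r = window_sum c p q + window_sum c q r"
proof -
  have "{\<lceil>p\<rceil>..<\<lceil>r\<rceil>} = {\<lceil>p\<rceil>..<\<lceil>q\<rceil>} \<union> {\<lceil>q\<rceil>..<\<lceil>r\<rceil>}"
    using ceiling_mono[OF assms(1)] ceiling_mono[OF assms(2)] by (intro ivl_disj_un_two(3)[symmetric])
  then show ?thesis unfolding window_sum_def by (simp add: sum.union_disjoint)
qed

text \<open>The row centres cut the line into cells of length \<open>a \<le> 1\<close>, hence with at most one integer.
  \<open>cell_left j\<close> is the left end of the cell of \<open>j\<close>, and \<open>target d j\<close> is the only candidate for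
  an integer in that cell shifted by \<open>d\<close>.\<close>

locale cells =
  fixes a b y :: real
  assumes a: "0 < a" "a \<le> 1" and b: "0 < b"
begin

definition cell_index :: "int \<Rightarrow> int" where
  "cell_index j = \<lfloor>(j + y) / a\<rfloor>"

definition cell_left :: "int \<Rightarrow> real" where
  "cell_left j = cell_index j * a - y"

definition target :: "real \<Rightarrow> int \<Rightarrow> int" where
  "target d j = \<lceil>cell_left j + d\<rceil>"

definition hits :: "real \<Rightarrow> int \<Rightarrow> bool" where
  "hits d j \<longleftrightarrow> target d j < cell_left j + d + a"

text \<open>The entry of \<open>g\<close> in the cell of \<open>j\<close> shifted by
  \<open>d\<close>, with 0 for an empty cell. A missed target is therefore informative: there
  \<open>c j - pull d c j\<close> is \<open>c j\<close> itself.\<close>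

definition pull :: "real \<Rightarrow> (int \<Rightarrow> 'v::zero) \<Rightarrow> int \<Rightarrow> 'v" where
  "pull d g j = (if hits d j then g (target d j) else 0)"

lemma cell_left_bounds:
  fixes j :: int
  shows "cell_left j \<le> j" "j < cell_left j + a"
  using floor_divide_lower[OF a(1), of "j + y"] floor_divide_upper[OF a(1), of "j + y"]
  unfolding cell_left_def cell_index_def by (auto simp: algebra_simps)

lemma target_bounds:
  fixes d :: real
  shows "cell_left j + d \<le> target d j" "target d j < cell_left j + d + 1"
  unfolding target_def by linarith+

lemma cell_left_less:
  assumes "j < j'"
  shows "cell_left j + a \<le> cell_left j'"
proof -
  have "cell_index j < cell_index j'"
  proof (rule ccontr)
    assume "\<not> cell_index j < cell_index j'"
    then have "cell_index j' * a \<le> cell_index j * a" using a by (intro mult_right_mono) linarith+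
    then show False
      using cell_left_bounds[of j] cell_left_bounds[of j'] assms a unfolding cell_left_def by linarith
  qed
  then have "of_int (cell_index j + 1) * a \<le> cell_index j' * a" using a by (intro mult_right_mono) linarith+
  then show ?thesis unfolding cell_left_def by (simp add: algebra_simps)
qed

lemma inj_cell_index: "inj cell_index"
proof (rule injI)
  fix j j' assume "cell_index j = cell_index j'"
  then show "j = j'" using cell_left_less[of j j'] cell_left_less[of j' j] a
    unfolding cell_left_def by (cases j j' rule: linorder_cases) auto
qed

text \<open>The target of \<open>j\<close> lies in its own shifted cell, and that of
  \<open>j'\<close> at or beyond the start of a later one. Strict monotonicity gives injectivity,
  which keeps \<open>pull\<close> from increasing sums.\<close>

lemma target_less: "hits d j \<Longrightarrow> j < j' \<Longrightarrow> target d j < target d j'"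
  using cell_left_less[of j j'] target_bounds[where d=d and j=j'] unfolding hits_def by linarith

lemma inj_target: "inj_on (target d) {j. hits d j}"
proof (rule inj_onI)
  fix j j' assume "j \<in> {j. hits d j}" "j' \<in> {j. hits d j}" "target d j = target d j'"
  then show "j = j'" using target_less[of d j j'] target_less[of d j' j]
    by (cases j j' rule: linorder_cases) auto
qed

lemma esum_pull: "esum (pull d g) \<le> esum g"
  using esum_inj_le[OF inj_target, of d g] by (simp add: pull_def[abs_def])

lemma esum_sqn_pull: "esum (\<lambda>j. sqn (pull d c j)) \<le> esum (\<lambda>j. sqn (c j))"
proof -
  have "(\<lambda>j. sqn (pull d c j)) = pull d (\<lambda>j. sqn (c j))"
    by (auto simp: pull_def fun_eq_iff)
  then show ?thesis using esum_pull[of d "\<lambda>j. sqn (c j)"] by simp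
qed

lemma window_sum_cell: "window_sum c (cell_left j + d) (cell_left j + d + a) = pull d c j"
proof (cases "hits d j")
  case True
  have "{\<lceil>cell_left j + d\<rceil>..<\<lceil>cell_left j + d + a\<rceil>} = {target d j}"
  proof -
    have "\<lceil>cell_left j + d + a\<rceil> = target d j + 1"
      using True target_bounds[where d=d and j=j] a unfolding hits_def by linarith
    then show ?thesis by (auto simp: target_def)
  qed
  then show ?thesis using True by (simp add: window_sum_def pull_def)
next
  case False
  then have "\<lceil>cell_left j + d + a\<rceil> \<le> target d j" unfolding hits_def by linarith
  then show ?thesis using False by (simp add: window_sum_def pull_def target_def)
qed

lemma pull_0: "pull 0 c j = c j"
proof -
  have "target 0 j = j"
    using cell_left_bounds[of j] a unfolding target_def by linarith
  then show ?thesis using cell_left_bounds[of j] by (simp add: pull_def hits_def)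
qed

text \<open>When the centre advances by one cell, each half-window gains a cell at its right end and
  loses one at its left end. The central cell is lost by the positive half and gained by the
  negative one, whence the coefficient -2.\<close>

lemma row_difference:
  "haar_row a b y c (cell_index j + 1) - haar_row a b y c (cell_index j) =
     pull b c j + pull (-b) c j - 2 * c j"
proof -
  define s where "s = cell_left j"
  have s: "cell_index j * a - y = s" "of_int (cell_index j + 1) * a - y = s + a"
    by (auto simp: s_def cell_left_def algebra_simps)
  \<comment> \<open>Both sides sum over \<open>[p, q + a)\<close>, so the window may also be shorter
    than the cell.\<close>
  have *: "window_sum c (p + a) (q + a) + window_sum c p (p + a) = window_sum c p q + window_sum c q (q + a)"
    if "p \<le> q" for p q
    using window_sum_split[of p "p + a" "q + a" c] window_sum_split[of p q "q + a" c] that a by simp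
  have 1: "window_sum c (s + a) (s + b + a) + window_sum c s (s + a) = window_sum c s (s + b) + window_sum c (s + b) (s + b + a)"
    using *[of s "s + b"] b by simp
  have 2: "window_sum c (s - b + a) (s + a) + window_sum c (s - b) (s - b + a) = window_sum c (s - b) s + window_sum c s (s + a)"
    using *[of "s - b" s] b by simp
  have 3: "window_sum c s (s + a) = c j" "window_sum c (s + b) (s + b + a) = pull b c j"
    "window_sum c (s - b) (s - b + a) = pull (-b) c j"
    using window_sum_cell[of c j 0] window_sum_cell[of c j b] window_sum_cell[of c j "-b"] pull_0
    unfolding s_def by auto
  have e: "s + a + b = s + b + a" "s + a - b = s - b + a" by auto
  show ?thesis unfolding haar_row_def s e
    using 1 2 unfolding 3 by (simp add: algebra_simps)
qed

definition defect :: "(int \<Rightarrow> complex) \<Rightarrow> int \<Rightarrow> ennreal" where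
  "defect c j = sqn (c j - pull b c j) + sqn (c j - pull (-b) c j)"

lemma esum_second_difference:
  "esum (\<lambda>j. sqn (pull b c j + pull (-b) c j - 2 * c j)) \<le> 4 * esum (\<lambda>i. sqn (haar_row a b y c i))"
proof -
  let ?r = "haar_row a b y c"
  have "esum (\<lambda>j. sqn (pull b c j + pull (-b) c j - 2 * c j))
      = esum (\<lambda>j. sqn (?r (cell_index j + 1) - ?r (cell_index j)))"
    by (simp add: row_difference)
  also have "\<dots> \<le> esum (\<lambda>i. sqn (?r (i + 1) - ?r i))"
    using esum_inj_le[OF inj_cell_index, of "\<lambda>i. sqn (?r (i + 1) - ?r i)"] by simp
  also have "\<dots> \<le> esum (\<lambda>i. 2 * sqn (?r (i + 1)) + 2 * sqn (?r i))"
    by (intro esum_mono sqn_diff_le)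
  also have "\<dots> = 2 * esum (\<lambda>i. sqn (?r (i + 1))) + 2 * esum (\<lambda>i. sqn (?r i))"
    by (simp only: esum_add esum_cmult)
  also have "\<dots> = 4 * esum (\<lambda>i. sqn (?r i))"
    unfolding esum_shift[of "\<lambda>i. sqn (?r i)" 1] distrib_right[symmetric] by simp
  finally show ?thesis .
qed

text \<open>With \<open>e = u + v - 2 * z\<close>, expansion turns the left side into |u|^2 + |v|^2
  minus twice the inner product of \<open>z\<close> and \<open>e\<close>. That product is split by
  Young's inequality with weight \<open>\<eta>\<close>.\<close>

lemma defect_pointwise:
  fixes z u v :: complex
  assumes "\<eta> > 0"
  shows "(cmod (z - u))\<^sup>2 + (cmod (z - v))\<^sup>2 + 2 * (cmod z)\<^sup>2 \<le>
    (cmod u)\<^sup>2 + (cmod v)\<^sup>2 + \<eta> * (cmod z)\<^sup>2 + (cmod (u + v - 2 * z))\<^sup>2 / \<eta>"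
proof -
  define e where "e = u + v - 2 * z"
  have "(cmod (z - u))\<^sup>2 + (cmod (z - v))\<^sup>2 + 2 * (cmod z)\<^sup>2 =
      (cmod u)\<^sup>2 + (cmod v)\<^sup>2 - 2 * (z \<bullet> e)"
    unfolding e_def cmod_power2 inner_complex_def by (simp add: algebra_simps power2_eq_square)
  moreover have "- 2 * (z \<bullet> e) \<le> 2 * (cmod z * cmod e)"
    using norm_cauchy_schwarz[of z "-e"] by (simp add: mult.commute)
  moreover have "2 * (cmod z * cmod e) \<le> \<eta> * (cmod z)\<^sup>2 + (cmod e)\<^sup>2 / \<eta>"
  proof -
    have "0 \<le> (sqrt \<eta> * cmod z - cmod e / sqrt \<eta>)\<^sup>2" by simp
    also have "\<dots> = \<eta> * (cmod z)\<^sup>2 + (cmod e)\<^sup>2 / \<eta> - 2 * (cmod z * cmod e)"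
      using assms by (simp add: power2_diff power_mult_distrib power_divide field_simps)
    finally show ?thesis by simp
  qed
  ultimately show ?thesis unfolding e_def by linarith
qed

text \<open>After summation the two pulled terms contribute at most twice the norm of
  \<open>c\<close>, which cancels against \<open>2 * sqn (c j)\<close> on the left; finiteness of
  the norm is what permits the cancellation. What remains is the second difference, controlled by
  four times the rows.\<close>

lemma esum_defect:
  assumes fin: "esum (\<lambda>j. sqn (c j)) < \<infinity>" and "\<eta> > 0"
  shows "esum (defect c) \<le> ennreal \<eta> * esum (\<lambda>j. sqn (c j))
           + ennreal (4 / \<eta>) * esum (\<lambda>i. sqn (haar_row a b y c i))"
proof -
  let ?N = "esum (\<lambda>j. sqn (c j))" and ?R = "esum (\<lambda>i. sqn (haar_row a b y c i))"
  let ?e = "\<lambda>j. pull b c j + pull (-b) c j - 2 * c j"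
  have pw: "defect c j + 2 * sqn (c j) \<le> sqn (pull b c j) + sqn (pull (-b) c j)
      + (ennreal \<eta> * sqn (c j) + ennreal (1 / \<eta>) * sqn (?e j))" for j
  proof -
    have "defect c j + 2 * sqn (c j) = ennreal ((cmod (c j - pull b c j))\<^sup>2
        + (cmod (c j - pull (-b) c j))\<^sup>2 + 2 * (cmod (c j))\<^sup>2)"
      by (simp add: defect_def sqn_def ennreal_plus ennreal_mult)
    also have "\<dots> \<le> ennreal ((cmod (pull b c j))\<^sup>2 + (cmod (pull (-b) c j))\<^sup>2
        + \<eta> * (cmod (c j))\<^sup>2 + (cmod (?e j))\<^sup>2 / \<eta>)"
      by (intro ennreal_leI defect_pointwise assms)
    also have "\<dots> = ennreal ((cmod (pull b c j))\<^sup>2 + (cmod (pull (-b) c j))\<^sup>2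
        + (\<eta> * (cmod (c j))\<^sup>2 + 1 / \<eta> * (cmod (?e j))\<^sup>2))"
      by (simp add: add.assoc)
    also have "\<dots> = sqn (pull b c j) + sqn (pull (-b) c j)
      + (ennreal \<eta> * sqn (c j) + ennreal (1 / \<eta>) * sqn (?e j))"
      unfolding sqn_def using \<open>\<eta> > 0\<close> by (simp add: ennreal_plus flip: ennreal_mult)
    finally show ?thesis .
  qed
  have "2 * ?N + esum (defect c) = esum (\<lambda>j. defect c j + 2 * sqn (c j))"
    by (simp only: esum_add esum_cmult add.commute)
  also have "\<dots> \<le> esum (\<lambda>j. sqn (pull b c j) + sqn (pull (-b) c j)
      + (ennreal \<eta> * sqn (c j) + ennreal (1 / \<eta>) * sqn (?e j)))"
    by (intro esum_mono pw)
  also have "\<dots> = esum (\<lambda>j. sqn (pull b c j)) + esum (\<lambda>j. sqn (pull (-b) c j))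
      + (ennreal \<eta> * ?N + ennreal (1 / \<eta>) * esum (\<lambda>j. sqn (?e j)))"
    by (simp only: esum_add esum_cmult)
  also have "\<dots> \<le> ?N + ?N + (ennreal \<eta> * ?N + ennreal (1 / \<eta>) * (4 * ?R))"
    by (intro add_mono order_refl mult_left_mono esum_sqn_pull esum_second_difference) auto
  also have "\<dots> = 2 * ?N + (ennreal \<eta> * ?N + ennreal (4 / \<eta>) * ?R)"
  proof -
    have "ennreal (4 / \<eta>) = ennreal (1 / \<eta>) * 4"
      using \<open>\<eta> > 0\<close> by (subst ennreal_numeral[symmetric], subst ennreal_mult[symmetric]) auto
    then show ?thesis by (simp add: mult.assoc mult_2)
  qed
  finally show ?thesis
    by (rule ennreal_add_left_cancel_le[THEN iffD1, THEN disjE])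
       (use fin in \<open>auto simp: ennreal_mult_eq_top_iff\<close>)
qed

end

section \<open>Norm bounds for the rows\<close>

lemma absorb_bound:
  fixes N R \<Delta> :: ennreal and K C :: real
  assumes fin: "N < \<infinity>" and K: "K > 0" "C \<ge> 0"
    and N: "N \<le> ennreal C * R + ennreal K * \<Delta>"
    and \<Delta>: "\<And>\<eta>. \<eta> > 0 \<Longrightarrow> \<Delta> \<le> ennreal \<eta> * N + ennreal (4 / \<eta>) * R"
  shows "N \<le> ennreal (2 * C + 16 * K\<^sup>2) * R"
proof (cases "R = \<infinity>")
  case True
  have "2 * C + 16 * K\<^sup>2 > 0" using K by (intro add_nonneg_pos) auto
  then show ?thesis using True by (simp add: ennreal_mult_top)
next
  case False
  define n where "n = enn2real N"
  define r where "r = enn2real R"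
  have n: "N = ennreal n" "n \<ge> 0" using fin by (auto simp: n_def)
  have r: "R = ennreal r" "r \<ge> 0" using False by (auto simp: r_def less_top)
  \<comment> \<open>This weight makes \<open>K * \<eta> * n = n / 2\<close>, which is absorbed on
    the left; doubling the rest \<open>K * 4 / \<eta> = 8 * K\<^sup>2\<close> gives the 16.\<close>
  define \<eta> where "\<eta> = 1 / (2 * K)"
  have \<eta>: "\<eta> > 0" using K by (simp add: \<eta>_def)
  have "N \<le> ennreal C * R + ennreal K * (ennreal \<eta> * N + ennreal (4 / \<eta>) * R)"
    by (rule order_trans[OF N]) (intro add_mono order_refl mult_left_mono \<Delta> \<eta>, simp)
  also have "\<dots> = ennreal (C * r + K * (\<eta> * n + 4 / \<eta> * r))"
    unfolding n(1) r(1) using n(2) r(2) K \<eta> by (simp flip: ennreal_plus ennreal_mult)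
  finally have "n \<le> C * r + K * (\<eta> * n + 4 / \<eta> * r)"
    unfolding n(1) using n(2) r(2) K \<eta> by (subst (asm) ennreal_le_iff) auto
  then have "n \<le> (2 * C + 16 * K\<^sup>2) * r"
  proof -
    have "K * (\<eta> * n + 4 / \<eta> * r) = n / 2 + 8 * K\<^sup>2 * r"
      unfolding \<eta>_def using K by (simp add: field_simps power2_eq_square)
    then show ?thesis using \<open>n \<le> C * r + K * (\<eta> * n + 4 / \<eta> * r)\<close> by (simp add: algebra_simps)
  qed
  then show ?thesis
    unfolding n(1) r(1) using r(2) K by (subst ennreal_mult[symmetric]) (auto intro: ennreal_leI)
qed

text \<open>The recursion is that of the norm of \<open>energy\<close>: two pulls, each taken twice.
  The start value is 1 because the absorption argument needs a positive constant.\<close>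

fun death_const :: "nat \<Rightarrow> real" where
  "death_const 0 = 1"
| "death_const (Suc L) = 2 + 4 * death_const L"

lemma death_const_pos: "death_const L > 0"
  by (induction L) auto

context cells
begin

text \<open>Passing from \<open>j\<close> to \<open>target d j\<close> changes the position in the
  cell by \<open>k - l * a\<close>, with \<open>l\<close> the difference of the cell indices, so
  integers follow the moves of \<open>survives\<close>. The offset \<open>y\<close> cancels.\<close>

lemma hits_survives:
  assumes "\<not> survives a b (Suc L) (j - cell_left j)"
  shows "\<exists>d. (d = b \<or> d = -b) \<and> (hits d j \<longrightarrow> \<not> survives a b L (target d j - cell_left (target d j)))"
proof -
  have "\<exists>(k::int) (l::int). 0 \<le> j - cell_left j + k - d \<and> j - cell_left j + k - d < a \<and>
      survives a b L (j - cell_left j + k - l * a)"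
    if h: "hits d j" and s: "survives a b L (target d j - cell_left (target d j))" for d
  proof (intro exI conjI)
    define k l where "k = target d j - j" and "l = cell_index (target d j) - cell_index j"
    show "0 \<le> j - cell_left j + k - d" "j - cell_left j + k - d < a"
      using h target_bounds[where d=d and j=j] unfolding hits_def k_def by auto
    have "j - cell_left j + k - l * a = target d j - cell_left (target d j)"
      unfolding k_def l_def cell_left_def by (simp add: algebra_simps)
    then show "survives a b L (j - cell_left j + k - l * a)" using s by simp
  qed
  note * = this
  have r: "0 \<le> j - cell_left j" "j - cell_left j < a" using cell_left_bounds[of j] by auto
  show ?thesis
  proof (rule ccontr)
    assume "\<not> ?thesis"
    then have "hits b j \<and> survives a b L (target b j - cell_left (target b j))"
      "hits (-b) j \<and> survives a b L (target (-b) j - cell_left (target (-b) j))"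
      by blast+
    then have "\<forall>d\<in>{b, -b}. \<exists>(k::int) (l::int). 0 \<le> j - cell_left j + k - d \<and> j - cell_left j + k - d < a \<and>
      survives a b L (j - cell_left j + k - l * a)"
      using *[of b] *[of "-b"] by blast
    then show False using assms r unfolding survives.simps by blast
  qed
qed

text \<open>The defects collected along all sequences of fewer than \<open>L\<close> further moves,
  with weights. Both directions are included, so that no choice of a dying direction has to be
  tracked. Depth 0 collects nothing, as every position in a cell survives zero steps.\<close>

primrec energy :: "(int \<Rightarrow> complex) \<Rightarrow> nat \<Rightarrow> int \<Rightarrow> ennreal" where
  "energy c 0 = (\<lambda>j. 0)"
| "energy c (Suc L) = (\<lambda>j. 2 * defect c j + 2 * (pull b (energy c L) j + pull (-b) (energy c L) j))"

text \<open>In the dying direction either the target is missed and the defect alone bounds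
  \<open>c j\<close>, or \<open>c j\<close> is compared with \<open>c\<close> at the target, where
  the induction hypothesis applies.\<close>

lemma sqn_le_energy:
  assumes "\<not> survives a b L (j - cell_left j)"
  shows "sqn (c j) \<le> energy c L j"
  using assms
proof (induction L arbitrary: j)
  case 0
  then show ?case using cell_left_bounds[of j] by simp
next
  case (Suc L)
  obtain d where d: "d = b \<or> d = -b" "hits d j \<Longrightarrow> \<not> survives a b L (target d j - cell_left (target d j))"
    using hits_survives[OF Suc.prems] by blast
  have "sqn (c j) = sqn ((c j - pull d c j) + pull d c j)" by simp
  also have "\<dots> \<le> 2 * sqn (c j - pull d c j) + 2 * sqn (pull d c j)" by (rule sqn_add_le)
  also have "\<dots> \<le> 2 * defect c j + 2 * pull d (energy c L) j"
  proof (intro add_mono mult_left_mono)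
    show "sqn (c j - pull d c j) \<le> defect c j" using d(1) unfolding defect_def by auto
    show "sqn (pull d c j) \<le> pull d (energy c L) j"
      using Suc.IH[OF d(2)] by (auto simp: pull_def)
  qed auto
  also have "\<dots> \<le> energy c (Suc L) j" using d(1) by (auto intro!: add_mono mult_left_mono)
  finally show ?case .
qed

lemma esum_energy: "esum (energy c L) \<le> ennreal (death_const L) * esum (defect c)"
proof (induction L)
  case (Suc L)
  have "esum (energy c (Suc L)) = 2 * esum (defect c) + 2 * (esum (pull b (energy c L)) + esum (pull (-b) (energy c L)))"
    by (simp only: energy.simps esum_add esum_cmult)
  also have "\<dots> \<le> 2 * esum (defect c) + 2 * (ennreal (death_const L) * esum (defect c) + ennreal (death_const L) * esum (defect c))"
    by (intro add_mono mult_left_mono order_refl order_trans[OF esum_pull Suc.IH]) auto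
  also have "\<dots> = (2 + 4 * ennreal (death_const L)) * esum (defect c)"
    by (simp add: algebra_simps flip: mult_2)
  also have "2 + 4 * ennreal (death_const L) = ennreal (death_const (Suc L))"
    using death_const_pos[of L] by (simp add: ennreal_plus ennreal_mult)
  finally show ?case .
qed simp

lemma lower_bound_no_survivors:
  assumes L: "\<And>u. \<not> survives a b L u" and fin: "esum (\<lambda>j. sqn (c j)) < \<infinity>"
  shows "esum (\<lambda>j. sqn (c j)) \<le> ennreal (16 * (death_const L)\<^sup>2) * esum (\<lambda>i. sqn (haar_row a b y c i))"
proof -
  have "esum (\<lambda>j. sqn (c j)) \<le> esum (energy c L)"
    by (intro esum_mono sqn_le_energy L)
  also have "\<dots> \<le> ennreal (death_const L) * esum (defect c)" by (rule esum_energy)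
  finally have "esum (\<lambda>j. sqn (c j)) \<le> ennreal 0 * esum (\<lambda>i. sqn (haar_row a b y c i)) + ennreal (death_const L) * esum (defect c)"
    by simp
  from absorb_bound[OF fin death_const_pos _ this esum_defect[OF fin]] show ?thesis by simp
qed

end

section \<open>Upper bounds for the rows\<close>

lemma card_int_interval_le:
  fixes x w :: real
  shows "finite {i::int. x < i \<and> i \<le> x + w} \<and> card {i::int. x < i \<and> i \<le> x + w} \<le> nat \<lceil>w\<rceil> + 1"
proof -
  have "{i::int. x < i \<and> i \<le> x + w} \<subseteq> {\<lfloor>x\<rfloor> + 1..\<lfloor>x\<rfloor> + \<lceil>w\<rceil> + 1}"
  proof
    fix i :: int assume "i \<in> {i::int. x < i \<and> i \<le> x + w}"
    then have "x < i" "i \<le> x + w" by auto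
    then show "i \<in> {\<lfloor>x\<rfloor> + 1..\<lfloor>x\<rfloor> + \<lceil>w\<rceil> + 1}" by auto linarith+
  qed
  moreover have "card {\<lfloor>x\<rfloor> + 1..\<lfloor>x\<rfloor> + \<lceil>w\<rceil> + 1} \<le> nat \<lceil>w\<rceil> + 1"
    by simp
  ultimately show ?thesis
    by (meson card_mono finite_atLeastAtMost_int finite_subset order_trans)
qed

text \<open>A Schur test: the first factor counts the integers in one window and enters through
  Cauchy-Schwarz, the second counts the windows containing a given integer.\<close>

lemma esum_window_sum_le:
  fixes a p q :: real
  assumes a: "0 < a" and pq: "p \<le> q"
  shows "esum (\<lambda>i::int. sqn (window_sum c (i * a + p) (i * a + q)))
    \<le> of_nat ((nat \<lceil>q - p\<rceil> + 1) * (nat \<lceil>(q - p) / a\<rceil> + 1)) * esum (\<lambda>k. sqn (c k))"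
proof -
  define W where "W i = {\<lceil>of_int i * a + p\<rceil>..<\<lceil>of_int i * a + q\<rceil>}" for i :: int
  define M where "M = nat \<lceil>q - p\<rceil> + 1"
  define M' where "M' = nat \<lceil>(q - p) / a\<rceil> + 1"
  have W: "k \<in> W i \<longleftrightarrow> (k - q) / a < i \<and> i \<le> (k - q) / a + (q - p) / a" for i k :: int
  proof -
    have "k \<in> W i \<longleftrightarrow> i * a + p \<le> k \<and> k < i * a + q"
      unfolding W_def by (simp add: ceiling_le_iff less_ceiling_iff)
    moreover have "k < i * a + q \<longleftrightarrow> (k - q) / a < i" using a by (simp add: pos_divide_less_eq algebra_simps)
    moreover have "i * a + p \<le> k \<longleftrightarrow> i \<le> (k - p) / a" using a by (simp add: pos_le_divide_eq algebra_simps)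
    moreover have "(k - p) / a = (k - q) / a + (q - p) / a" by (simp flip: add_divide_distrib)
    ultimately show ?thesis by auto
  qed
  have cW: "card (W i) \<le> M" for i
    unfolding W_def M_def card_atLeastLessThan_int by linarith
  have "esum (\<lambda>i::int. sqn (window_sum c (i * a + p) (i * a + q)))
      \<le> esum (\<lambda>i. of_nat M * esum (\<lambda>k. if k \<in> W i then sqn (c k) else 0))"
  proof (rule esum_mono)
    fix i :: int
    have fin: "finite (W i)" by (simp add: W_def)
    have "sqn (window_sum c (i * a + p) (i * a + q)) \<le> of_nat (card (W i)) * (\<Sum>k\<in>W i. sqn (c k))"
      using sqn_sum_le[OF fin, of c] by (simp add: window_sum_def W_def)
    also have "\<dots> \<le> of_nat M * (\<Sum>k\<in>W i. sqn (c k))"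
      by (intro mult_right_mono of_nat_mono cW) auto
    also have "(\<Sum>k\<in>W i. sqn (c k)) = esum (\<lambda>k. if k \<in> W i then sqn (c k) else 0)"
      using fin by (subst nn_integral_count_space'[of "W i"]) auto
    finally show "sqn (window_sum c (i * a + p) (i * a + q)) \<le> of_nat M * esum (\<lambda>k. if k \<in> W i then sqn (c k) else 0)" .
  qed
  also have "\<dots> = of_nat M * esum (\<lambda>k. esum (\<lambda>i. if k \<in> W i then sqn (c k) else 0))"
    unfolding esum_cmult
    using nn_integral_fst_count_space[of "\<lambda>(i, k). if k \<in> W i then sqn (c k) else 0"]
      nn_integral_snd_count_space[of "\<lambda>(i, k). if k \<in> W i then sqn (c k) else 0"] by simp
  also have "\<dots> \<le> of_nat M * esum (\<lambda>k. of_nat M' * sqn (c k))"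
  proof (intro mult_left_mono esum_mono)
    fix k :: int
    define I where "I = {i. k \<in> W i}"
    have I: "finite I" "card I \<le> M'"
      using card_int_interval_le[of "(k - q) / a" "(q - p) / a"] unfolding I_def W M'_def by auto
    have "esum (\<lambda>i. if k \<in> W i then sqn (c k) else 0) = (\<Sum>i\<in>I. sqn (c k))"
      using I(1) by (subst nn_integral_count_space'[of I]) (auto simp: I_def)
    also have "\<dots> = of_nat (card I) * sqn (c k)" by simp
    also have "\<dots> \<le> of_nat M' * sqn (c k)" using I(2) by (intro mult_right_mono of_nat_mono) auto
    finally show "esum (\<lambda>i. if k \<in> W i then sqn (c k) else 0) \<le> of_nat M' * sqn (c k)" .
  qed auto
  also have "\<dots> = of_nat (M * M') * esum (\<lambda>k. sqn (c k))"
    unfolding esum_cmult by (simp add: mult.assoc)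
  finally show ?thesis unfolding M_def M'_def .
qed

lemma haar_row_upper_bound:
  fixes a b y :: real
  assumes "0 < a" "0 < b"
  shows "esum (\<lambda>i. sqn (haar_row a b y c i))
    \<le> of_nat (4 * ((nat \<lceil>b\<rceil> + 1) * (nat \<lceil>b / a\<rceil> + 1))) * esum (\<lambda>k. sqn (c k))"
proof -
  have "esum (\<lambda>i. sqn (haar_row a b y c i))
     \<le> esum (\<lambda>i::int. 2 * sqn (window_sum c (i * a + - y) (i * a + (b - y)))
        + 2 * sqn (window_sum c (i * a + (- b - y)) (i * a + - y)))"
  proof (rule esum_mono)
    fix i :: int
    have "i * a - y = i * a + - y" "i * a - y + b = i * a + (b - y)" "i * a - y - b = i * a + (- b - y)" by auto
    then show "sqn (haar_row a b y c i) \<le> 2 * sqn (window_sum c (i * a + - y) (i * a + (b - y)))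
        + 2 * sqn (window_sum c (i * a + (- b - y)) (i * a + - y))"
      unfolding haar_row_def by (metis sqn_diff_le)
  qed
  also have "\<dots> = 2 * esum (\<lambda>i::int. sqn (window_sum c (i * a + - y) (i * a + (b - y))))
        + 2 * esum (\<lambda>i::int. sqn (window_sum c (i * a + (- b - y)) (i * a + - y)))"
    by (simp only: esum_add esum_cmult)
  also have "\<dots> \<le> 2 * (of_nat ((nat \<lceil>b\<rceil> + 1) * (nat \<lceil>b / a\<rceil> + 1)) * esum (\<lambda>k. sqn (c k)))
       + 2 * (of_nat ((nat \<lceil>b\<rceil> + 1) * (nat \<lceil>b / a\<rceil> + 1)) * esum (\<lambda>k. sqn (c k)))"
    using esum_window_sum_le[OF assms(1), of "-y" "b - y" c] esum_window_sum_le[OF assms(1), of "-b-y" "-y" c] assms(2)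
    by (intro add_mono mult_left_mono) auto
  also have "\<dots> = of_nat (4 * ((nat \<lceil>b\<rceil> + 1) * (nat \<lceil>b / a\<rceil> + 1))) * esum (\<lambda>k. sqn (c k))"
    by (simp only: of_nat_mult of_nat_numeral mult.assoc flip: distrib_right mult_2) simp
  finally show ?thesis .
qed

section \<open>The critical density\<close>

text \<open>For \<open>b = m + 1/2\<close> and \<open>a = 1\<close> the forward and backward moves
  advance by \<open>m\<close> and \<open>m + 1\<close> in one order or the other. Together they
  therefore produce a translation by 1, which is how an odd \<beta> enters.\<close>

lemma ceiling_floor_half_odd:
  fixes u :: real and m :: nat and k k' :: int
  assumes "0 \<le> u" "u < 1"
  defines "k \<equiv> \<lceil>m + 1/2 - u\<rceil>" and "k' \<equiv> \<lfloor>m + 1/2 + u\<rfloor>"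
  shows "k = m + 1 \<and> k' = m \<or> k = m \<and> k' = m + 1"
proof (cases "u < 1/2")
  case True
  then have "k = m + 1" "k' = m" unfolding k_def k'_def using assms(1) by (linarith, linarith)
  then show ?thesis by simp
next
  case False
  then have "k = m" "k' = m + 1" unfolding k_def k'_def using assms(2) by (linarith, linarith)
  then show ?thesis by simp
qed

text \<open>The squared distance between \<open>c\<close> and its translate by \<open>t\<close> is
  subadditive up to a factor 2. Iteration costs the crude factor \<open>4 ^ n\<close>; only shifts
  up to \<open>m + 1\<close> are used.\<close>

lemma esum_translate_diff_le:
  fixes c :: "int \<Rightarrow> complex"
  defines "g \<equiv> \<lambda>t. esum (\<lambda>j. sqn (c (j + t) - c j))"
  shows "g (s + t) \<le> 2 * g s + 2 * g t" and "g (- t) = g t"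
    and "g (int n) \<le> 4 ^ n * g 1"
proof -
  show add: "g (s + t) \<le> 2 * g s + 2 * g t" for s t
  proof -
    have "g (s + t) \<le> esum (\<lambda>j. 2 * sqn (c (j + t + s) - c (j + t)) + 2 * sqn (c (j + t) - c j))"
      unfolding g_def
    proof (rule esum_mono)
      fix j
      show "sqn (c (j + (s + t)) - c j) \<le> 2 * sqn (c (j + t + s) - c (j + t)) + 2 * sqn (c (j + t) - c j)"
        using sqn_add_le[of "c (j + t + s) - c (j + t)" "c (j + t) - c j"] by (simp add: ac_simps)
    qed
    also have "\<dots> = 2 * esum (\<lambda>j. sqn (c (j + t + s) - c (j + t))) + 2 * g t"
      unfolding g_def by (simp only: esum_add esum_cmult)
    also have "esum (\<lambda>j. sqn (c (j + t + s) - c (j + t))) = g s"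
      unfolding g_def by (rule esum_shift[of "\<lambda>j. sqn (c (j + s) - c j)"])
    finally show ?thesis .
  qed
  show "g (- t) = g t" for t
    unfolding g_def using esum_shift[of "\<lambda>j. sqn (c (j - t) - c j)" t] by (simp add: sqn_minus_commute)
  show "g (int n) \<le> 4 ^ n * g 1"
  proof (induction n)
    case 0
    then show ?case by (simp add: g_def)
  next
    case (Suc n)
    have "g (int (Suc n)) \<le> 2 * g (int n) + 2 * g 1" using add[of "int n" 1] by (simp add: ac_simps)
    also have "\<dots> \<le> 2 * (4 ^ n * g 1) + 2 * (4 ^ n * g 1)"
    proof (intro add_mono mult_left_mono Suc.IH)
      have "(1::ennreal) \<le> 4 ^ n" by (rule one_le_power) simp
      then have "1 * g 1 \<le> 4 ^ n * g 1" by (rule mult_right_mono) simp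
      then show "g 1 \<le> 4 ^ n * g 1" by simp
    qed auto
    also have "\<dots> = 4 ^ Suc n * g 1" by (simp add: mult.assoc flip: distrib_right mult_2)
    finally show ?case .
  qed
qed

text \<open>A small defect makes \<open>c\<close> close to its translate by 1, hence to all
  translates occurring in a row. A row has \<open>k\<close> plus and \<open>k'\<close> minus signs
  with \<open>k - k' = \<plusminus>1\<close>, so it is close to \<open>\<plusminus>c j\<close>. In
  \<open>K\<close>, one factor \<open>2 * m + 1\<close> is Cauchy-Schwarz, the other counts the
  terms, \<open>4 ^ (m + 1)\<close> bounds the translations, and 8 is 2 from splitting off the row
  times 4 from the shift by 1.\<close>

lemma critical_lower_bound:
  fixes y b :: real and m :: nat
  assumes half_odd: "b = m + 1/2" and fin: "esum (\<lambda>j. sqn (c j)) < \<infinity>"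
  defines "K \<equiv> real (8 * (2 * m + 1) * (2 * m + 1) * 4 ^ (m + 1))"
  shows "esum (\<lambda>j. sqn (c j)) \<le> ennreal (4 + 16 * K\<^sup>2) * esum (\<lambda>i. sqn (haar_row 1 b y c i))"
proof -
  interpret cells 1 b y by unfold_locales (auto simp: half_odd)
  define g where "g t = esum (\<lambda>j. sqn (c (j + t) - c j))" for t
  note g = esum_translate_diff_le[of c, folded g_def]
  define u where "u = frac y"
  have left: "cell_left j = j - u" for j :: int
    by (simp add: cell_left_def cell_index_def u_def frac_def)
  define k where "k = \<lceil>b - u\<rceil>"
  define k' where "k' = \<lfloor>b + u\<rfloor>"
  have u: "0 \<le> u" "u < 1" by (auto simp: u_def frac_lt_1)
  have k: "k = m + 1 \<and> k' = m \<or> k = m \<and> k' = m + 1"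
    using ceiling_floor_half_odd[OF u, of m] unfolding k_def k'_def half_odd by simp
  have target: "target b j = j + k" "target (-b) j = j - k'" for j
    unfolding target_def left k_def k'_def by linarith+
  have hits: "hits d j" for d j
    unfolding hits_def using target_bounds[where d=d and j=j] by simp
  have pull: "pull b c j = c (j + k)" "pull (-b) c j = c (j - k')" for j
    by (simp_all add: pull_def hits target)
  have \<Delta>: "esum (defect c) = g k + g k'"
  proof -
    have "esum (defect c) = esum (\<lambda>j. sqn (c (j + k) - c j)) + esum (\<lambda>j. sqn (c (j + - k') - c j))"
      unfolding defect_def[abs_def] pull esum_add by (simp add: sqn_minus_commute)
    then show ?thesis using g(2)[of k'] by (simp add: g_def)
  qed
  have g1: "g 1 \<le> 4 * esum (defect c)"
  proof -
    have "g 1 = g (k + (- k'))" using k g(2)[of 1] by auto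
    also have "\<dots> \<le> 2 * g k + 2 * g k'" using g(1)[of k "-k'"] g(2)[of k'] by simp
    also have "\<dots> = 2 * esum (defect c)" unfolding \<Delta> by (simp add: distrib_left)
    also have "\<dots> \<le> 4 * esum (defect c)" by (intro mult_right_mono) auto
    finally show ?thesis .
  qed
  have gt: "g t \<le> 4 ^ (m + 1) * (4 * esum (defect c))" if "- k' \<le> t" "t < k" for t
  proof -
    have "g t = g (int (nat \<bar>t\<bar>))" using g(2)[of t] by (cases "t \<ge> 0") auto
    also have "\<dots> \<le> 4 ^ nat \<bar>t\<bar> * g 1" by (rule g(3))
    also have "\<dots> \<le> 4 ^ (m + 1) * (4 * esum (defect c))"
      using that k by (intro mult_mono power_increasing g1) auto
    finally show ?thesis .
  qed
  define A where "A = {- k'..<k}"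
  define sg :: "int \<Rightarrow> complex" where "sg t = (if 0 \<le> t then 1 else -1)" for t
  have A: "finite A" "card A = 2 * m + 1" using k by (auto simp: A_def)
  have row: "haar_row 1 b y c (cell_index j) = (\<Sum>t\<in>A. sg t * c (j + t))" for j
  proof -
    have s: "of_int (cell_index j) * 1 - y = cell_left j" by (simp add: cell_left_def)
    have shift: "(\<Sum>i\<in>{j + p..<j + q}. c i) = (\<Sum>t\<in>{p..<q}. c (j + t))" for p q
      by (rule sum.reindex_bij_witness[of _ "\<lambda>t. j + t" "\<lambda>i. i - j"]) auto
    have cl: "\<lceil>cell_left j\<rceil> = j" "\<lceil>cell_left j + b\<rceil> = j + k" "\<lceil>cell_left j - b\<rceil> = j - k'"
      using target[of j] u unfolding target_def left by (auto intro: ceiling_unique)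
    have "haar_row 1 b y c (cell_index j) = (\<Sum>t\<in>{0..<k}. c (j + t)) - (\<Sum>t\<in>{-k'..<0}. c (j + t))"
      unfolding haar_row_def s window_sum_def cl using shift[of 0 k] shift[of "-k'" 0] by simp
    also have "\<dots> = (\<Sum>t\<in>{0..<k}. sg t * c (j + t)) + (\<Sum>t\<in>{-k'..<0}. sg t * c (j + t))"
      by (simp add: sg_def sum_negf)
    also have "\<dots> = (\<Sum>t\<in>A. sg t * c (j + t))"
    proof -
      have "A = {-k'..<0} \<union> {0..<k}" using k by (auto simp: A_def)
      then show ?thesis by (simp add: sum.union_disjoint)
    qed
    finally show ?thesis .
  qed
  have sgA: "(\<Sum>t\<in>A. sg t) = of_int (k - k')"
  proof -
    have "A = {-k'..<0} \<union> {0..<k}" using k by (auto simp: A_def)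
    then have "(\<Sum>t\<in>A. sg t) = (\<Sum>t\<in>{0..<k}. sg t) + (\<Sum>t\<in>{-k'..<0}. sg t)"
      by (simp add: sum.union_disjoint)
    also have "\<dots> = (\<Sum>t\<in>{0..<k}. 1) + (\<Sum>t\<in>{-k'..<0}. -1)"
      by (intro arg_cong2[where f="(+)"] sum.cong) (auto simp: sg_def)
    also have "\<dots> = of_int (k - k')" using k by auto
    finally show ?thesis .
  qed
  have pw: "sqn (c j) \<le> 2 * sqn (haar_row 1 b y c (cell_index j))
      + 2 * (of_nat (2 * m + 1) * (\<Sum>t\<in>A. sqn (c (j + t) - c j)))" for j
  proof -
    have "of_int (k - k') * c j = haar_row 1 b y c (cell_index j) - (\<Sum>t\<in>A. sg t * (c (j + t) - c j))"
      unfolding row sgA[symmetric] by (simp add: sum_distrib_right right_diff_distrib sum_subtractf)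
    then have 1: "sqn (of_int (k - k') * c j) \<le> 2 * sqn (haar_row 1 b y c (cell_index j))
        + 2 * sqn (\<Sum>t\<in>A. sg t * (c (j + t) - c j))"
      using sqn_diff_le by metis
    have 2: "sqn (of_int (k - k') * c j) = sqn (c j)" using k by (auto simp: sqn_def)
    have eq: "(\<Sum>t\<in>A. sqn (sg t * (c (j + t) - c j))) = (\<Sum>t\<in>A. sqn (c (j + t) - c j))"
      by (intro sum.cong) (auto simp: sqn_def sg_def norm_mult)
    have "sqn (\<Sum>t\<in>A. sg t * (c (j + t) - c j)) \<le> of_nat (2 * m + 1) * (\<Sum>t\<in>A. sqn (c (j + t) - c j))"
      using sqn_sum_le[OF A(1), of "\<lambda>t. sg t * (c (j + t) - c j)"] unfolding A(2) eq .
    then have 3: "2 * sqn (haar_row 1 b y c (cell_index j)) + 2 * sqn (\<Sum>t\<in>A. sg t * (c (j + t) - c j))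
        \<le> 2 * sqn (haar_row 1 b y c (cell_index j)) + 2 * (of_nat (2 * m + 1) * (\<Sum>t\<in>A. sqn (c (j + t) - c j)))"
      by (intro add_mono mult_left_mono) auto
    show ?thesis using order_trans[OF 1 3] unfolding 2 .
  qed
  let ?R = "esum (\<lambda>i. sqn (haar_row 1 b y c i))"
  have "esum (\<lambda>j. sqn (c j)) \<le> esum (\<lambda>j. 2 * sqn (haar_row 1 b y c (cell_index j))
      + 2 * (of_nat (2 * m + 1) * (\<Sum>t\<in>A. sqn (c (j + t) - c j))))"
    by (intro esum_mono pw)
  also have "\<dots> = 2 * esum (\<lambda>j. sqn (haar_row 1 b y c (cell_index j))) + 2 * (of_nat (2 * m + 1) * (\<Sum>t\<in>A. g t))"
    unfolding esum_add esum_cmult g_def by (subst nn_integral_sum) auto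
  also have "\<dots> \<le> 2 * ?R + 2 * (of_nat (2 * m + 1) * (\<Sum>t\<in>A. 4 ^ (m + 1) * (4 * esum (defect c))))"
  proof (intro add_mono mult_left_mono sum_mono gt)
    show "esum (\<lambda>j. sqn (haar_row 1 b y c (cell_index j))) \<le> ?R"
      using esum_inj_le[OF inj_cell_index, of "\<lambda>i. sqn (haar_row 1 b y c i)"] by simp
  qed (auto simp: A_def)
  also have "\<dots> = ennreal 2 * ?R + ennreal K * esum (defect c)"
  proof -
    have "ennreal K = 8 * of_nat (2 * m + 1) * of_nat (2 * m + 1) * 4 ^ (m + 1)"
      unfolding K_def ennreal_of_nat_eq_real_of_nat[symmetric] by (simp only: of_nat_mult of_nat_power of_nat_numeral)
    moreover have "8 * q * q * p = 2 * (q * (q * (p * 4)))" for p q :: ennreal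
    proof -
      have "(8 :: ennreal) = 2 * 4" by simp
      then show ?thesis by (simp only: mult_ac)
    qed
    ultimately have "ennreal K = 2 * (of_nat (2 * m + 1) * (of_nat (2 * m + 1) * (4 ^ (m + 1) * 4)))"
      by (rule trans)
    then show ?thesis unfolding sum_constant A(2) by (simp only: mult.assoc ennreal_numeral)
  qed
  finally have main: "esum (\<lambda>j. sqn (c j)) \<le> ennreal 2 * ?R + ennreal K * esum (defect c)" .
  have "K > 0" unfolding K_def of_nat_0_less_iff by simp
  from absorb_bound[OF fin this _ main esum_defect[OF fin]] show ?thesis by simp
qed

section \<open>Fourier series on a period\<close>

definition wave :: "real \<Rightarrow> int \<Rightarrow> real \<Rightarrow> complex" where
  "wave \<beta> m x = cis (2 * pi * m * \<beta> * x)"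

inductive trig_poly :: "real \<Rightarrow> (real \<Rightarrow> complex) \<Rightarrow> bool" for \<beta> where
  trig_poly_wave: "trig_poly \<beta> (\<lambda>x. c * wave \<beta> m x)"
| trig_poly_add: "trig_poly \<beta> p \<Longrightarrow> trig_poly \<beta> q \<Longrightarrow> trig_poly \<beta> (\<lambda>x. p x + q x)"

lemma wave_mult: "wave \<beta> m x * wave \<beta> n x = wave \<beta> (m + n) x"
  by (simp add: wave_def cis_mult algebra_simps)

lemma cnj_wave: "cnj (wave \<beta> m x) = wave \<beta> (- m) x"
  by (simp add: wave_def cis_cnj)

lemma cmod_wave[simp]: "cmod (wave \<beta> m x) = 1"
  by (simp add: wave_def)

lemma wave_measurable[measurable]: "wave \<beta> m \<in> borel_measurable borel"
  unfolding wave_def[abs_def] by (intro borel_measurable_continuous_onI continuous_intros)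

lemma trig_poly_const: "trig_poly \<beta> (\<lambda>x. c)"
  using trig_poly_wave[of \<beta> c 0] by (simp add: wave_def)

lemma trig_poly_mult:
  assumes "trig_poly \<beta> p" "trig_poly \<beta> q"
  shows "trig_poly \<beta> (\<lambda>x. p x * q x)"
  using assms(1)
proof induction
  case (trig_poly_wave c m)
  show ?case using assms(2)
  proof induction
    case (trig_poly_wave d n)
    have "(\<lambda>x. c * wave \<beta> m x * (d * wave \<beta> n x)) = (\<lambda>x. (c * d) * wave \<beta> (m + n) x)"
      by (auto simp: wave_mult[symmetric])
    then show ?case by (simp only: trig_poly.trig_poly_wave)
  next
    case (trig_poly_add p q)
    then show ?case by (simp only: distrib_left trig_poly.trig_poly_add)
  qed
next
  case (trig_poly_add p q)
  then show ?case by (simp only: distrib_right trig_poly.trig_poly_add)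
qed

text \<open>A real-linear functional is a combination of real and imaginary part, and on the circle
  these are combinations of \<open>wave \<beta> 1\<close> and its inverse. This converts the
  polynomials supplied by Stone-Weierstrass.\<close>

lemma trig_poly_of_real_polynomial:
  assumes "real_polynomial_function g"
  shows "trig_poly \<beta> (\<lambda>x. complex_of_real (g (wave \<beta> 1 x)))"
  using assms
proof induction
  case (linear f)
  interpret f: bounded_linear f by fact
  have f: "f z = Re z * f 1 + Im z * f \<i>" for z
  proof -
    have "f z = f (Re z *\<^sub>R 1 + Im z *\<^sub>R \<i>)" by (rule arg_cong[of _ _ f]) (simp add: complex_eq_iff)
    then show ?thesis by (simp only: f.add f.scaleR real_scaleR_def)
  qed
  have 1: "complex_of_real (Re (wave \<beta> 1 x)) = (wave \<beta> 1 x + wave \<beta> (-1) x) / 2" for x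
    using complex_add_cnj[of "wave \<beta> 1 x"] by (simp add: cnj_wave)
  have 2: "complex_of_real (Im (wave \<beta> 1 x)) = - \<i> * (wave \<beta> 1 x - wave \<beta> (-1) x) / 2" for x
    unfolding cnj_wave[of \<beta> 1, symmetric] by (simp add: complex_eq_iff)
  have "(\<lambda>x. complex_of_real (f (wave \<beta> 1 x))) = (\<lambda>x. (f 1 / 2 - \<i> * f \<i> / 2) * wave \<beta> 1 x
      + (f 1 / 2 + \<i> * f \<i> / 2) * wave \<beta> (-1) x)"
    by (subst f) (simp add: 1 2 algebra_simps add_divide_distrib diff_divide_distrib fun_eq_iff)
  then show ?case by (simp only: trig_poly_wave trig_poly_add)
next
  case (const c)
  show ?case by (rule trig_poly_const)
next
  case (add f g)
  then show ?case by (simp only: of_real_add trig_poly_add)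
next
  case (mult f g)
  then show ?case by (simp only: of_real_mult trig_poly_mult)
qed

lemma trig_poly_finite_sum:
  assumes "trig_poly \<beta> p"
  obtains F c where "finite F" "p = (\<lambda>x. \<Sum>m\<in>F. c m * wave \<beta> m x)"
proof -
  have "\<exists>F c. finite F \<and> p = (\<lambda>x. \<Sum>m\<in>F. c m * wave \<beta> m x)"
    using assms
  proof induction
    case (trig_poly_wave c m)
    show ?case by (intro exI[of _ "{m}"] exI[of _ "\<lambda>_. c"]) simp
  next
    case (trig_poly_add p q)
    then obtain F c G d where *: "finite F" "p = (\<lambda>x. \<Sum>m\<in>F. c m * wave \<beta> m x)"
      "finite G" "q = (\<lambda>x. \<Sum>m\<in>G. d m * wave \<beta> m x)" by blast
    define h where "h m = (if m \<in> F then c m else 0) + (if m \<in> G then d m else 0)" for m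
    have "p x + q x = (\<Sum>m\<in>F \<union> G. h m * wave \<beta> m x)" for x
    proof -
      have "(\<Sum>m\<in>F. c m * wave \<beta> m x) = (\<Sum>m\<in>F \<union> G. (if m \<in> F then c m else 0) * wave \<beta> m x)"
        using *(1,3) by (intro sum.mono_neutral_cong_left) auto
      moreover have "(\<Sum>m\<in>G. d m * wave \<beta> m x) = (\<Sum>m\<in>F \<union> G. (if m \<in> G then d m else 0) * wave \<beta> m x)"
        using *(1,3) by (intro sum.mono_neutral_cong_left) auto
      ultimately show ?thesis unfolding *(2,4) h_def by (simp add: sum.distrib distrib_right)
    qed
    then show ?case using *(1,3) by (intro exI[of _ "F \<union> G"] exI[of _ h]) auto
  qed
  then show thesis using that by blast
qed

text \<open>A density rather than a restricted space: functions stay defined and Borel measurable on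
  the whole line, as the translated fibres require.\<close>

definition period_measure :: "real \<Rightarrow> real measure" where
  "period_measure \<beta> = density lborel (\<lambda>x. ennreal (indicator {0..<1/\<beta>} x))"

lemma sets_period_measure[simp, measurable_cong]: "sets (period_measure \<beta>) = sets borel"
  by (simp add: period_measure_def)

lemma space_period_measure[simp]: "space (period_measure \<beta>) = UNIV"
  by (simp add: period_measure_def)

lemma nn_integral_period:
  "f \<in> borel_measurable borel \<Longrightarrow>
    (\<integral>\<^sup>+x. f x \<partial>period_measure \<beta>) = (\<integral>\<^sup>+x. indicator {0..<1/\<beta>} x * f x \<partial>lborel)"
  unfolding period_measure_def by (subst nn_integral_density) (auto simp: ennreal_indicator)

lemma integral_period:
  fixes f :: "real \<Rightarrow> complex"
  assumes [measurable]: "f \<in> borel_measurable borel"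
  shows "(\<integral>x. f x \<partial>period_measure \<beta>) = (\<integral>x. indicator {0..<1/\<beta>} x *\<^sub>R f x \<partial>lborel)"
  unfolding period_measure_def by (subst integral_density) auto

lemma emeasure_period:
  assumes [measurable]: "A \<in> sets borel"
  shows "emeasure (period_measure \<beta>) A = emeasure lborel ({0..<1/\<beta>} \<inter> A)"
  unfolding period_measure_def
  by (subst emeasure_density) (auto simp: ennreal_indicator nn_integral_indicator
    simp flip: indicator_inter_arith)

lemma finite_period_measure: "finite_measure (period_measure \<beta>)"
  using emeasure_bounded_finite[of "{0..<1/\<beta>}"]
  by (intro finite_measureI) (simp add: emeasure_period less_top)

lemma integral_wave:
  assumes "\<beta> > 0"
  shows "(\<integral>x. wave \<beta> m x \<partial>period_measure \<beta>) = (if m = 0 then complex_of_real (1 / \<beta>) else 0)"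
proof -
  \<comment> \<open>The fundamental theorem of calculus works on the closed interval, which differs
    by a null set.\<close>
  have ind: "indicator {0..<1/\<beta>} x *\<^sub>R wave \<beta> m x = indicator {0..1/\<beta>} x *\<^sub>R wave \<beta> m x"
    if "x \<noteq> 1 / \<beta>" for x using that by (auto simp: indicator_def)
  have "(\<integral>x. wave \<beta> m x \<partial>period_measure \<beta>) = (\<integral>x. indicator {0..1/\<beta>} x *\<^sub>R wave \<beta> m x \<partial>lborel)"
    unfolding integral_period[OF wave_measurable]
    by (intro integral_cong_AE) (use AE_lborel_singleton[of "1/\<beta>"] ind in auto)
  also have "\<dots> = (if m = 0 then complex_of_real (1 / \<beta>) else 0)"
  proof (cases "m = 0")
    case True
    then show ?thesis using assms by (simp add: wave_def scaleR_conv_of_real)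
  next
    case False
    define w where "w = 2 * pi * m * \<beta>"
    have w: "w \<noteq> 0" using False assms by (simp add: w_def)
    define G where "G x = - \<i> / w * cis (w * x)" for x
    have "(\<integral>x. indicator {0..1/\<beta>} x *\<^sub>R wave \<beta> m x \<partial>lborel) = G (1/\<beta>) - G 0"
    proof (rule integral_FTC_atLeastAtMost)
      show "0 \<le> 1 / \<beta>" using assms by simp
      show "continuous_on {0..1/\<beta>} (wave \<beta> m)" unfolding wave_def[abs_def] by (intro continuous_intros)
      fix x
      have "((\<lambda>z. - \<i> / w * exp (\<i> * w * z)) has_field_derivative exp (\<i> * w * complex_of_real x)) (at (complex_of_real x))"
        using w by (auto intro!: derivative_eq_intros)
      from has_vector_derivative_real_field[OF this]
      show "(G has_vector_derivative wave \<beta> m x) (at x within {0..1/\<beta>})"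
        by (simp add: G_def[abs_def] cis_conv_exp wave_def w_def mult.assoc)
    qed
    also have "cis (w * (1/\<beta>)) = 1"
      using assms cis_multiple_2pi[of m] by (simp add: w_def mult.commute)
    then have "G (1/\<beta>) - G 0 = 0" by (simp add: G_def)
    finally show ?thesis using False by simp
  qed
  finally show ?thesis .
qed

section \<open>Density of trigonometric polynomials in the square-integrable functions on a
  period\<close>

definition approximable :: "real \<Rightarrow> (real \<Rightarrow> complex) \<Rightarrow> bool" where
  "approximable \<beta> f \<longleftrightarrow> f \<in> borel_measurable borel \<and>
     (\<forall>e>0. \<exists>p. trig_poly \<beta> p \<and> (\<integral>\<^sup>+x. sqn (f x - p x) \<partial>period_measure \<beta>) < ennreal e)"

lemma sqn_measurable[measurable]: "sqn \<in> borel_measurable borel"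
  unfolding sqn_def[abs_def] by measurable

lemma trig_poly_measurable: "trig_poly \<beta> p \<Longrightarrow> p \<in> borel_measurable borel"
  by (induction rule: trig_poly.induct) auto

lemma nn_integral_sqn_triangle:
  assumes [measurable]: "f \<in> borel_measurable M" "g \<in> borel_measurable M" "h \<in> borel_measurable M"
    and "(\<integral>\<^sup>+x. sqn (f x - g x) \<partial>M) < ennreal (e / 8)" "(\<integral>\<^sup>+x. sqn (g x - h x) \<partial>M) < ennreal (e / 8)"
  shows "(\<integral>\<^sup>+x. sqn (f x - h x) \<partial>M) < ennreal e"
proof -
  have e: "e > 0" using assms(4) by (cases "e > 0") (auto simp: ennreal_neg)
  have "(\<integral>\<^sup>+x. sqn (f x - h x) \<partial>M) \<le> (\<integral>\<^sup>+x. 2 * sqn (f x - g x) + 2 * sqn (g x - h x) \<partial>M)"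
    using sqn_add_le[of "f x - g x" "g x - h x" for x] by (intro nn_integral_mono) simp
  also have "\<dots> = 2 * (\<integral>\<^sup>+x. sqn (f x - g x) \<partial>M) + 2 * (\<integral>\<^sup>+x. sqn (g x - h x) \<partial>M)"
    by (simp add: nn_integral_add nn_integral_cmult)
  also have "\<dots> \<le> 2 * ennreal (e / 8) + 2 * ennreal (e / 8)"
    using assms(4,5) by (intro add_mono mult_left_mono) auto
  also have "\<dots> = ennreal (e / 2)"
  proof -
    have "2 * ennreal (e / 8) = ennreal (e / 4)"
      using e by (subst ennreal_numeral[symmetric], subst ennreal_mult[symmetric]) auto
    then show ?thesis using e by (simp flip: ennreal_plus)
  qed
  also have "\<dots> < ennreal e" using e by (simp add: ennreal_less_iff)
  finally show ?thesis .
qed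

lemma approximable_limit:
  assumes f: "f \<in> borel_measurable borel"
    and ex: "\<And>e. e > 0 \<Longrightarrow> \<exists>g. approximable \<beta> g \<and> (\<integral>\<^sup>+x. sqn (f x - g x) \<partial>period_measure \<beta>) < ennreal e"
  shows "approximable \<beta> f"
  unfolding approximable_def
proof (intro conjI f allI impI)
  fix e :: real assume "e > 0"
  then have e: "e / 8 > 0" by simp
  obtain g where g: "approximable \<beta> g" "(\<integral>\<^sup>+x. sqn (f x - g x) \<partial>period_measure \<beta>) < ennreal (e / 8)"
    using ex[OF e] by blast
  obtain p where p: "trig_poly \<beta> p" "(\<integral>\<^sup>+x. sqn (g x - p x) \<partial>period_measure \<beta>) < ennreal (e / 8)"
    using g(1) e unfolding approximable_def by blast
  have "(\<integral>\<^sup>+x. sqn (f x - p x) \<partial>period_measure \<beta>) < ennreal e"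
  proof (rule nn_integral_sqn_triangle[OF _ _ _ g(2) p(2)])
    show "f \<in> borel_measurable (period_measure \<beta>)" "g \<in> borel_measurable (period_measure \<beta>)"
      "p \<in> borel_measurable (period_measure \<beta>)"
      using f g(1) trig_poly_measurable[OF p(1)] unfolding approximable_def
      by (simp_all cong: measurable_cong_sets)
  qed
  then show "\<exists>p. trig_poly \<beta> p \<and> (\<integral>\<^sup>+x. sqn (f x - p x) \<partial>period_measure \<beta>) < ennreal e"
    using p(1) by blast
qed

lemma approximable_add:
  assumes "approximable \<beta> f" "approximable \<beta> g"
  shows "approximable \<beta> (\<lambda>x. f x + g x)"
  unfolding approximable_def
proof (intro conjI allI impI)
  have [measurable]: "f \<in> borel_measurable borel" "g \<in> borel_measurable borel"
    using assms by (auto simp: approximable_def)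
  then show "(\<lambda>x. f x + g x) \<in> borel_measurable borel" by measurable
  fix e :: real assume "e > 0"
  then have e: "e / 8 > 0" by simp
  obtain p where p: "trig_poly \<beta> p" "(\<integral>\<^sup>+x. sqn (f x - p x) \<partial>period_measure \<beta>) < ennreal (e / 8)"
    using assms(1) e unfolding approximable_def by blast
  obtain q where q: "trig_poly \<beta> q" "(\<integral>\<^sup>+x. sqn (g x - q x) \<partial>period_measure \<beta>) < ennreal (e / 8)"
    using assms(2) e unfolding approximable_def by blast
  have [measurable]: "p \<in> borel_measurable borel" "q \<in> borel_measurable borel"
    using p(1) q(1) trig_poly_measurable by auto
  have "(\<integral>\<^sup>+x. sqn (f x + g x - (p x + q x)) \<partial>period_measure \<beta>) < ennreal e"
  proof (rule nn_integral_sqn_triangle[where g="\<lambda>x. p x + g x"])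
    have "f x + g x - (p x + g x) = f x - p x" "p x + g x - (p x + q x) = g x - q x" for x by auto
    then show "(\<integral>\<^sup>+x. sqn (f x + g x - (p x + g x)) \<partial>period_measure \<beta>) < ennreal (e / 8)"
      "(\<integral>\<^sup>+x. sqn (p x + g x - (p x + q x)) \<partial>period_measure \<beta>) < ennreal (e / 8)"
      using p(2) q(2) by simp_all
  qed measurable
  then show "\<exists>p. trig_poly \<beta> p \<and> (\<integral>\<^sup>+x. sqn (f x + g x - p x) \<partial>period_measure \<beta>) < ennreal e"
    using trig_poly_add[OF p(1) q(1)] by blast
qed

lemma approximable_cmult:
  assumes "approximable \<beta> f"
  shows "approximable \<beta> (\<lambda>x. c * f x)"
  unfolding approximable_def
proof (intro conjI allI impI)
  have [measurable]: "f \<in> borel_measurable borel"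
    using assms by (auto simp: approximable_def)
  then show "(\<lambda>x. c * f x) \<in> borel_measurable borel" by measurable
  fix e :: real assume e: "e > 0"
  define K where "K = (cmod c)\<^sup>2 + 1"
  have K: "K > 0" by (simp add: K_def add_nonneg_pos)
  obtain p where p: "trig_poly \<beta> p" "(\<integral>\<^sup>+x. sqn (f x - p x) \<partial>period_measure \<beta>) < ennreal (e / K)"
    using assms divide_pos_pos[OF e K] unfolding approximable_def by blast
  have [measurable]: "p \<in> borel_measurable borel" using p(1) trig_poly_measurable by auto
  have "(\<integral>\<^sup>+x. sqn (c * f x - c * p x) \<partial>period_measure \<beta>) = sqn c * (\<integral>\<^sup>+x. sqn (f x - p x) \<partial>period_measure \<beta>)"
    by (subst nn_integral_cmult[symmetric]) (auto simp: sqn_mult[symmetric] right_diff_distrib)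
  also have "\<dots> \<le> ennreal K * (\<integral>\<^sup>+x. sqn (f x - p x) \<partial>period_measure \<beta>)"
    by (intro mult_right_mono) (auto simp: sqn_def K_def)
  also have "\<dots> < ennreal K * ennreal (e / K)"
    using p(2) K by (intro ennreal_mult_strict_left_mono) auto
  also have "\<dots> = ennreal e" using K e by (subst ennreal_mult[symmetric]) auto
  finally show "\<exists>p. trig_poly \<beta> p \<and> (\<integral>\<^sup>+x. sqn (c * f x - p x) \<partial>period_measure \<beta>) < ennreal e"
    using trig_poly_mult[OF trig_poly_const[of \<beta> c] p(1)] by blast
qed

text \<open>Regularity traps the set, up to null sets, between a closed \<open>K\<close> and an open
  \<open>U\<close> of small difference. After wrapping the period onto the circle, Urysohn's lemma
  gives a continuous function that is 1 on the image of \<open>K\<close> and 0 on the image of the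
  complement of \<open>U\<close>, and Stone-Weierstrass approximates it uniformly.\<close>

lemma approximable_indicator:
  assumes \<beta>: "\<beta> > 0" and A: "A \<in> sets borel"
  shows "approximable \<beta> (indicator A)"
  unfolding approximable_def
proof (intro conjI allI impI)
  show "indicator A \<in> borel_measurable borel" using A by simp
  fix e :: real assume e: "e > 0"
  define T where "T = 1 / \<beta>"
  have T: "T > 0" using \<beta> by (simp add: T_def)
  \<comment> \<open>The ends of the period wrap to the same point of the circle. Keeping
    \<open>K\<close> and \<open>U\<close> in the open interval makes the two images
    disjoint.\<close>
  define A' where "A' = A \<inter> {0<..<T}"
  have A': "A' \<in> sets borel" using A by (simp add: A'_def)
  then have A'l: "A' \<in> sets lebesgue" by (intro sets_completionI_sets) simp
  obtain U0 where U0: "open U0" "A' \<subseteq> U0" "emeasure lebesgue (U0 - A') < ennreal (e / 32)"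
    using sets_lebesgue_outer_open[OF A'l, of "e / 32"] e by (metis divide_pos_pos zero_less_numeral)
  obtain K where K: "closed K" "K \<subseteq> A'" "emeasure lebesgue (A' - K) < ennreal (e / 32)"
    using sets_lebesgue_inner_closed[OF A'l, of "e / 32"] e by (metis divide_pos_pos zero_less_numeral)
  define U where "U = U0 \<inter> {0<..<T}"
  have U: "open U" "A' \<subseteq> U" using U0 unfolding U_def A'_def by auto
  have UK: "emeasure lborel (U - K) \<le> ennreal (e / 16)"
  proof -
    have s: "U0 - A' \<in> sets borel" "A' - K \<in> sets borel" "U - K \<in> sets borel"
      using U0 K U A' by auto
    have "emeasure lborel (U - K) \<le> emeasure lborel ((U0 - A') \<union> (A' - K))"
      using s by (intro emeasure_mono) (auto simp: U_def)
    also have "\<dots> \<le> emeasure lborel (U0 - A') + emeasure lborel (A' - K)"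
      using s by (intro emeasure_subadditive) auto
    also have "\<dots> \<le> ennreal (e / 32) + ennreal (e / 32)"
      using U0(3) K(3) s by (intro add_mono) (auto simp: emeasure_completion less_imp_le main_part_sets)
    also have "\<dots> = ennreal (e / 16)" using e by (simp flip: ennreal_plus)
    finally show ?thesis .
  qed
  define E where "E = wave \<beta> 1"
  have contE: "continuous_on S E" for S unfolding E_def wave_def[abs_def] by (intro continuous_intros)
  have injE: "x = z" if "E x = E z" "\<bar>x - z\<bar> < T" for x z
  proof -
    have "cis (2 * pi * \<beta> * (x - z)) = 1"
      using that(1) by (simp add: E_def wave_def cis_divide[symmetric] right_diff_distrib)
    then obtain n :: int where n: "2 * pi * \<beta> * (x - z) = 2 * pi * n"
      unfolding cis_conv_exp exp_eq_1 by (auto simp: mult_ac)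
    then have "\<beta> * (x - z) = n" by simp
    moreover have "\<bar>\<beta> * (x - z)\<bar> < 1" 
    proof -
      have "\<bar>\<beta> * (x - z)\<bar> = \<beta> * \<bar>x - z\<bar>" using \<beta> by (simp add: abs_mult)
      also have "\<dots> < \<beta> * T" using that(2) \<beta> by (intro mult_strict_left_mono)
      finally show ?thesis using \<beta> by (simp add: T_def)
    qed
    ultimately have "n = 0" by linarith
    then show ?thesis using \<open>\<beta> * (x - z) = n\<close> \<beta> by simp
  qed
  have "K \<subseteq> {0..T}" using K(2) by (auto simp: A'_def)
  then have "compact K" using K(1) compact_Int_closed[OF compact_Icc K(1), of 0 T] by (simp add: Int_absorb1)
  then have cK: "closed (E ` K)" using compact_continuous_image contE compact_imp_closed by blast
  have "compact ({0..T} - U)" by (rule compact_diff[OF compact_Icc U(1)])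
  then have cU: "closed (E ` ({0..T} - U))" using compact_continuous_image contE compact_imp_closed by blast
  have disj: "E ` K \<inter> E ` ({0..T} - U) = {}"
  proof -
    have False if "x \<in> K" "z \<in> {0..T}" "z \<notin> U" "E x = E z" for x z
    proof -
      have "x \<in> {0<..<T}" "x \<in> U" using that(1) K(2) U(2) by (auto simp: A'_def)
      then have "\<bar>x - z\<bar> < T" using that(2) by auto
      then show False using injE[OF that(4)] \<open>x \<in> U\<close> that(3) by simp
    qed
    then show ?thesis by blast
  qed
  obtain \<phi> :: "complex \<Rightarrow> real" where \<phi>: "continuous_on UNIV \<phi>" "\<And>z. \<phi> z \<in> closed_segment 1 0"
      "\<And>z. z \<in> E ` K \<Longrightarrow> \<phi> z = 1" "\<And>z. z \<in> E ` ({0..T} - U) \<Longrightarrow> \<phi> z = 0"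
    by (rule Urysohn[OF cK cU disj, of 1 0]) blast
  have \<phi>01: "0 \<le> \<phi> z" "\<phi> z \<le> 1" for z using \<phi>(2)[of z] by (auto simp: closed_segment_eq_real_ivl)
  \<comment> \<open>Chosen so that a uniform error \<open>\<delta>\<close> costs
    \<open>\<delta>\<^sup>2 * T = e / 16\<close> over a period of length \<open>T\<close>.\<close>
  define \<delta> where "\<delta> = sqrt (e / (16 * T))"
  have \<delta>: "\<delta> > 0" "\<delta>\<^sup>2 * T = e / 16" using e T by (auto simp: \<delta>_def)
  obtain g where g: "real_polynomial_function g" "\<And>z. z \<in> sphere 0 1 \<Longrightarrow> \<bar>\<phi> z - g z\<bar> < \<delta>"
    by (rule Stone_Weierstrass_real_polynomial_function[OF compact_sphere[of 0 1] continuous_on_subset[OF \<phi>(1) subset_UNIV] \<delta>(1)]) blast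
  define f where "f x = complex_of_real (\<phi> (E x))" for x
  define p where "p x = complex_of_real (g (E x))" for x
  have tp: "trig_poly \<beta> p" unfolding p_def[abs_def] E_def by (rule trig_poly_of_real_polynomial[OF g(1)])
  have [measurable]: "f \<in> borel_measurable borel"
  proof -
    have "continuous_on UNIV (\<lambda>x. complex_of_real (\<phi> (E x)))"
      by (intro continuous_intros continuous_on_compose2[OF \<phi>(1) contE]) auto
    then show ?thesis unfolding f_def[abs_def] by (rule borel_measurable_continuous_onI)
  qed
  have [measurable]: "p \<in> borel_measurable borel" by (rule trig_poly_measurable[OF tp])
  have [measurable]: "U \<in> sets borel" "K \<in> sets borel" using U K by auto
  note [measurable] = A
  have 1: "(\<integral>\<^sup>+x. sqn (indicator A x - f x) \<partial>period_measure \<beta>) \<le> ennreal (e / 16)"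
  proof -
    have "(\<integral>\<^sup>+x. sqn (indicator A x - f x) \<partial>period_measure \<beta>)
        = (\<integral>\<^sup>+x. indicator {0..<1/\<beta>} x * sqn (indicator A x - f x) \<partial>lborel)"
      by (rule nn_integral_period) measurable
    also have "\<dots> \<le> (\<integral>\<^sup>+x. indicator (U - K) x \<partial>lborel)"
    proof (rule nn_integral_mono_AE, use AE_lborel_singleton[of 0] in eventually_elim)
      fix x :: real assume x: "x \<noteq> 0"
      show "indicator {0..<1/\<beta>} x * sqn (indicator A x - f x) \<le> indicator (U - K) x"
      proof (cases "x \<in> {0..<1/\<beta>}")
        case True
        then have xT: "x \<in> {0<..<T}" using x by (auto simp: T_def)
        consider "x \<in> K" | "x \<notin> U" | "x \<in> U - K" by blast
        then show ?thesis
        proof cases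
          case 1
          then have "x \<in> A" "\<phi> (E x) = 1" using K(2) \<phi>(3) by (auto simp: A'_def)
          then show ?thesis by (simp add: f_def)
        next
          case 2
          then have "x \<notin> A" "\<phi> (E x) = 0" using U(2) xT \<phi>(4)[of "E x"] by (auto simp: A'_def)
          then show ?thesis by (simp add: f_def)
        next
          case 3
          have "cmod (indicator A x - f x) \<le> 1"
          proof -
            have "indicator A x - f x = complex_of_real (indicator A x - \<phi> (E x))"
              by (simp add: f_def indicator_def)
            then have "cmod (indicator A x - f x) = \<bar>indicator A x - \<phi> (E x)\<bar>" by (simp only: norm_of_real)
            then show ?thesis using \<phi>01[of "E x"] by (auto simp: indicator_def)
          qed
          then have "sqn (indicator A x - f x) \<le> sqn 1" by (intro sqn_le) simp
          then show ?thesis using 3 True by (simp add: sqn_def)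
        qed
      qed simp
    qed
    also have "\<dots> = emeasure lborel (U - K)" by simp
    finally show ?thesis using UK by simp
  qed
  have 2: "(\<integral>\<^sup>+x. sqn (f x - p x) \<partial>period_measure \<beta>) \<le> ennreal (e / 16)"
  proof -
    have "(\<integral>\<^sup>+x. sqn (f x - p x) \<partial>period_measure \<beta>) \<le> (\<integral>\<^sup>+x. ennreal (\<delta>\<^sup>2) \<partial>period_measure \<beta>)"
    proof (rule nn_integral_mono)
      fix x
      have "f x - p x = complex_of_real (\<phi> (E x) - g (E x))" by (simp add: f_def p_def)
      then have "cmod (f x - p x) = \<bar>\<phi> (E x) - g (E x)\<bar>" by (simp only: norm_of_real)
      also have "\<dots> \<le> \<delta>" using g(2)[of "E x"] by (simp add: E_def)
      finally show "sqn (f x - p x) \<le> ennreal (\<delta>\<^sup>2)"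
        unfolding sqn_def by (intro ennreal_leI power_mono) auto
    qed
    also have "\<dots> = ennreal (\<delta>\<^sup>2) * ennreal T"
      using T by (simp add: emeasure_period T_def[symmetric])
    also have "\<dots> = ennreal (e / 16)" using \<delta>(2) T by (subst ennreal_mult[symmetric]) auto
    finally show ?thesis .
  qed
  have lt: "ennreal (e / 16) < ennreal (e / 8)" using e by (simp add: ennreal_less_iff)
  have "(\<integral>\<^sup>+x. sqn (indicator A x - p x) \<partial>period_measure \<beta>) < ennreal e"
    by (rule nn_integral_sqn_triangle[OF _ _ _ le_less_trans[OF 1 lt] le_less_trans[OF 2 lt]]) measurable
  then show "\<exists>p. trig_poly \<beta> p \<and> (\<integral>\<^sup>+x. sqn (indicator A x - p x) \<partial>period_measure \<beta>) < ennreal e"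
    using tp by (intro exI[of _ p] conjI)
qed

text \<open>Finiteness of the norm passes down to smaller nonnegative functions, which feeds the
  induction, and monotone limits are limits in square mean by dominated convergence.\<close>

lemma approximable_nonneg:
  fixes f :: "real \<Rightarrow> real"
  assumes \<beta>: "\<beta> > 0" and f: "f \<in> borel_measurable borel" "\<And>x. 0 \<le> f x"
    and "(\<integral>\<^sup>+x. sqn (f x) \<partial>period_measure \<beta>) < \<infinity>"
  shows "approximable \<beta> (\<lambda>x. complex_of_real (f x))"
  using f assms(4)
proof (induction rule: borel_measurable_induct_real)
  case (set A)
  then show ?case using approximable_indicator[OF \<beta>, of A]
    by (simp add: indicator_def[abs_def] of_bool_def if_distrib cong: if_cong)
next
  case (mult u c)
  show ?case
  proof (cases "c = 0")
    case True
    then show ?thesis using approximable_cmult[OF approximable_indicator[OF \<beta>, of "{}"], of 0] by simp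
  next
    case False
    have "(\<integral>\<^sup>+x. sqn (u x) \<partial>period_measure \<beta>) = sqn (1 / c) * (\<integral>\<^sup>+x. sqn (c * u x) \<partial>period_measure \<beta>)"
      using mult.hyps False
      by (subst nn_integral_cmult[symmetric]) (auto simp flip: sqn_mult)
    also have "\<dots> < \<infinity>" using mult.prems by (auto simp: ennreal_mult_less_top sqn_def)
    finally show ?thesis using approximable_cmult[OF mult.IH, of c] by simp
  qed
next
  case (add u v)
  have "(\<integral>\<^sup>+x. sqn (u x) \<partial>period_measure \<beta>) \<le> (\<integral>\<^sup>+x. sqn (v x + u x) \<partial>period_measure \<beta>)"
    "(\<integral>\<^sup>+x. sqn (v x) \<partial>period_measure \<beta>) \<le> (\<integral>\<^sup>+x. sqn (v x + u x) \<partial>period_measure \<beta>)"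
    using add.hyps by (auto intro!: nn_integral_mono sqn_le simp flip: of_real_add)
  then show ?case using approximable_add[OF add.IH(2) add.IH(1)] add.prems by (auto intro: le_less_trans)
next
  case (seq U)
  note [measurable] = seq.hyps(1) f(1)
  have inc: "mono (\<lambda>i. U i x)" for x using seq.hyps(3) by (auto simp: incseq_def le_fun_def mono_def)
  have le: "U i x \<le> f x" for i x using incseq_le[OF inc, of x "f x"] seq.hyps(4)[of x] by simp
  have Ui: "approximable \<beta> (\<lambda>x. complex_of_real (U i x))" for i
  proof (rule seq.IH)
    have "(\<integral>\<^sup>+x. sqn (U i x) \<partial>period_measure \<beta>) \<le> (\<integral>\<^sup>+x. sqn (f x) \<partial>period_measure \<beta>)"
      using seq.hyps(2) le order_trans[OF seq.hyps(2) le] by (intro nn_integral_mono sqn_le) auto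
    then show "(\<integral>\<^sup>+x. sqn (U i x) \<partial>period_measure \<beta>) < \<infinity>" using seq.prems by (auto intro: le_less_trans)
  qed
  have "(\<lambda>i. \<integral>\<^sup>+x. sqn (f x - U i x) \<partial>period_measure \<beta>) \<longlonglongrightarrow> (\<integral>\<^sup>+x. 0 \<partial>period_measure \<beta>)"
  proof (rule nn_integral_dominated_convergence[where w="\<lambda>x. sqn (f x)"])
    show "AE x in period_measure \<beta>. sqn (f x - U i x) \<le> sqn (f x)" for i
    proof -
      have "\<bar>f x - U i x\<bar> \<le> \<bar>f x\<bar>" for x using seq.hyps(2)[of i x] le[of i x] by linarith
      then have "sqn (f x - U i x) \<le> sqn (f x)" for x
        by (intro sqn_le) (metis norm_of_real of_real_diff)
      then show ?thesis by simp
    qed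
    show "AE x in period_measure \<beta>. (\<lambda>i. sqn (f x - U i x)) \<longlonglongrightarrow> 0"
    proof (rule AE_I2)
      fix x
      have "(\<lambda>i. ennreal ((cmod (complex_of_real (f x) - U i x))\<^sup>2)) \<longlonglongrightarrow> ennreal ((cmod (complex_of_real (f x) - f x))\<^sup>2)"
        using seq.hyps(4)[of x] by (intro tendsto_intros) auto
      then show "(\<lambda>i. sqn (f x - U i x)) \<longlonglongrightarrow> 0" by (simp add: sqn_def)
    qed
  qed (use seq.prems in auto)
  then have lim: "(\<lambda>i. \<integral>\<^sup>+x. sqn (f x - U i x) \<partial>period_measure \<beta>) \<longlonglongrightarrow> 0" by simp
  show ?case
  proof (rule approximable_limit)
    fix e :: real assume "e > 0"
    then have "\<forall>\<^sub>F i in sequentially. (\<integral>\<^sup>+x. sqn (f x - U i x) \<partial>period_measure \<beta>) < ennreal e"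
      using lim by (intro order_tendstoD) auto
    then obtain i where "(\<integral>\<^sup>+x. sqn (f x - U i x) \<partial>period_measure \<beta>) < ennreal e"
      by (auto simp: eventually_sequentially)
    then show "\<exists>g. approximable \<beta> g \<and> (\<integral>\<^sup>+x. sqn (complex_of_real (f x) - g x) \<partial>period_measure \<beta>) < ennreal e"
      using Ui[of i] by (intro exI[of _ "\<lambda>x. complex_of_real (U i x)"] conjI) simp_all
  qed simp
qed

section \<open>Parseval\<close>

lemma esum_summable:
  fixes f :: "'i \<Rightarrow> real"
  assumes "f summable_on UNIV" "\<And>i. 0 \<le> f i"
  shows "esum (\<lambda>i. ennreal (f i)) = ennreal (infsum f UNIV)"
proof -
  have "Infinite_Set_Sum.abs_summable_on f UNIV"
    using assms(1) summable_on_iff_abs_summable_on_real abs_summable_equivalent by (metis (no_types))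
  then show ?thesis
    using nn_integral_conv_infsetsum[of f UNIV] assms(2) infsetsum_infsum[of f UNIV] by simp
qed

lemma summable_esum:
  fixes f :: "'i \<Rightarrow> real"
  assumes "esum (\<lambda>i. ennreal (f i)) < \<infinity>" "\<And>i. 0 \<le> f i"
  shows "f summable_on UNIV"
proof -
  have "integrable (count_space UNIV) f"
    using assms by (intro integrableI_bounded) auto
  then have "Infinite_Set_Sum.abs_summable_on f UNIV" by (simp add: Infinite_Set_Sum.abs_summable_on_def)
  then show ?thesis
    using summable_on_iff_abs_summable_on_real abs_summable_equivalent by (metis (no_types))
qed

lemma complex_square_integrable:
  fixes h :: "'a \<Rightarrow> complex"
  assumes "finite_measure M" and [measurable]: "h \<in> borel_measurable M"
    and fin: "(\<integral>\<^sup>+x. sqn (h x) \<partial>M) < \<infinity>"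
  shows "integrable M (\<lambda>x. (cmod (h x))\<^sup>2)" "integrable M h"
proof -
  interpret finite_measure M by fact
  show 1: "integrable M (\<lambda>x. (cmod (h x))\<^sup>2)"
    using fin unfolding sqn_def by (intro integrableI_bounded) auto
  have "integrable M (\<lambda>x. 1 + (cmod (h x))\<^sup>2)" using 1 by simp
  then show "integrable M h"
  proof (rule Bochner_Integration.integrable_bound)
    show "AE x in M. norm (h x) \<le> norm (1 + (cmod (h x))\<^sup>2)"
    proof (rule AE_I2)
      fix x
      have "cmod (h x) \<le> 1 + (cmod (h x))\<^sup>2"
        using sum_squares_bound[of 1 "cmod (h x)"] norm_ge_zero[of "h x"] unfolding power_one by linarith
      then show "norm (h x) \<le> norm (1 + (cmod (h x))\<^sup>2)" by simp
    qed
  qed simp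
qed

context
  fixes \<beta> :: real and h :: "real \<Rightarrow> complex"
  assumes \<beta>: "\<beta> > 0" and h[measurable]: "h \<in> borel_measurable borel"
    and fin: "(\<integral>\<^sup>+x. sqn (h x) \<partial>period_measure \<beta>) < \<infinity>"
begin

definition fourier :: "int \<Rightarrow> complex" where
  "fourier m = (\<integral>x. h x * wave \<beta> m x \<partial>period_measure \<beta>)"

definition sq_norm :: real where
  "sq_norm = (\<integral>x. (cmod (h x))\<^sup>2 \<partial>period_measure \<beta>)"

lemma h_integrable: "integrable (period_measure \<beta>) (\<lambda>x. (cmod (h x))\<^sup>2)" "integrable (period_measure \<beta>) h"
  by (rule complex_square_integrable[OF finite_period_measure _ fin]; measurable)+

lemma wave_integrable:
  "integrable (period_measure \<beta>) (\<lambda>x. wave \<beta> m x)"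
  "integrable (period_measure \<beta>) (\<lambda>x. h x * wave \<beta> m x)"
  "integrable (period_measure \<beta>) (\<lambda>x. cnj (h x) * wave \<beta> m x)"
proof -
  interpret finite_measure "period_measure \<beta>" by (rule finite_period_measure)
  have "cnj \<in> borel_measurable borel"
    by (intro borel_measurable_continuous_onI continuous_intros)
  note cnj_h = measurable_compose[OF h this]
  have cnj_meas: "(\<lambda>x. cnj (h x) * wave \<beta> m x) \<in> borel_measurable (period_measure \<beta>)"
    unfolding measurable_cong_sets[OF sets_period_measure refl]
    by (rule borel_measurable_times[OF cnj_h wave_measurable])
  show "integrable (period_measure \<beta>) (\<lambda>x. wave \<beta> m x)"
    by (rule integrable_const_bound[where B=1]) auto
  show "integrable (period_measure \<beta>) (\<lambda>x. h x * wave \<beta> m x)"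
    by (rule Bochner_Integration.integrable_bound[OF h_integrable(2)]) (auto simp: norm_mult)
  show "integrable (period_measure \<beta>) (\<lambda>x. cnj (h x) * wave \<beta> m x)"
    by (rule Bochner_Integration.integrable_bound[OF h_integrable(2) cnj_meas]) (simp add: norm_mult)
qed

text \<open>The square is expanded using orthogonality of the waves, each of squared norm
  \<open>1 / \<beta>\<close>. As \<open>fourier m\<close> pairs \<open>h\<close> with
  \<open>wave \<beta> m\<close> without conjugation, the expansion runs over
  \<open>wave \<beta> (- m)\<close>.\<close>

lemma distance_to_trig_sum:
  assumes F: "finite F"
  shows "(\<integral>x. (cmod (h x - (\<Sum>m\<in>F. c m * wave \<beta> (- m) x)))\<^sup>2 \<partial>period_measure \<beta>) =
    sq_norm - 2 * Re (\<Sum>m\<in>F. cnj (c m) * fourier m) + (1 / \<beta>) * (\<Sum>m\<in>F. (cmod (c m))\<^sup>2)"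
proof -
  let ?P = "period_measure \<beta>"
  define q where "q x = (\<Sum>m\<in>F. c m * wave \<beta> (- m) x)" for x
  define S where "S = (\<Sum>m\<in>F. cnj (c m) * fourier m)"
  have cq: "cnj (q x) = (\<Sum>m\<in>F. cnj (c m) * wave \<beta> m x)" for x
    by (simp add: q_def cnj_wave)
  have 1: "has_bochner_integral ?P (\<lambda>x. h x * cnj (q x)) S"
  proof -
    have "has_bochner_integral ?P (\<lambda>x. \<Sum>m\<in>F. cnj (c m) * (h x * wave \<beta> m x)) (\<Sum>m\<in>F. cnj (c m) * fourier m)"
      unfolding fourier_def
      by (intro has_bochner_integral_sum has_bochner_integral_mult_right has_bochner_integral_integrable wave_integrable)
    then show ?thesis by (simp add: cq S_def sum_distrib_left mult_ac)
  qed
  have 2: "has_bochner_integral ?P (\<lambda>x. q x * cnj (h x)) (cnj S)"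
    using has_bochner_integral_cnj[OF 1] by (simp add: mult.commute)
  have 3: "has_bochner_integral ?P (\<lambda>x. q x * cnj (q x)) (\<Sum>m\<in>F. complex_of_real (1 / \<beta> * (cmod (c m))\<^sup>2))"
  proof -
    have "has_bochner_integral ?P (\<lambda>x. \<Sum>m\<in>F. \<Sum>n\<in>F. c m * cnj (c n) * wave \<beta> (- m + n) x)
       (\<Sum>m\<in>F. \<Sum>n\<in>F. c m * cnj (c n) * (\<integral>x. wave \<beta> (- m + n) x \<partial>?P))"
      by (intro has_bochner_integral_sum has_bochner_integral_mult_right has_bochner_integral_integrable wave_integrable)
    moreover have "(\<Sum>m\<in>F. \<Sum>n\<in>F. c m * cnj (c n) * wave \<beta> (- m + n) x) = q x * cnj (q x)" for x
      unfolding cq unfolding q_def sum_product by (intro sum.cong refl) (simp only: wave_mult[symmetric] mult_ac)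
    moreover have "(\<Sum>m\<in>F. \<Sum>n\<in>F. c m * cnj (c n) * (\<integral>x. wave \<beta> (- m + n) x \<partial>?P))
        = (\<Sum>m\<in>F. complex_of_real (1 / \<beta> * (cmod (c m))\<^sup>2))"
    proof (rule sum.cong[OF refl])
      fix m assume m: "m \<in> F"
      have "(\<Sum>n\<in>F. c m * cnj (c n) * (\<integral>x. wave \<beta> (- m + n) x \<partial>?P))
          = (\<Sum>n\<in>F. if n = m then c m * cnj (c m) * complex_of_real (1 / \<beta>) else 0)"
        by (intro sum.cong) (auto simp: integral_wave[OF \<beta>])
      also have "\<dots> = complex_of_real (1 / \<beta> * (cmod (c m))\<^sup>2)"
        using F m complex_norm_square[of "c m"] by simp
      finally show "(\<Sum>n\<in>F. c m * cnj (c n) * (\<integral>x. wave \<beta> (- m + n) x \<partial>?P)) = complex_of_real (1 / \<beta> * (cmod (c m))\<^sup>2)" .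
    qed
    ultimately show ?thesis by simp
  qed
  have 4: "has_bochner_integral ?P (\<lambda>x. complex_of_real ((cmod (h x))\<^sup>2)) (complex_of_real sq_norm)"
    unfolding sq_norm_def by (intro has_bochner_integral_of_real has_bochner_integral_integrable h_integrable)
  have A: "has_bochner_integral ?P
      (\<lambda>x. complex_of_real ((cmod (h x))\<^sup>2) - h x * cnj (q x) - q x * cnj (h x) + q x * cnj (q x))
      (complex_of_real sq_norm - S - cnj S + (\<Sum>m\<in>F. complex_of_real (1 / \<beta> * (cmod (c m))\<^sup>2)))"
    by (intro has_bochner_integral_add has_bochner_integral_diff 1 2 3 4)
  have B: "complex_of_real ((cmod (h x))\<^sup>2) - h x * cnj (q x) - q x * cnj (h x) + q x * cnj (q x)
      = complex_of_real ((cmod (h x - q x))\<^sup>2)" for x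
  proof -
    have n: "complex_of_real ((cmod z)\<^sup>2) = z * cnj z" for z
      using complex_norm_square[of z] by simp
    show ?thesis unfolding n by (simp add: algebra_simps)
  qed
  have C: "complex_of_real sq_norm - S - cnj S + (\<Sum>m\<in>F. complex_of_real (1 / \<beta> * (cmod (c m))\<^sup>2))
      = complex_of_real (sq_norm - 2 * Re S + (1 / \<beta>) * (\<Sum>m\<in>F. (cmod (c m))\<^sup>2))"
    by (simp add: complex_eq_iff sum_distrib_left)
  have "has_bochner_integral ?P (\<lambda>x. complex_of_real ((cmod (h x - q x))\<^sup>2))
      (complex_of_real (sq_norm - 2 * Re S + (1 / \<beta>) * (\<Sum>m\<in>F. (cmod (c m))\<^sup>2)))"
    using A unfolding B C .
  from has_bochner_integral_Re[OF this]
  have "has_bochner_integral ?P (\<lambda>x. (cmod (h x - q x))\<^sup>2)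
      (sq_norm - 2 * Re S + (1 / \<beta>) * (\<Sum>m\<in>F. (cmod (c m))\<^sup>2))" by simp
  then show ?thesis unfolding q_def S_def by (rule has_bochner_integral_integral_eq)
qed

lemma bessel:
  assumes F: "finite F"
  shows "\<beta> * (\<Sum>m\<in>F. (cmod (fourier m))\<^sup>2) \<le> sq_norm"
proof -
  \<comment> \<open>The coefficients of the orthogonal projection, which minimise the
    distance.\<close>
  define c where "c m = complex_of_real \<beta> * fourier m" for m
  have "0 \<le> (\<integral>x. (cmod (h x - (\<Sum>m\<in>F. c m * wave \<beta> (- m) x)))\<^sup>2 \<partial>period_measure \<beta>)"
    by simp
  also have "\<dots> = sq_norm - 2 * Re (\<Sum>m\<in>F. cnj (c m) * fourier m) + (1 / \<beta>) * (\<Sum>m\<in>F. (cmod (c m))\<^sup>2)"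
    by (rule distance_to_trig_sum[OF F])
  also have "Re (\<Sum>m\<in>F. cnj (c m) * fourier m) = \<beta> * (\<Sum>m\<in>F. (cmod (fourier m))\<^sup>2)"
  proof -
    have "cnj (c m) * fourier m = complex_of_real (\<beta> * (cmod (fourier m))\<^sup>2)" for m
      using complex_norm_square[of "fourier m"] by (simp add: c_def mult_ac)
    then show ?thesis by (simp add: sum_distrib_left)
  qed
  also have "(1 / \<beta>) * (\<Sum>m\<in>F. (cmod (c m))\<^sup>2) = \<beta> * (\<Sum>m\<in>F. (cmod (fourier m))\<^sup>2)"
    unfolding c_def sum_distrib_left using \<beta>
    by (intro sum.cong) (auto simp: norm_mult power_mult_distrib power2_eq_square)
  finally show ?thesis by simp
qed

text \<open>The projection is the best approximation: the mixed term is bounded by Young's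
  inequality with weight \<open>\<beta>\<close>, matching the squared norm of a wave.\<close>

lemma distance_to_trig_sum_ge:
  assumes F: "finite F"
  shows "sq_norm - \<beta> * (\<Sum>m\<in>F. (cmod (fourier m))\<^sup>2) \<le>
    (\<integral>x. (cmod (h x - (\<Sum>m\<in>F. c m * wave \<beta> (- m) x)))\<^sup>2 \<partial>period_measure \<beta>)"
proof -
  have "2 * Re (\<Sum>m\<in>F. cnj (c m) * fourier m)
      \<le> \<beta> * (\<Sum>m\<in>F. (cmod (fourier m))\<^sup>2) + (1 / \<beta>) * (\<Sum>m\<in>F. (cmod (c m))\<^sup>2)"
    unfolding Re_sum sum_distrib_left sum.distrib[symmetric]
  proof (rule sum_mono)
    fix m
    have "Re (cnj (c m) * fourier m) \<le> cmod (c m) * cmod (fourier m)"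
      using complex_Re_le_cmod[of "cnj (c m) * fourier m"] by (simp add: norm_mult)
    moreover have "2 * (cmod (c m) * cmod (fourier m)) \<le> \<beta> * (cmod (fourier m))\<^sup>2 + (1 / \<beta>) * (cmod (c m))\<^sup>2"
    proof -
      have "0 \<le> (sqrt \<beta> * cmod (fourier m) - cmod (c m) / sqrt \<beta>)\<^sup>2" by simp
      also have "\<dots> = \<beta> * (cmod (fourier m))\<^sup>2 + (1 / \<beta>) * (cmod (c m))\<^sup>2 - 2 * (cmod (c m) * cmod (fourier m))"
        using \<beta> by (simp add: power2_diff power_mult_distrib power_divide field_simps)
      finally show ?thesis by simp
    qed
    ultimately show "2 * Re (cnj (c m) * fourier m) \<le> \<beta> * (cmod (fourier m))\<^sup>2 + 1 / \<beta> * (cmod (c m))\<^sup>2"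
      by simp
  qed
  then show ?thesis unfolding distance_to_trig_sum[OF F] by simp
qed

lemma approximable_h: "approximable \<beta> h"
proof -
  have part: "approximable \<beta> (\<lambda>x. complex_of_real (k x))"
    if k: "k \<in> borel_measurable borel" "\<And>x. 0 \<le> k x" "\<And>x. k x \<le> cmod (h x)" for k :: "real \<Rightarrow> real"
  proof (rule approximable_nonneg[OF \<beta> k(1,2)])
    have "(\<integral>\<^sup>+x. sqn (k x) \<partial>period_measure \<beta>) \<le> (\<integral>\<^sup>+x. sqn (h x) \<partial>period_measure \<beta>)"
      using k by (intro nn_integral_mono sqn_le) auto
    then show "(\<integral>\<^sup>+x. sqn (k x) \<partial>period_measure \<beta>) < \<infinity>" using fin by (rule le_less_trans)
  qed
  have ab: "\<bar>Re (h x)\<bar> \<le> cmod (h x)" "\<bar>Im (h x)\<bar> \<le> cmod (h x)" for x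
    by (auto simp: abs_Re_le_cmod abs_Im_le_cmod)
  have "max 0 (Re (h x)) \<le> cmod (h x)" "max 0 (- Re (h x)) \<le> cmod (h x)"
    "max 0 (Im (h x)) \<le> cmod (h x)" "max 0 (- Im (h x)) \<le> cmod (h x)" for x
    using ab[of x] by linarith+
  note bound = this
  have "approximable \<beta> (\<lambda>x. complex_of_real (max 0 (Re (h x))))"
    "approximable \<beta> (\<lambda>x. complex_of_real (max 0 (- Re (h x))))"
    "approximable \<beta> (\<lambda>x. complex_of_real (max 0 (Im (h x))))"
    "approximable \<beta> (\<lambda>x. complex_of_real (max 0 (- Im (h x))))"
    by (rule part; (rule bound | measurable | rule max.cobounded1))+
  note ap = this
  note approximable_add[OF approximable_add[OF ap(1) approximable_cmult[OF ap(2), of "-1"]]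
    approximable_add[OF approximable_cmult[OF ap(3), of \<i>] approximable_cmult[OF ap(4), of "-\<i>"]]]
  moreover have "(\<lambda>x. complex_of_real (max 0 (Re (h x))) + (-1) * complex_of_real (max 0 (- Re (h x)))
      + (\<i> * complex_of_real (max 0 (Im (h x))) + (-\<i>) * complex_of_real (max 0 (- Im (h x))))) = h"
  proof (rule ext)
    fix x
    have "max 0 t - max 0 (- t) = t" for t :: real by linarith
    then show "complex_of_real (max 0 (Re (h x))) + (-1) * complex_of_real (max 0 (- Re (h x)))
      + (\<i> * complex_of_real (max 0 (Im (h x))) + (-\<i>) * complex_of_real (max 0 (- Im (h x)))) = h x"
      by (simp add: complex_eq_iff)
  qed
  ultimately show ?thesis by (simp only:)
qed

text \<open>Bessel gives one inequality. For the other, a trigonometric polynomial close to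
  \<open>h\<close> uses finitely many frequencies, and the projection onto these is at least as
  close.\<close>

lemma parseval:
  "esum (\<lambda>m. sqn (\<integral>x. h x * wave \<beta> m x \<partial>period_measure \<beta>)) =
    ennreal (1 / \<beta>) * (\<integral>\<^sup>+x. sqn (h x) \<partial>period_measure \<beta>)"
proof -
  let ?P = "period_measure \<beta>"
  let ?f = "\<lambda>m. (cmod (fourier m))\<^sup>2"
  have bound: "sum ?f F \<le> sq_norm / \<beta>" if "finite F" for F
    using bessel[OF that] \<beta> by (simp add: field_simps)
  have sm: "?f summable_on UNIV"
  proof (rule nonneg_bdd_above_summable_on)
    show "bdd_above (sum ?f ` {F. F \<subseteq> UNIV \<and> finite F})"
      using bound by (intro bdd_aboveI[of _ "sq_norm / \<beta>"]) blast
  qed simp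
  have "infsum ?f UNIV \<le> sq_norm / \<beta>" using bound by (intro infsum_le_finite_sums[OF sm])
  moreover have "sq_norm / \<beta> \<le> infsum ?f UNIV"
  proof (rule field_le_epsilon)
    fix e :: real assume "e > 0"
    then have e: "e * \<beta> > 0" using \<beta> by simp
    obtain p where p: "trig_poly \<beta> p" "(\<integral>\<^sup>+x. sqn (h x - p x) \<partial>?P) < ennreal (e * \<beta>)"
      using approximable_h e unfolding approximable_def by blast
    have [measurable]: "p \<in> borel_measurable borel" by (rule trig_poly_measurable[OF p(1)])
    obtain F c where F: "finite F" "p = (\<lambda>x. \<Sum>m\<in>F. c m * wave \<beta> m x)"
      by (rule trig_poly_finite_sum[OF p(1)])
    \<comment> \<open>The sign change matches the expansion in
      \<open>wave \<beta> (- m)\<close>.\<close>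
    define F' where "F' = uminus ` F"
    have pF': "p x = (\<Sum>m\<in>F'. c (- m) * wave \<beta> (- m) x)" for x
      unfolding F(2) F'_def by (subst sum.reindex) (auto simp: o_def)
    have "sq_norm - \<beta> * sum ?f F' \<le> (\<integral>x. (cmod (h x - p x))\<^sup>2 \<partial>?P)"
      unfolding pF' using F(1) by (intro distance_to_trig_sum_ge) (simp add: F'_def)
    also have "\<dots> \<le> e * \<beta>"
    proof -
      have hp: "integrable ?P (\<lambda>x. (cmod (h x - p x))\<^sup>2)"
        by (rule complex_square_integrable(1)[OF finite_period_measure])
           (measurable, use order_less_trans[OF p(2) ennreal_less_top] in simp)
      have "ennreal (\<integral>x. (cmod (h x - p x))\<^sup>2 \<partial>?P) = (\<integral>\<^sup>+x. sqn (h x - p x) \<partial>?P)"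
        unfolding sqn_def by (rule nn_integral_eq_integral[OF hp, symmetric]) simp
      then have "ennreal (\<integral>x. (cmod (h x - p x))\<^sup>2 \<partial>?P) < ennreal (e * \<beta>)" using p(2) by simp
      then show ?thesis using e by (simp add: ennreal_less_iff less_imp_le)
    qed
    finally have "sq_norm / \<beta> \<le> sum ?f F' + e" using \<beta> by (simp add: field_simps)
    also have "sum ?f F' \<le> infsum ?f UNIV" using F(1) by (intro finite_sum_le_infsum[OF sm]) (auto simp: F'_def)
    finally show "sq_norm / \<beta> \<le> infsum ?f UNIV + e" by simp
  qed
  ultimately have "infsum ?f UNIV = sq_norm / \<beta>" by simp
  then have "esum (\<lambda>m. sqn (fourier m)) = ennreal (sq_norm / \<beta>)"
    using esum_summable[OF sm] by (simp add: sqn_def)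
  also have "\<dots> = ennreal (1 / \<beta>) * ennreal sq_norm"
    using \<beta> by (subst ennreal_mult[symmetric]) (auto simp: sq_norm_def)
  also have "ennreal sq_norm = (\<integral>\<^sup>+x. sqn (h x) \<partial>?P)"
    unfolding sqn_def sq_norm_def by (rule nn_integral_eq_integral[OF h_integrable(1), symmetric]) simp
  finally show ?thesis unfolding fourier_def .
qed

end

section \<open>Fibering the Gabor coefficients\<close>

lemma esum_int_nat: "esum (g :: int \<Rightarrow> ennreal) = (\<Sum>i. g (int_decode i))"
proof -
  have "esum g = (\<integral>\<^sup>+i. g (int_decode i) \<partial>count_space UNIV)"
    by (rule nn_integral_bij_count_space[symmetric]) (rule bij_int_decode)
  then show ?thesis by (simp add: nn_integral_count_space_nat)
qed

lemma esum_int_measurable[measurable (raw)]: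
  fixes g :: "int \<Rightarrow> 'a \<Rightarrow> ennreal"
  assumes [measurable]: "\<And>k. g k \<in> borel_measurable M"
  shows "(\<lambda>x. esum (\<lambda>k. g k x)) \<in> borel_measurable M"
  unfolding esum_int_nat by measurable

lemma nn_integral_esum_int:
  fixes g :: "int \<Rightarrow> 'a \<Rightarrow> ennreal"
  assumes "\<And>k. g k \<in> borel_measurable M"
  shows "(\<integral>\<^sup>+x. esum (\<lambda>k. g k x) \<partial>M) = esum (\<lambda>k. \<integral>\<^sup>+x. g k x \<partial>M)"
  using assms by (intro nn_integral_count_space_nn_integral) auto

lemma gabor_haar_eq:
  "gabor haar \<alpha> \<beta> (m, n) x = wave \<beta> (- m) x * haar (x - n * \<alpha>)"
  by (simp add: gabor_def wave_def cis_conv_exp mult_ac)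

lemma haar_cases:
  "haar x = (if -1/2 \<le> x \<and> x < 0 then -1 else if 0 \<le> x \<and> x < 1/2 then 1 else 0)"
  by (auto simp: haar_def indicator_def)

lemma haar_simps[simp]: "cnj (haar x) = haar x" "cmod (haar x) \<le> 1"
  by (auto simp: haar_cases)

lemma haar_measurable[measurable]: "haar \<in> borel_measurable borel"
  unfolding haar_def[abs_def] by measurable

lemma cnj_gabor_haar: "cnj (gabor haar \<alpha> \<beta> (m, n) x) = haar (x - n * \<alpha>) * wave \<beta> m x"
  by (simp add: gabor_haar_eq cnj_wave)

lemma gabor_haar_measurable[measurable]: "gabor haar \<alpha> \<beta> i \<in> borel_measurable borel"
proof (cases i)
  case (Pair m n)
  have "(\<lambda>x. wave \<beta> (- m) x * haar (x - n * \<alpha>)) \<in> borel_measurable borel" by measurable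
  then show ?thesis by (simp add: Pair gabor_haar_eq[abs_def])
qed

definition tile :: "real \<Rightarrow> int \<Rightarrow> real set" where
  "tile \<beta> k = {k / \<beta>..<(k + 1) / \<beta>}"

lemma tile_iff: "\<beta> > 0 \<Longrightarrow> x \<in> tile \<beta> k \<longleftrightarrow> \<lfloor>\<beta> * x\<rfloor> = k"
  unfolding tile_def by (simp add: floor_eq_iff field_simps)

lemma tile_shift: "\<beta> > 0 \<Longrightarrow> x + k / \<beta> \<in> tile \<beta> k \<longleftrightarrow> x \<in> {0..<1/\<beta>}"
  unfolding tile_def by (simp add: field_simps zero_le_mult_iff)

lemma tile_measurable[measurable]: "tile \<beta> k \<in> sets borel"
  by (simp add: tile_def)

lemma nn_integral_shift:
  fixes f :: "real \<Rightarrow> ennreal"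
  assumes [measurable]: "f \<in> borel_measurable borel"
  shows "(\<integral>\<^sup>+x. f x \<partial>lborel) = (\<integral>\<^sup>+x. f (x + t) \<partial>lborel)"
  by (subst nn_integral_real_affine[where c=1 and t=t]) (auto simp: add.commute)

lemma nn_integral_tiles:
  fixes f :: "real \<Rightarrow> ennreal"
  assumes \<beta>: "\<beta> > 0" and [measurable]: "f \<in> borel_measurable borel"
  shows "(\<integral>\<^sup>+x. f x \<partial>lborel) = (\<integral>\<^sup>+x. esum (\<lambda>k::int. f (x + k / \<beta>)) \<partial>period_measure \<beta>)"
proof -
  have "(\<integral>\<^sup>+x. f x \<partial>lborel) = (\<integral>\<^sup>+x. esum (\<lambda>k. indicator (tile \<beta> k) x * f x) \<partial>lborel)"
  proof (rule nn_integral_cong)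
    fix x
    have "esum (\<lambda>k. indicator (tile \<beta> k) x * f x) = (\<Sum>k\<in>{\<lfloor>\<beta> * x\<rfloor>}. indicator (tile \<beta> k) x * f x)"
      by (rule nn_integral_count_space') (auto simp: tile_iff[OF \<beta>] indicator_def)
    then show "f x = esum (\<lambda>k. indicator (tile \<beta> k) x * f x)" by (simp add: tile_iff[OF \<beta>] indicator_def)
  qed
  also have "\<dots> = esum (\<lambda>k. \<integral>\<^sup>+x. indicator (tile \<beta> k) x * f x \<partial>lborel)"
    by (rule nn_integral_esum_int) measurable
  also have "\<dots> = esum (\<lambda>k::int. \<integral>\<^sup>+x. f (x + k / \<beta>) \<partial>period_measure \<beta>)"
  proof (rule nn_integral_cong)
    fix k :: int
    have "(\<integral>\<^sup>+x. indicator (tile \<beta> k) x * f x \<partial>lborel)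
        = (\<integral>\<^sup>+x. indicator (tile \<beta> k) (x + k / \<beta>) * f (x + k / \<beta>) \<partial>lborel)"
      by (rule nn_integral_shift) measurable
    also have "\<dots> = (\<integral>\<^sup>+x. indicator {0..<1/\<beta>} x * f (x + k / \<beta>) \<partial>lborel)"
      using tile_shift[OF \<beta>] by (intro nn_integral_cong) (simp add: indicator_def)
    also have "\<dots> = (\<integral>\<^sup>+x. f (x + k / \<beta>) \<partial>period_measure \<beta>)"
      by (rule nn_integral_period[symmetric]) measurable
    finally show "(\<integral>\<^sup>+x. indicator (tile \<beta> k) x * f x \<partial>lborel) = (\<integral>\<^sup>+x. f (x + k / \<beta>) \<partial>period_measure \<beta>)" .
  qed
  also have "\<dots> = (\<integral>\<^sup>+x. esum (\<lambda>k::int. f (x + k / \<beta>)) \<partial>period_measure \<beta>)"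
    by (rule nn_integral_esum_int[symmetric]) measurable
  finally show ?thesis .
qed

lemma integral_finite_tiles:
  fixes G :: "real \<Rightarrow> complex"
  assumes \<beta>: "\<beta> > 0" and G: "integrable lborel G" and K: "finite K"
    and supp: "\<And>x. G x \<noteq> 0 \<Longrightarrow> \<lfloor>\<beta> * x\<rfloor> \<in> K"
  shows "(\<integral>x. G x \<partial>lborel) = (\<integral>x. (\<Sum>k\<in>K. G (x + k / \<beta>)) \<partial>period_measure \<beta>)"
proof -
  have [measurable]: "G \<in> borel_measurable borel" using G by simp
  have intT: "integrable lborel (\<lambda>x. indicator (tile \<beta> k) x *\<^sub>R G x)" for k
    by (rule integrable_mult_indicator[OF _ G]) measurable
  have shift: "integrable lborel (\<lambda>x. g (x + t))" "(\<integral>x. g x \<partial>lborel) = (\<integral>x. g (x + t) \<partial>lborel)"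
    if "integrable lborel g" for g :: "real \<Rightarrow> complex" and t :: real
    using lborel_integrable_real_affine[OF that, of 1 t] lborel_integral_real_affine[of 1 g t]
    by (simp_all add: add.commute)
  have "G x = (\<Sum>k\<in>K. indicator (tile \<beta> k) x *\<^sub>R G x)" for x
  proof (cases "G x = 0")
    case False
    have "(\<Sum>k\<in>K. indicator (tile \<beta> k) x *\<^sub>R G x) = (\<Sum>k\<in>K. if k = \<lfloor>\<beta> * x\<rfloor> then G x else 0)"
      by (intro sum.cong) (auto simp: tile_iff[OF \<beta>] indicator_def)
    then show ?thesis using supp[OF False] K by simp
  qed simp
  then have "(\<integral>x. G x \<partial>lborel) = (\<integral>x. (\<Sum>k\<in>K. indicator (tile \<beta> k) x *\<^sub>R G x) \<partial>lborel)" by presburger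
  also have "\<dots> = (\<Sum>k\<in>K. \<integral>x. indicator (tile \<beta> k) x *\<^sub>R G x \<partial>lborel)"
    by (rule Bochner_Integration.integral_sum) (rule intT)
  also have "\<dots> = (\<Sum>k\<in>K. \<integral>x. indicator {0..<1/\<beta>} x *\<^sub>R G (x + k / \<beta>) \<partial>lborel)"
  proof (rule sum.cong[OF refl])
    fix k
    show "(\<integral>x. indicator (tile \<beta> k) x *\<^sub>R G x \<partial>lborel) = (\<integral>x. indicator {0..<1/\<beta>} x *\<^sub>R G (x + k / \<beta>) \<partial>lborel)"
      unfolding shift(2)[OF intT, of k "k / \<beta>"] using tile_shift[OF \<beta>]
      by (intro Bochner_Integration.integral_cong) (simp_all add: indicator_def)
  qed
  also have "\<dots> = (\<integral>x. (\<Sum>k\<in>K. indicator {0..<1/\<beta>} x *\<^sub>R G (x + k / \<beta>)) \<partial>lborel)"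
    by (rule Bochner_Integration.integral_sum[symmetric])
       (intro integrable_mult_indicator shift(1) G, simp)
  also have "\<dots> = (\<integral>x. (\<Sum>k\<in>K. G (x + k / \<beta>)) \<partial>period_measure \<beta>)"
    by (subst integral_period) (simp_all add: scaleR_sum_right)
  finally show ?thesis .
qed

text \<open>Scaling by \<beta> sends the points \<open>x + k / \<beta>\<close> to integers up to the
  offset \<open>\<beta> * x\<close>, and the two halves of the translated Haar function to
  \<open>[s, s + \<beta> / 2)\<close> and \<open>[s - \<beta> / 2, s)\<close>.\<close>

lemma haar_row_eq_sum:
  fixes \<alpha> \<beta> x :: real and c :: "int \<Rightarrow> complex"
  assumes \<beta>: "\<beta> > 0" and K: "finite K" "\<And>k. haar (x + k / \<beta> - n * \<alpha>) \<noteq> 0 \<Longrightarrow> k \<in> K"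
  shows "(\<Sum>k\<in>K. c k * haar (x + k / \<beta> - n * \<alpha>)) = haar_row (\<alpha> * \<beta>) (\<beta> / 2) (\<beta> * x) c n"
proof -
  define s where "s = n * (\<alpha> * \<beta>) - \<beta> * x"
  define W1 where "W1 = {\<lceil>s\<rceil>..<\<lceil>s + \<beta> / 2\<rceil>}"
  define W2 where "W2 = {\<lceil>s - \<beta> / 2\<rceil>..<\<lceil>s\<rceil>}"
  have 1: "k \<in> W1 \<longleftrightarrow> 0 \<le> x + k / \<beta> - n * \<alpha> \<and> x + k / \<beta> - n * \<alpha> < 1/2" for k :: int
  proof -
    have "k \<in> W1 \<longleftrightarrow> s \<le> k \<and> k < s + \<beta> / 2" by (simp add: W1_def ceiling_le_iff less_ceiling_iff)
    then show ?thesis using \<beta> by (simp add: s_def field_simps)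
  qed
  have 2: "k \<in> W2 \<longleftrightarrow> -1/2 \<le> x + k / \<beta> - n * \<alpha> \<and> x + k / \<beta> - n * \<alpha> < 0" for k :: int
  proof -
    have "k \<in> W2 \<longleftrightarrow> s - \<beta> / 2 \<le> k \<and> k < s" by (simp add: W2_def ceiling_le_iff less_ceiling_iff)
    then show ?thesis using \<beta> by (simp add: s_def field_simps)
  qed
  have haar: "haar (x + k / \<beta> - n * \<alpha>) = (if k \<in> W1 then 1 else 0) - (if k \<in> W2 then 1 else 0)" for k :: int
    unfolding 1 2 haar_cases by auto
  have sub: "W1 \<subseteq> K" "W2 \<subseteq> K" using K(2) unfolding haar by (auto simp: W1_def W2_def)
  have "(\<Sum>k\<in>K. c k * haar (x + k / \<beta> - n * \<alpha>)) = (\<Sum>k\<in>K. if k \<in> W1 then c k else 0) - (\<Sum>k\<in>K. if k \<in> W2 then c k else 0)"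
    unfolding haar sum_subtractf[symmetric] by (intro sum.cong) auto
  also have "\<dots> = sum c W1 - sum c W2"
    using sub K(1) by (simp add: sum.If_cases Int_absorb1)
  also have "\<dots> = haar_row (\<alpha> * \<beta>) (\<beta> / 2) (\<beta> * x) c n"
    by (simp add: haar_row_def window_sum_def W1_def W2_def s_def)
  finally show ?thesis .
qed

definition fiber :: "real \<Rightarrow> (real \<Rightarrow> complex) \<Rightarrow> real \<Rightarrow> int \<Rightarrow> complex" where
  "fiber \<beta> f x k = f (x + k / \<beta>)"

lemma locally_integrable_of_square:
  fixes f :: "real \<Rightarrow> complex"
  assumes [measurable]: "f \<in> borel_measurable borel" "g \<in> borel_measurable borel"
    and fin: "(\<integral>\<^sup>+x. sqn (f x) \<partial>lborel) < \<infinity>"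
    and g: "\<And>x. cmod (g x) \<le> indicator {p..q} x"
  shows "integrable lborel (\<lambda>x. f x * g x)"
proof -
  have 1: "integrable lborel (\<lambda>x. (cmod (f x))\<^sup>2)"
    using fin unfolding sqn_def by (intro integrableI_bounded) auto
  have "integrable lborel (\<lambda>x. indicator {p..q} x + (cmod (f x))\<^sup>2 :: real)"
    using 1 by (intro Bochner_Integration.integrable_add integrable_real_indicator)
      (auto simp: emeasure_lborel_Icc_eq)
  then show ?thesis
  proof (rule Bochner_Integration.integrable_bound)
    show "AE x in lborel. norm (f x * g x) \<le> norm (indicator {p..q} x + (cmod (f x))\<^sup>2 :: real)"
    proof (rule AE_I2)
      fix x
      have "2 * cmod (f x) \<le> 1 + (cmod (f x))\<^sup>2"
        using sum_squares_bound[of 1 "cmod (f x)"] by simp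
      then have "cmod (f x) \<le> 1 + (cmod (f x))\<^sup>2" using norm_ge_zero[of "f x"] by linarith
      moreover have "cmod (f x * g x) \<le> cmod (f x) * indicator {p..q} x"
        unfolding norm_mult by (intro mult_left_mono g) simp
      ultimately show "norm (f x * g x) \<le> norm (indicator {p..q} x + (cmod (f x))\<^sup>2 :: real)"
        by (auto simp: indicator_def split: if_splits)
    qed
  qed measurable
qed

text \<open>For fixed \<open>n\<close>, \<open>f\<close> times the window lives on the finitely many
  tiles in \<open>K\<close> and periodises to the finite sum \<open>h\<close>. The coefficients in
  \<open>m\<close> are Fourier coefficients of \<open>h\<close>, so Parseval applies. The rows agree
  with \<open>h\<close> on one period only, hence the indicator in the measurability claim.\<close>

lemma gabor_coefficients_fiber:
  fixes \<alpha> \<beta> :: real and n :: int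
  assumes \<alpha>: "\<alpha> > 0" and \<beta>: "\<beta> > 0" and f[measurable]: "f \<in> borel_measurable borel"
    and fin: "(\<integral>\<^sup>+x. sqn (f x) \<partial>lborel) < \<infinity>"
  shows "esum (\<lambda>m. sqn (\<integral>x. f x * cnj (gabor haar \<alpha> \<beta> (m, n) x) \<partial>lborel)) =
    ennreal (1 / \<beta>) * (\<integral>\<^sup>+x. sqn (haar_row (\<alpha> * \<beta>) (\<beta> / 2) (\<beta> * x) (fiber \<beta> f x) n) \<partial>period_measure \<beta>)"
    "(\<lambda>x. indicator {0..<1/\<beta>} x * sqn (haar_row (\<alpha> * \<beta>) (\<beta> / 2) (\<beta> * x) (fiber \<beta> f x) n)) \<in> borel_measurable borel"
    "(\<integral>\<^sup>+x. sqn (haar_row (\<alpha> * \<beta>) (\<beta> / 2) (\<beta> * x) (fiber \<beta> f x) n) \<partial>period_measure \<beta>)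
      = (\<integral>\<^sup>+x. indicator {0..<1/\<beta>} x * sqn (haar_row (\<alpha> * \<beta>) (\<beta> / 2) (\<beta> * x) (fiber \<beta> f x) n) \<partial>lborel)"
proof -
  let ?P = "period_measure \<beta>"
  let ?row = "\<lambda>x. haar_row (\<alpha> * \<beta>) (\<beta> / 2) (\<beta> * x) (fiber \<beta> f x) n"
  define K where "K = {\<lfloor>\<beta> * (n * \<alpha> - 1/2)\<rfloor> - 1..\<lfloor>\<beta> * (n * \<alpha> + 1/2)\<rfloor> + 1}"
  have K: "finite K" by (simp add: K_def)
  have inK: "\<lfloor>\<beta> * x\<rfloor> \<in> K" if "haar (x - n * \<alpha>) \<noteq> 0" for x
  proof -
    have "n * \<alpha> - 1/2 \<le> x" "x \<le> n * \<alpha> + 1/2" using that by (auto simp: haar_cases split: if_splits)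
    then have "\<beta> * (n * \<alpha> - 1/2) \<le> \<beta> * x" "\<beta> * x \<le> \<beta> * (n * \<alpha> + 1/2)" using \<beta> by auto
    then have "\<lfloor>\<beta> * (n * \<alpha> - 1/2)\<rfloor> \<le> \<lfloor>\<beta> * x\<rfloor>" "\<lfloor>\<beta> * x\<rfloor> \<le> \<lfloor>\<beta> * (n * \<alpha> + 1/2)\<rfloor>" by (simp_all add: floor_mono)
    then show ?thesis by (simp add: K_def)
  qed
  define h where "h x = (\<Sum>k\<in>K. f (x + k / \<beta>) * haar (x + k / \<beta> - n * \<alpha>))" for x
  have [measurable]: "h \<in> borel_measurable borel" unfolding h_def[abs_def] by measurable
  have h_row: "h x = ?row x" if "x \<in> {0..<1/\<beta>}" for x
  proof -
    have "k \<in> K" if "haar (x + k / \<beta> - n * \<alpha>) \<noteq> 0" for k :: int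
    proof -
      have "\<lfloor>\<beta> * (x + k / \<beta>)\<rfloor> = k"
        using \<open>x \<in> {0..<1/\<beta>}\<close> tile_shift[OF \<beta>] tile_iff[OF \<beta>] by blast
      then show ?thesis using inK[OF that] by simp
    qed
    from haar_row_eq_sum[OF \<beta> K this, where c="fiber \<beta> f x" and n=n] show ?thesis
      by (simp add: h_def fiber_def)
  qed
  have ind_eq: "(\<lambda>x. indicator {0..<1/\<beta>} x * sqn (?row x)) = (\<lambda>x. indicator {0..<1/\<beta>} x * sqn (h x))"
    using h_row by (auto simp: indicator_def fun_eq_iff)
  show "(\<lambda>x. indicator {0..<1/\<beta>} x * sqn (?row x)) \<in> borel_measurable borel"
    unfolding ind_eq by measurable
  have AEP: "AE x in ?P. x \<in> {0..<1/\<beta>}"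
    unfolding period_measure_def by (subst AE_density) (auto simp: indicator_def)
  have row_h: "(\<integral>\<^sup>+x. sqn (?row x) \<partial>?P) = (\<integral>\<^sup>+x. sqn (h x) \<partial>?P)"
    using AEP h_row by (intro nn_integral_cong_AE) auto
  then show "(\<integral>\<^sup>+x. sqn (?row x) \<partial>?P) = (\<integral>\<^sup>+x. indicator {0..<1/\<beta>} x * sqn (?row x) \<partial>lborel)"
    unfolding ind_eq by (simp add: nn_integral_period)
  have finh: "(\<integral>\<^sup>+x. sqn (h x) \<partial>?P) < \<infinity>"
  proof -
    have "(\<integral>\<^sup>+x. sqn (h x) \<partial>?P) \<le> (\<integral>\<^sup>+x. of_nat (card K) * (\<Sum>k\<in>K. sqn (f (x + k / \<beta>))) \<partial>?P)"
    proof (rule nn_integral_mono)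
      fix x
      have "sqn (h x) \<le> of_nat (card K) * (\<Sum>k\<in>K. sqn (f (x + k / \<beta>) * haar (x + k / \<beta> - n * \<alpha>)))"
        unfolding h_def by (rule sqn_sum_le[OF K])
      also have "\<dots> \<le> of_nat (card K) * (\<Sum>k\<in>K. sqn (f (x + k / \<beta>)))"
        by (intro mult_left_mono sum_mono sqn_le) (auto simp: norm_mult mult_left_le)
      finally show "sqn (h x) \<le> of_nat (card K) * (\<Sum>k\<in>K. sqn (f (x + k / \<beta>)))" .
    qed
    also have "\<dots> = of_nat (card K) * (\<Sum>k\<in>K. \<integral>\<^sup>+x. sqn (f (x + k / \<beta>)) \<partial>?P)"
      by (simp add: nn_integral_cmult nn_integral_sum)
    also have "\<dots> \<le> of_nat (card K) * (\<Sum>k\<in>K. \<integral>\<^sup>+x. sqn (f x) \<partial>lborel)"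
    proof (intro mult_left_mono sum_mono)
      fix k :: int
      have "(\<integral>\<^sup>+x. sqn (f (x + k / \<beta>)) \<partial>?P) \<le> (\<integral>\<^sup>+x. sqn (f (x + k / \<beta>)) \<partial>lborel)"
        by (subst nn_integral_period) (auto intro!: nn_integral_mono simp: indicator_def)
      also have "\<dots> = (\<integral>\<^sup>+x. sqn (f x) \<partial>lborel)"
        by (rule nn_integral_shift[symmetric]) measurable
      finally show "(\<integral>\<^sup>+x. sqn (f (x + k / \<beta>)) \<partial>?P) \<le> (\<integral>\<^sup>+x. sqn (f x) \<partial>lborel)" .
    qed auto
    also have "\<dots> < \<infinity>" using fin by (simp add: ennreal_mult_less_top ennreal_of_nat_eq_real_of_nat)
    finally show ?thesis .
  qed
  have coef: "(\<integral>x. f x * cnj (gabor haar \<alpha> \<beta> (m, n) x) \<partial>lborel) = (\<integral>x. h x * wave \<beta> m x \<partial>?P)" for m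
  proof -
    define G where "G x = f x * (haar (x - n * \<alpha>) * wave \<beta> m x)" for x
    have "integrable lborel G" unfolding G_def[abs_def]
    proof (rule locally_integrable_of_square[OF f _ fin])
      fix x
      show "cmod (haar (x - n * \<alpha>) * wave \<beta> m x) \<le> indicator {n * \<alpha> - 1/2..n * \<alpha> + 1/2} x"
        by (auto simp: norm_mult haar_cases indicator_def)
    qed measurable
    then have "(\<integral>x. G x \<partial>lborel) = (\<integral>x. (\<Sum>k\<in>K. G (x + k / \<beta>)) \<partial>?P)"
      by (rule integral_finite_tiles[OF \<beta> _ K]) (use inK in \<open>auto simp: G_def\<close>)
    moreover have "(\<Sum>k\<in>K. G (x + k / \<beta>)) = h x * wave \<beta> m x" for x
    proof -
      have "wave \<beta> m (x + k / \<beta>) = wave \<beta> m x" for k :: int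
      proof -
        have "wave \<beta> m (x + k / \<beta>) = cis (2 * pi * m * \<beta> * x + 2 * pi * of_int (m * k))"
        proof -
          have "2 * pi * m * \<beta> * (x + k / \<beta>) = 2 * pi * m * \<beta> * x + 2 * pi * of_int (m * k)"
            using \<beta> by (simp add: field_simps)
          then show ?thesis by (simp only: wave_def)
        qed
        also have "\<dots> = wave \<beta> m x" unfolding cis_mult[symmetric] by (simp add: wave_def cis_multiple_2pi)
        finally show ?thesis .
      qed
      then show ?thesis by (simp add: G_def h_def sum_distrib_right mult.assoc)
    qed
    ultimately show ?thesis by (simp add: G_def cnj_gabor_haar)
  qed
  have "esum (\<lambda>m. sqn (\<integral>x. f x * cnj (gabor haar \<alpha> \<beta> (m, n) x) \<partial>lborel))
      = esum (\<lambda>m. sqn (\<integral>x. h x * wave \<beta> m x \<partial>?P))" by (simp only: coef)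
  also have "\<dots> = ennreal (1 / \<beta>) * (\<integral>\<^sup>+x. sqn (h x) \<partial>?P)"
    by (rule parseval[OF \<beta> _ finh]) measurable
  finally show "esum (\<lambda>m. sqn (\<integral>x. f x * cnj (gabor haar \<alpha> \<beta> (m, n) x) \<partial>lborel))
      = ennreal (1 / \<beta>) * (\<integral>\<^sup>+x. sqn (?row x) \<partial>?P)" by (simp only: row_h)
qed

theorem gabor_energy_fiber:
  fixes \<alpha> \<beta> :: real
  assumes \<alpha>: "\<alpha> > 0" and \<beta>: "\<beta> > 0" and f[measurable]: "f \<in> borel_measurable borel"
    and fin: "(\<integral>\<^sup>+x. sqn (f x) \<partial>lborel) < \<infinity>"
  shows "esum (\<lambda>i. sqn (\<integral>x. f x * cnj (gabor haar \<alpha> \<beta> i x) \<partial>lborel)) = ennreal (1 / \<beta>) *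
    (\<integral>\<^sup>+x. indicator {0..<1/\<beta>} x * esum (\<lambda>n. sqn (haar_row (\<alpha> * \<beta>) (\<beta> / 2) (\<beta> * x) (fiber \<beta> f x) n)) \<partial>lborel)"
proof -
  let ?c = "\<lambda>i. sqn (\<integral>x. f x * cnj (gabor haar \<alpha> \<beta> i x) \<partial>lborel)"
  let ?r = "\<lambda>n x. indicator {0..<1/\<beta>} x * sqn (haar_row (\<alpha> * \<beta>) (\<beta> / 2) (\<beta> * x) (fiber \<beta> f x) n)"
  note fib = gabor_coefficients_fiber[OF assms]
  have "esum ?c = esum (\<lambda>n. esum (\<lambda>m. ?c (m, n)))"
    by (rule nn_integral_snd_count_space[symmetric])
  also have "\<dots> = esum (\<lambda>n. ennreal (1 / \<beta>) * (\<integral>\<^sup>+x. ?r n x \<partial>lborel))"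
    by (simp only: fib(1) fib(3))
  also have "\<dots> = ennreal (1 / \<beta>) * (\<integral>\<^sup>+x. esum (\<lambda>n. ?r n x) \<partial>lborel)"
  proof -
    have "(\<integral>\<^sup>+x. esum (\<lambda>n. ?r n x) \<partial>lborel) = esum (\<lambda>n. \<integral>\<^sup>+x. ?r n x \<partial>lborel)"
      by (rule nn_integral_esum_int) (simp add: fib(2))
    then show ?thesis by (simp only: esum_cmult[of "ennreal (1 / \<beta>)"])
  qed
  finally show ?thesis by (simp only: esum_cmult)
qed

section \<open>Frame criteria\<close>

text \<open>\<open>L2\<close> admits Lebesgue measurable representatives, while tiling and fibering
  are carried out for Borel functions; the exchange is made once, here.\<close>

lemma completion_borel_complex:
  fixes f :: "real \<Rightarrow> complex"
  assumes [measurable]: "f \<in> borel_measurable lebesgue"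
  obtains g where "g \<in> borel_measurable borel" "AE x in lborel. f x = g x"
proof -
  have "(\<lambda>x. Re (f x)) \<in> borel_measurable lebesgue" "(\<lambda>x. Im (f x)) \<in> borel_measurable lebesgue"
    by measurable
  then obtain r i where r: "r \<in> borel_measurable lborel" "AE x in lborel. Re (f x) = r x"
    and i: "i \<in> borel_measurable lborel" "AE x in lborel. Im (f x) = i x"
    using completion_ex_borel_measurable_real by metis
  show thesis
  proof
    have [measurable]: "r \<in> borel_measurable borel" "i \<in> borel_measurable borel" using r(1) i(1) by simp_all
    show "(\<lambda>x. complex_of_real (r x) + \<i> * complex_of_real (i x)) \<in> borel_measurable borel" by measurable
    show "AE x in lborel. f x = complex_of_real (r x) + \<i> * complex_of_real (i x)"
      using r(2) i(2) by eventually_elim (simp add: complex_eq_iff)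
  qed
qed

lemma L2_transfer:
  fixes f g :: "real \<Rightarrow> complex"
  assumes f: "f \<in> L2" and g[measurable]: "g \<in> borel_measurable borel" and eq: "AE x in lborel. f x = g x"
  shows "ennreal ((L2_norm f)\<^sup>2) = (\<integral>\<^sup>+x. sqn (g x) \<partial>lborel)"
    and "\<phi> \<in> borel_measurable borel \<Longrightarrow> L2_inner f \<phi> = (\<integral>x. g x * cnj (\<phi> x) \<partial>lborel)"
proof -
  have fm[measurable]: "f \<in> borel_measurable lebesgue" and fi: "integrable lebesgue (\<lambda>x. (cmod (f x))\<^sup>2)"
    using f by (auto simp: L2_def)
  have gl[measurable]: "g \<in> borel_measurable lebesgue" using g by (intro measurable_completion) simp
  have eq': "AE x in lebesgue. f x = g x" by (rule AE_completion[OF eq])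
  have "(L2_norm f)\<^sup>2 = (\<integral>x. (cmod (f x))\<^sup>2 \<partial>lebesgue)"
    unfolding L2_norm_def by (rule real_sqrt_pow2) simp
  then have "ennreal ((L2_norm f)\<^sup>2) = (\<integral>\<^sup>+x. ennreal ((cmod (f x))\<^sup>2) \<partial>lebesgue)"
    by (simp add: nn_integral_eq_integral[OF fi])
  also have "\<dots> = (\<integral>\<^sup>+x. sqn (g x) \<partial>lebesgue)"
    using eq' by (intro nn_integral_cong_AE) (auto simp: sqn_def)
  finally show "ennreal ((L2_norm f)\<^sup>2) = (\<integral>\<^sup>+x. sqn (g x) \<partial>lborel)"
    by (simp add: nn_integral_completion)
  assume \<phi>: "\<phi> \<in> borel_measurable borel"
  have cnj_m: "cnj \<in> borel_measurable borel"
    by (intro borel_measurable_continuous_onI continuous_intros)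
  have gphi: "(\<lambda>x. g x * cnj (\<phi> x)) \<in> borel_measurable lborel"
    using borel_measurable_times[OF g measurable_compose[OF \<phi> cnj_m]] by simp
  have fphi: "(\<lambda>x. f x * cnj (\<phi> x)) \<in> borel_measurable lebesgue"
    by (intro borel_measurable_times fm measurable_completion) (use measurable_compose[OF \<phi> cnj_m] in simp)
  have "L2_inner f \<phi> = (\<integral>x. g x * cnj (\<phi> x) \<partial>lebesgue)"
    unfolding L2_inner_def using eq' by (intro integral_cong_AE fphi measurable_completion gphi) auto
  also have "\<dots> = (\<integral>x. g x * cnj (\<phi> x) \<partial>lborel)" by (rule integral_completion[OF gphi])
  finally show "L2_inner f \<phi> = (\<integral>x. g x * cnj (\<phi> x) \<partial>lborel)" .
qed

lemma borel_in_L2: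
  assumes [measurable]: "f \<in> borel_measurable borel" and "(\<integral>\<^sup>+x. sqn (f x) \<partial>lborel) < \<infinity>"
  shows "f \<in> L2"
proof -
  have fl[measurable]: "f \<in> borel_measurable lebesgue" using assms(1) by (intro measurable_completion) simp
  moreover have "integrable lebesgue (\<lambda>x. (cmod (f x))\<^sup>2)"
    using assms(2) unfolding sqn_def by (intro integrableI_bounded) (auto simp: nn_integral_completion)
  ultimately show ?thesis by (simp add: L2_def)
qed

lemma gabor_haar_in_L2: "gabor haar \<alpha> \<beta> i \<in> L2"
proof (rule borel_in_L2)
  obtain m n where i: "i = (m, n)" by (cases i)
  have "(\<integral>\<^sup>+x. sqn (gabor haar \<alpha> \<beta> i x) \<partial>lborel) \<le> (\<integral>\<^sup>+x. indicator {n * \<alpha> - 1/2..n * \<alpha> + 1/2} x \<partial>lborel)"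
    unfolding i gabor_haar_eq by (intro nn_integral_mono) (auto simp: sqn_def haar_cases indicator_def norm_mult)
  also have "\<dots> < \<infinity>" by (simp add: emeasure_lborel_Icc_eq)
  finally show "(\<integral>\<^sup>+x. sqn (gabor haar \<alpha> \<beta> i x) \<partial>lborel) < \<infinity>" .
qed measurable

theorem frame_if_rows_bounded:
  fixes \<alpha> \<beta> C1 C2 :: real
  assumes \<alpha>: "\<alpha> > 0" and \<beta>: "\<beta> > 0" and C: "C1 > 0" "C2 > 0"
    and lower: "\<And>y c. esum (\<lambda>k. sqn (c k)) < \<infinity> \<Longrightarrow>
        esum (\<lambda>k. sqn (c k)) \<le> ennreal C1 * esum (\<lambda>n. sqn (haar_row (\<alpha> * \<beta>) (\<beta> / 2) y c n))"
    and upper: "\<And>y c. esum (\<lambda>n. sqn (haar_row (\<alpha> * \<beta>) (\<beta> / 2) y c n)) \<le> ennreal C2 * esum (\<lambda>k. sqn (c k))"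
  shows "is_frame (gabor haar \<alpha> \<beta>)"
  unfolding is_frame_def
proof (intro conjI exI ballI allI)
  show "gabor haar \<alpha> \<beta> i \<in> L2" for i by (rule gabor_haar_in_L2)
  \<comment> \<open>The factor \<open>1 / \<beta>\<close> comes from Parseval on a period.\<close>
  let ?A = "1 / (\<beta> * C1)" and ?B = "C2 / \<beta>"
  show "?A > 0" "?B > 0" using \<beta> C by auto
  fix f :: "real \<Rightarrow> complex" assume f: "f \<in> L2"
  then obtain g where g[measurable]: "g \<in> borel_measurable borel" and eq: "AE x in lborel. f x = g x"
    using completion_borel_complex[of f] by (auto simp: L2_def)
  note tr = L2_transfer[OF f g eq]
  let ?c = "\<lambda>i. (cmod (L2_inner f (gabor haar \<alpha> \<beta> i)))\<^sup>2"
  define N where "N = (\<integral>\<^sup>+x. sqn (g x) \<partial>lborel)"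
  define E where "E = esum (\<lambda>i. ennreal (?c i))"
  define ind where "ind x = (indicator {0..<1/\<beta>} x :: ennreal)" for x
  define F where "F x = esum (\<lambda>k. sqn (fiber \<beta> g x k))" for x
  define R where "R x = esum (\<lambda>n. sqn (haar_row (\<alpha> * \<beta>) (\<beta> / 2) (\<beta> * x) (fiber \<beta> g x) n))" for x
  have N: "N = ennreal ((L2_norm f)\<^sup>2)" unfolding N_def by (rule tr(1)[symmetric])
  have fin: "(\<integral>\<^sup>+x. sqn (g x) \<partial>lborel) < \<infinity>" using N unfolding N_def by simp
  have [measurable]: "F \<in> borel_measurable borel" "ind \<in> borel_measurable borel"
    unfolding F_def[abs_def] fiber_def ind_def[abs_def] by measurable
  have NF: "N = (\<integral>\<^sup>+x. ind x * F x \<partial>lborel)"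
    unfolding N_def ind_def F_def fiber_def
    by (subst nn_integral_tiles[OF \<beta>], measurable) (rule nn_integral_period, measurable)
  have ER: "E = ennreal (1 / \<beta>) * (\<integral>\<^sup>+x. ind x * R x \<partial>lborel)"
  proof -
    have "E = esum (\<lambda>i. sqn (\<integral>x. g x * cnj (gabor haar \<alpha> \<beta> i x) \<partial>lborel))"
      unfolding E_def using tr(2)[OF gabor_haar_measurable] by (simp add: sqn_def)
    also have "\<dots> = ennreal (1 / \<beta>) * (\<integral>\<^sup>+x. ind x * R x \<partial>lborel)"
      unfolding ind_def R_def by (rule gabor_energy_fiber[OF \<alpha> \<beta> g fin])
    finally show ?thesis .
  qed
  have "(\<integral>\<^sup>+x. ind x * R x \<partial>lborel) \<le> (\<integral>\<^sup>+x. ennreal C2 * (ind x * F x) \<partial>lborel)"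
  proof (rule nn_integral_mono)
    fix x
    have "ind x * R x \<le> ind x * (ennreal C2 * F x)"
      unfolding R_def F_def by (intro mult_left_mono upper) simp
    then show "ind x * R x \<le> ennreal C2 * (ind x * F x)" by (simp only: mult.left_commute)
  qed
  also have "\<dots> = ennreal C2 * N" unfolding NF by (rule nn_integral_cmult) measurable
  finally have "E \<le> ennreal (1 / \<beta>) * (ennreal C2 * N)" unfolding ER by (rule mult_left_mono) simp
  also have "\<dots> = ennreal (?B * (L2_norm f)\<^sup>2)"
    unfolding N using \<beta> C by (simp flip: ennreal_mult)
  finally have EB: "E \<le> ennreal (?B * (L2_norm f)\<^sup>2)" .
  have Efin: "E < \<infinity>" using EB by (rule le_less_trans) simp
  \<comment> \<open>The lower row bound is available for square-summable sequences only; almost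
    every fibre is one because the norm of \<open>f\<close> is finite.\<close>
  have "AE x in lborel. ind x * F x \<noteq> \<infinity>"
    by (rule nn_integral_PInf_AE) (measurable, simp add: NF[symmetric] N)
  then have "(\<integral>\<^sup>+x. ind x * F x \<partial>lborel) \<le> (\<integral>\<^sup>+x. ind x * (ennreal C1 * R x) \<partial>lborel)"
  proof (intro nn_integral_mono_AE, eventually_elim)
    fix x assume "ind x * F x \<noteq> \<infinity>"
    then show "ind x * F x \<le> ind x * (ennreal C1 * R x)"
    proof (cases "x \<in> {0..<1/\<beta>}")
      case True
      then have "ind x = 1" by (simp add: ind_def)
      then have "F x < \<infinity>" using \<open>ind x * F x \<noteq> \<infinity>\<close> by (simp add: less_top)
      then have "F x \<le> ennreal C1 * R x" unfolding F_def R_def by (rule lower)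
      then show ?thesis by (rule mult_left_mono) simp
    qed (simp add: ind_def)
  qed
  also have "\<dots> = (\<integral>\<^sup>+x. ennreal C1 * (ind x * R x) \<partial>lborel)" by (simp only: mult.left_commute)
  also have "\<dots> = ennreal C1 * (\<integral>\<^sup>+x. ind x * R x \<partial>lborel)"
  proof (rule nn_integral_cmult)
    have "(\<lambda>x. esum (\<lambda>n. ind x * sqn (haar_row (\<alpha> * \<beta>) (\<beta> / 2) (\<beta> * x) (fiber \<beta> g x) n))) \<in> borel_measurable borel"
      unfolding ind_def by (intro esum_int_measurable gabor_coefficients_fiber(2)[OF \<alpha> \<beta> g fin])
    then show "(\<lambda>x. ind x * R x) \<in> borel_measurable lborel" unfolding R_def esum_cmult by simp
  qed
  also have "\<dots> = ennreal (C1 * \<beta>) * E"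
    unfolding ER using \<beta> C by (simp flip: ennreal_mult mult.assoc)
  finally have NE: "N \<le> ennreal (C1 * \<beta>) * E" unfolding NF .
  show sm: "?c summable_on UNIV"
    using Efin unfolding E_def by (intro summable_esum) auto
  have EI: "E = ennreal (infsum ?c UNIV)" unfolding E_def by (rule esum_summable[OF sm]) simp
  have I0: "0 \<le> infsum ?c UNIV" by (rule infsum_nonneg) simp
  show "infsum ?c UNIV \<le> ?B * (L2_norm f)\<^sup>2"
    using EB \<beta> C unfolding EI by (subst (asm) ennreal_le_iff) auto
  have "(L2_norm f)\<^sup>2 \<le> C1 * \<beta> * infsum ?c UNIV"
    using NE unfolding N EI using \<beta> C I0 by (subst (asm) ennreal_mult[symmetric]) (auto simp: ennreal_le_iff)
  then show "?A * (L2_norm f)\<^sup>2 \<le> infsum ?c UNIV"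
    using \<beta> C by (simp add: field_simps)
qed

section \<open>From the frame inequality back to single fibres\<close>

lemma lattice_gap:
  fixes a r :: real
  assumes "a > 0"
  shows "\<exists>\<delta>>0. \<forall>n::int. r + n * a > 0 \<longrightarrow> r + n * a \<ge> \<delta>"
proof -
  define n0 where "n0 = \<lfloor>- r / a\<rfloor> + 1"
  have "- r / a < n0" unfolding n0_def by linarith
  then have pos: "r + n0 * a > 0" using assms by (simp add: field_simps)
  have "r + n * a \<ge> r + n0 * a" if "r + n * a > 0" for n :: int
  proof -
    have "- r / a < n" using that assms by (simp add: field_simps)
    then have "n0 \<le> n" unfolding n0_def by linarith
    then show ?thesis using assms by simp
  qed
  then show ?thesis using pos by blast
qed

lemma lattice_gap_finite:
  fixes a :: real
  assumes a: "a > 0" and "finite Z"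
  shows "\<exists>\<delta>>0. \<forall>r\<in>Z. \<forall>n::int. r + n * a > 0 \<longrightarrow> r + n * a \<ge> \<delta>"
  using assms(2)
proof induction
  case empty
  show ?case by (intro exI[of _ 1]) simp
next
  case (insert r Z)
  then obtain d where d: "d > 0" "\<forall>r\<in>Z. \<forall>n::int. r + n * a > 0 \<longrightarrow> r + n * a \<ge> d" by blast
  obtain e where e: "e > 0" "\<forall>n::int. r + n * a > 0 \<longrightarrow> r + n * a \<ge> e" using lattice_gap[OF a] by blast
  show ?case
  proof (intro exI[of _ "min d e"] conjI ballI allI impI)
    show "0 < min d e" using d(1) e(1) by simp
    fix s n assume "s \<in> insert r Z" "s + real_of_int n * a > 0"
    then show "min d e \<le> s + real_of_int n * a" using d(2) e(2) by (auto simp: min_le_iff_disj)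
  qed
qed

lemma window_sum_support:
  fixes p q :: real
  assumes "finite S" "\<And>k. c k \<noteq> 0 \<Longrightarrow> k \<in> S"
  shows "window_sum c p q = (\<Sum>k\<in>S. if p \<le> k \<and> k < q then c k else 0)"
proof -
  have "window_sum c p q = (\<Sum>k\<in>{\<lceil>p\<rceil>..<\<lceil>q\<rceil>} \<inter> S. c k)"
    unfolding window_sum_def by (rule sum.mono_neutral_right) (use assms(2) in auto)
  also have "\<dots> = (\<Sum>k\<in>S. if k \<in> {\<lceil>p\<rceil>..<\<lceil>q\<rceil>} then c k else 0)"
    by (simp only: Int_commute[of _ S] sum.inter_restrict[OF assms(1)])
  also have "\<dots> = (\<Sum>k\<in>S. if p \<le> k \<and> k < q then c k else 0)"
    by (intro sum.cong) (auto simp: ceiling_le_iff less_ceiling_iff)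
  finally show ?thesis .
qed

text \<open>As \<open>y\<close> grows, window ends move left, and with half-open windows a
  comparison with \<open>k\<close> changes only when an end lying strictly beyond \<open>k\<close>
  reaches it. For finite support, the positive distances from ends to integers, over all
  \<open>n\<close> at once, lie in finitely many cosets of the multiples of \<open>a\<close> and so
  have a positive lower bound.\<close>

lemma haar_row_stable:
  fixes a b y :: real
  assumes a: "a > 0" and S: "finite S" "\<And>k. c k \<noteq> 0 \<Longrightarrow> k \<in> S"
  shows "\<exists>\<delta>>0. \<forall>y'. y \<le> y' \<and> y' < y + \<delta> \<longrightarrow> haar_row a b y' c = haar_row a b y c"
proof -
  define Z where "Z = (\<lambda>(o1, k::int). - y + o1 - k) ` ({0, b, -b} \<times> S)"
  have "finite Z" using S(1) by (simp add: Z_def)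
  then obtain \<delta> where \<delta>: "\<delta> > 0" "\<And>r n. r \<in> Z \<Longrightarrow> r + real_of_int n * a > 0 \<Longrightarrow> r + n * a \<ge> \<delta>"
    using lattice_gap_finite[OF a, of Z] by blast
  have key: "n * a - y' + o1 \<le> k \<longleftrightarrow> n * a - y + o1 \<le> k"
    if "o1 \<in> {0, b, -b}" "k \<in> S" "y \<le> y'" "y' < y + \<delta>" for o1 y' :: real and n k :: int
  proof -
    have "- y + o1 - k \<in> Z" unfolding Z_def using that(1,2) by force
    from \<delta>(2)[OF this, of n] have "n * a - y + o1 \<le> k \<or> \<delta> \<le> - y + o1 - k + n * a"
      by (cases "n * a - y + o1 \<le> k") auto
    then show ?thesis using that(3,4) by auto
  qed
  have ws: "window_sum c p q = (\<Sum>k\<in>S. if p \<le> k \<and> k < q then c k else 0)" for p q :: real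
    by (rule window_sum_support) (use S in auto)
  have "haar_row a b y' c = haar_row a b y c" if y': "y \<le> y'" "y' < y + \<delta>" for y'
  proof (rule ext)
    fix n :: int
    note k0 = key[of 0, OF _ _ y', simplified] and kb = key[of b, OF _ _ y', simplified]
      and km = key[of "-b", OF _ _ y', simplified]
    have "(if n * a - y' \<le> k \<and> k < n * a - y' + b then c k else 0)
        = (if n * a - y \<le> k \<and> k < n * a - y + b then c k else 0)"
      "(if n * a - y' - b \<le> k \<and> k < n * a - y' then c k else 0)
        = (if n * a - y - b \<le> k \<and> k < n * a - y then c k else 0)" if "k \<in> S" for k
      using k0[OF that, of n] kb[OF that, of n] km[OF that, of n] by (auto simp: not_le[symmetric])
    then show "haar_row a b y' c n = haar_row a b y c n"
      unfolding haar_row_def ws by (simp cong: sum.cong)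
  qed
  then show ?thesis using \<delta>(1) by blast
qed

lemma haar_row_translate:
  "haar_row a b y (\<lambda>k. c (k + z)) n = haar_row a b (y - of_int z) c n"
proof -
  have shift: "window_sum (\<lambda>k. c (k + z)) p q = window_sum c (p + z) (q + z)" for p q :: real
    unfolding window_sum_def ceiling_add_of_int
    by (rule sum.reindex_bij_witness[of _ "\<lambda>k. k - z" "\<lambda>k. k + z"]) auto
  have "n * a - y + z = n * a - (y - z)" "n * a - y + b + z = n * a - (y - z) + b"
    "n * a - y - b + z = n * a - (y - z) - b" by auto
  then show ?thesis unfolding haar_row_def shift by (simp only:)
qed

text \<open>The sequence is spread into a step function whose nonzero fibres are translates of
  \<open>c\<close>, with the rows of \<open>c\<close> at \<open>y\<close>. The measure
  \<open>M\<close> of the nonzero fibres occurs on both sides of the frame inequality and cancels,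
  so the bound holds for every \<open>y\<close>, not just almost every one.\<close>

theorem frame_imp_rows_bounded:
  fixes \<alpha> \<beta> :: real
  assumes \<alpha>: "\<alpha> > 0" and \<beta>: "\<beta> > 0" and frame: "is_frame (gabor haar \<alpha> \<beta>)"
  obtains A where "A > 0" "\<And>y c. finite {k. c k \<noteq> 0} \<Longrightarrow>
    ennreal A * esum (\<lambda>k. sqn (c k)) \<le> esum (\<lambda>n. sqn (haar_row (\<alpha> * \<beta>) (\<beta> / 2) y c n))"
proof -
  obtain A where A: "A > 0" and lower: "\<And>f. f \<in> L2 \<Longrightarrow>
      (\<lambda>i. (cmod (L2_inner f (gabor haar \<alpha> \<beta> i)))\<^sup>2) summable_on UNIV \<and>
      A * (L2_norm f)\<^sup>2 \<le> (\<Sum>\<^sub>\<infinity>i. (cmod (L2_inner f (gabor haar \<alpha> \<beta> i)))\<^sup>2)"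
  proof -
    from frame[unfolded is_frame_def, THEN conjunct2] obtain A B where A0: "A > 0" and AB:
      "\<forall>f\<in>L2. (\<lambda>i. (cmod (L2_inner f (gabor haar \<alpha> \<beta> i)))\<^sup>2) summable_on UNIV \<and>
        A * (L2_norm f)\<^sup>2 \<le> (\<Sum>\<^sub>\<infinity>i. (cmod (L2_inner f (gabor haar \<alpha> \<beta> i)))\<^sup>2) \<and>
        (\<Sum>\<^sub>\<infinity>i. (cmod (L2_inner f (gabor haar \<alpha> \<beta> i)))\<^sup>2) \<le> B * (L2_norm f)\<^sup>2"
      by (elim exE conjE)
    show ?thesis
      by (rule that[OF A0], drule bspec[OF AB], elim conjE, rule conjI)
  qed
  show thesis
  proof (rule that[of "A * \<beta>"])
    show "A * \<beta> > 0" using A \<beta> by simp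
    fix y :: real and c :: "int \<Rightarrow> complex" assume fin: "finite {k. c k \<noteq> 0}"
    define S where "S = {k. c k \<noteq> 0}"
    have S: "finite S" "\<And>k. c k \<noteq> 0 \<Longrightarrow> k \<in> S" using fin by (auto simp: S_def)
    have a: "\<alpha> * \<beta> > 0" using \<alpha> \<beta> by simp
    have "\<exists>\<delta>>0. \<forall>y'. y \<le> y' \<and> y' < y + \<delta> \<longrightarrow>
        haar_row (\<alpha> * \<beta>) (\<beta> / 2) y' c = haar_row (\<alpha> * \<beta>) (\<beta> / 2) y c"
      by (rule haar_row_stable[OF a S(1)]) (rule S(2))
    then obtain \<delta>0 where \<delta>0: "\<delta>0 > 0" and stable: "\<forall>y'. y \<le> y' \<and> y' < y + \<delta>0 \<longrightarrow>
        haar_row (\<alpha> * \<beta>) (\<beta> / 2) y' c = haar_row (\<alpha> * \<beta>) (\<beta> / 2) y c"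
      by (elim exE conjE)
    define \<delta> where "\<delta> = min \<delta>0 1"
    have \<delta>: "0 < \<delta>" "\<delta> \<le> 1" "\<delta> \<le> \<delta>0" using \<delta>0 by (auto simp: \<delta>_def)
    define f where "f x = (\<Sum>k\<in>S. c k * indicator {(y + k) / \<beta>..<(y + k + \<delta>) / \<beta>} x)" for x
    have [measurable]: "f \<in> borel_measurable borel" unfolding f_def[abs_def] by measurable
    define I where "I = {x. frac (\<beta> * x - y) < \<delta>}"
    have f_eq: "f x = (if x \<in> I then c \<lfloor>\<beta> * x - y\<rfloor> else 0)" for x
    proof -
      have ind: "x \<in> {(y + k) / \<beta>..<(y + k + \<delta>) / \<beta>} \<longleftrightarrow> x \<in> I \<and> k = \<lfloor>\<beta> * x - y\<rfloor>" for k :: int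
      proof -
        have "x \<in> {(y + k) / \<beta>..<(y + k + \<delta>) / \<beta>} \<longleftrightarrow> k \<le> \<beta> * x - y \<and> \<beta> * x - y < k + \<delta>"
          using \<beta> by (auto simp: field_simps)
        also have "\<dots> \<longleftrightarrow> x \<in> I \<and> k = \<lfloor>\<beta> * x - y\<rfloor>"
        proof
          assume h: "k \<le> \<beta> * x - y \<and> \<beta> * x - y < k + \<delta>"
          then have "\<lfloor>\<beta> * x - y\<rfloor> = k" using \<delta> by (intro floor_unique) auto
          then show "x \<in> I \<and> k = \<lfloor>\<beta> * x - y\<rfloor>" using h by (simp add: I_def frac_def)
        next
          assume "x \<in> I \<and> k = \<lfloor>\<beta> * x - y\<rfloor>"
          then have "frac (\<beta> * x - y) < \<delta>" "k = \<lfloor>\<beta> * x - y\<rfloor>" by (auto simp: I_def)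
          then show "k \<le> \<beta> * x - y \<and> \<beta> * x - y < k + \<delta>" unfolding frac_def by linarith
        qed
        finally show ?thesis .
      qed
      have "f x = (\<Sum>k\<in>S. if k = \<lfloor>\<beta> * x - y\<rfloor> then (if x \<in> I then c k else 0) else 0)"
        unfolding f_def indicator_def ind by (intro sum.cong) auto
      also have "\<dots> = (if x \<in> I then c \<lfloor>\<beta> * x - y\<rfloor> else 0)"
        using S by (auto simp: sum.delta)
      finally show ?thesis .
    qed
    have fiber: "fiber \<beta> f x k = (if x \<in> I then c (k + \<lfloor>\<beta> * x - y\<rfloor>) else 0)" for x k
    proof -
      have w: "\<beta> * (x + k / \<beta>) - y = (\<beta> * x - y) + k" using \<beta> by (simp add: field_simps)
      have fl: "\<lfloor>(\<beta> * x - y) + real_of_int k\<rfloor> = k + \<lfloor>\<beta> * x - y\<rfloor>" by linarith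
      have "frac ((\<beta> * x - y) + k) = frac (\<beta> * x - y)" unfolding frac_def fl by simp
      then show ?thesis unfolding fiber_def f_eq I_def mem_Collect_eq w fl by simp
    qed
    let ?N = "esum (\<lambda>k. sqn (c k))"
    let ?R = "esum (\<lambda>n. sqn (haar_row (\<alpha> * \<beta>) (\<beta> / 2) y c n))"
    have I_meas[measurable]: "I \<in> sets borel" unfolding I_def frac_def by measurable
    define M where "M = emeasure lborel ({0..<1/\<beta>} \<inter> I)"
    have F: "esum (\<lambda>k::int. sqn (f (x + k / \<beta>))) = indicator I x * ?N" for x
      using fiber[of x] esum_shift[of "\<lambda>k. sqn (c k)" "\<lfloor>\<beta> * x - y\<rfloor>"]
      by (simp add: fiber_def indicator_def)
    have R: "esum (\<lambda>n. sqn (haar_row (\<alpha> * \<beta>) (\<beta> / 2) (\<beta> * x) (fiber \<beta> f x) n)) = indicator I x * ?R" for x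
    proof (cases "x \<in> I")
      case True
      \<comment> \<open>Undoing the translation of the fibre brings the offset into
        \<open>[y, y + \<delta>)\<close>, where the rows are constant.\<close>
      let ?y = "\<beta> * x - of_int \<lfloor>\<beta> * x - y\<rfloor>"
      have "frac (\<beta> * x - y) < \<delta>" using True by (simp add: I_def)
      then have "y \<le> ?y" "?y < y + \<delta>0" using \<delta> frac_ge_0[of "\<beta> * x - y"] unfolding frac_def by linarith+
      then have "haar_row (\<alpha> * \<beta>) (\<beta> / 2) ?y c = haar_row (\<alpha> * \<beta>) (\<beta> / 2) y c"
        using stable by (intro stable[rule_format]) simp
      moreover have "fiber \<beta> f x = (\<lambda>k. c (k + \<lfloor>\<beta> * x - y\<rfloor>))" using fiber[of x] True by auto
      ultimately show ?thesis using True by (simp add: haar_row_translate)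
    next
      case False
      then have "fiber \<beta> f x = (\<lambda>k. 0)" using fiber[of x] by auto
      then show ?thesis using False by (simp add: haar_row_def window_sum_def)
    qed
    have mult_M: "(\<integral>\<^sup>+x. indicator {0..<1/\<beta>} x * (indicator I x * t) \<partial>lborel) = M * t" for t :: ennreal
    proof -
      have "(\<integral>\<^sup>+x. indicator {0..<1/\<beta>} x * (indicator I x * t) \<partial>lborel) = (\<integral>\<^sup>+x. t * indicator ({0..<1/\<beta>} \<inter> I) x \<partial>lborel)"
        by (intro nn_integral_cong) (auto simp: indicator_def)
      also have "\<dots> = M * t" unfolding M_def by (subst nn_integral_cmult_indicator) (auto simp: mult.commute)
      finally show ?thesis .
    qed
    have Nf: "(\<integral>\<^sup>+x. sqn (f x) \<partial>lborel) = M * ?N"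
    proof -
      have "(\<integral>\<^sup>+x. sqn (f x) \<partial>lborel) = (\<integral>\<^sup>+x. esum (\<lambda>k::int. sqn (f (x + k / \<beta>))) \<partial>period_measure \<beta>)"
        by (rule nn_integral_tiles[OF \<beta>]) measurable
      also have "\<dots> = (\<integral>\<^sup>+x. indicator I x * ?N \<partial>period_measure \<beta>)" by (simp only: F)
      also have "\<dots> = (\<integral>\<^sup>+x. indicator {0..<1/\<beta>} x * (indicator I x * ?N) \<partial>lborel)"
        by (rule nn_integral_period) measurable
      finally show ?thesis by (simp only: mult_M)
    qed
    have M: "M < \<infinity>"
    proof -
      have "M \<le> emeasure lborel {0..<1/\<beta>}" unfolding M_def by (rule emeasure_mono) auto
      also have "\<dots> < \<infinity>" using \<beta> by simp
      finally show ?thesis .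
    qed
    have M0: "M > 0"
    proof -
      \<comment> \<open>An interval of scaled length \<open>t\<close> starting at
        \<open>frac y\<close> stays inside one period and one bump.\<close>
      define t where "t = min \<delta> (1 - frac y)"
      have t: "t > 0" using \<delta> frac_lt_1[of y] by (simp add: t_def)
      have "{frac y / \<beta>..<(frac y + t) / \<beta>} \<subseteq> {0..<1/\<beta>} \<inter> I"
      proof
        fix x assume x: "x \<in> {frac y / \<beta>..<(frac y + t) / \<beta>}"
        then have x1: "frac y \<le> \<beta> * x" "\<beta> * x < frac y + t" using \<beta> by (auto simp: field_simps)
        have "\<beta> * x < 1" using x1(2) by (simp add: t_def)
        moreover have "0 \<le> \<beta> * x" using x1(1) frac_ge_0[of y] by linarith
        moreover have "\<lfloor>\<beta> * x - y\<rfloor> = - \<lfloor>y\<rfloor>" using x1 \<delta> unfolding t_def frac_def by linarith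
        then have "x \<in> I" using x1 unfolding I_def t_def frac_def by simp
        ultimately show "x \<in> {0..<1/\<beta>} \<inter> I" using \<beta> by (auto simp: field_simps zero_le_mult_iff)
      qed
      then have "emeasure lborel {frac y / \<beta>..<(frac y + t) / \<beta>} \<le> M" unfolding M_def by (rule emeasure_mono) measurable
      moreover have "emeasure lborel {frac y / \<beta>..<(frac y + t) / \<beta>} = ennreal (t / \<beta>)"
        using \<beta> t by (subst emeasure_lborel_Ico) (auto simp: divide_right_mono diff_divide_distrib[symmetric])
      ultimately have "ennreal (t / \<beta>) \<le> M" by simp
      moreover have "0 < ennreal (t / \<beta>)" using t \<beta> by simp
      ultimately show ?thesis by (rule less_le_trans[rotated])
    qed
    have Nfin: "?N < \<infinity>"
    proof -
      have "?N = (\<Sum>k\<in>S. sqn (c k))" by (rule nn_integral_count_space') (auto simp: S(1), simp add: S_def)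
      then show ?thesis by (simp add: sqn_def)
    qed
    have fin_f: "(\<integral>\<^sup>+x. sqn (f x) \<partial>lborel) < \<infinity>"
      unfolding Nf using M Nfin by (simp add: ennreal_mult_less_top)
    have fL2: "f \<in> L2" by (rule borel_in_L2[OF _ fin_f]) measurable
    have fm: "f \<in> borel_measurable borel" by measurable
    note tr = L2_transfer[OF fL2 fm AE_I2[OF refl]]
    let ?c = "\<lambda>i. (cmod (L2_inner f (gabor haar \<alpha> \<beta> i)))\<^sup>2"
    have E: "esum (\<lambda>i. ennreal (?c i)) = ennreal (infsum ?c UNIV)"
      using lower[OF fL2] by (intro esum_summable) auto
    have "esum (\<lambda>i. ennreal (?c i)) = esum (\<lambda>i. sqn (\<integral>x. f x * cnj (gabor haar \<alpha> \<beta> i x) \<partial>lborel))"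
      using tr(2)[OF gabor_haar_measurable] by (simp add: sqn_def)
    also have "\<dots> = ennreal (1 / \<beta>) * (M * ?R)"
      unfolding gabor_energy_fiber[OF \<alpha> \<beta> fm fin_f] R mult_M ..
    finally have E2: "ennreal (infsum ?c UNIV) = ennreal (1 / \<beta>) * (M * ?R)" unfolding E .
    have "ennreal A * (M * ?N) = ennreal (A * (L2_norm f)\<^sup>2)"
      using A by (simp add: ennreal_mult tr(1) Nf)
    also have "\<dots> \<le> ennreal (infsum ?c UNIV)" using lower[OF fL2] by (intro ennreal_leI) simp
    finally have "ennreal A * (M * ?N) \<le> ennreal (1 / \<beta>) * (M * ?R)" unfolding E2 .
    then have "ennreal \<beta> * (ennreal A * (M * ?N)) \<le> ennreal \<beta> * (ennreal (1 / \<beta>) * (M * ?R))"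
      by (rule mult_left_mono) simp
    also have "\<dots> = M * ?R" using \<beta> by (simp flip: mult.assoc ennreal_mult)
    also have "ennreal \<beta> * (ennreal A * (M * ?N)) = M * (ennreal (A * \<beta>) * ?N)"
      using A \<beta> by (simp add: ennreal_mult mult_ac)
    finally have "M * (ennreal (A * \<beta>) * ?N) \<le> M * ?R" .
    then show "ennreal (A * \<beta>) * ?N \<le> ?R"
      using M M0 by (subst (asm) ennreal_mult_le_mult_iff) auto
  qed
qed

section \<open>Kernels\<close>

lemma not_frame_if_kernel:
  fixes \<alpha> \<beta> y :: real
  assumes \<alpha>: "\<alpha> > 0" and \<beta>: "\<beta> > 0" and fin: "finite {k. c k \<noteq> 0}" and k: "c k \<noteq> 0"
    and zero: "\<And>n. haar_row (\<alpha> * \<beta>) (\<beta> / 2) y c n = 0"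
  shows "\<not> is_frame (gabor haar \<alpha> \<beta>)"
proof
  assume "is_frame (gabor haar \<alpha> \<beta>)"
  from frame_imp_rows_bounded[OF \<alpha> \<beta> this] obtain A where A: "A > 0"
    "ennreal A * esum (\<lambda>k. sqn (c k)) \<le> esum (\<lambda>n. sqn (haar_row (\<alpha> * \<beta>) (\<beta> / 2) y c n))"
    using fin by metis
  then have "esum (\<lambda>k. sqn (c k)) = 0" by (simp add: zero)
  moreover have "sqn (c k) \<le> esum (\<lambda>k. sqn (c k))" by (rule nn_integral_ge_point) simp
  ultimately show False using k by (simp add: sqn_def)
qed

text \<open>Gaussian elimination: a nonzero coefficient in row \<open>r\<close> serves as pivot,
  which removes one equation and one unknown and keeps the excess of unknowns.\<close>

lemma homogeneous_system:
  fixes M :: "'r \<Rightarrow> 'k \<Rightarrow> complex"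
  assumes "finite R" "finite S" "card R < card S"
  shows "\<exists>c. (\<exists>k\<in>S. c k \<noteq> 0) \<and> (\<forall>k. k \<notin> S \<longrightarrow> c k = 0) \<and> (\<forall>r\<in>R. (\<Sum>k\<in>S. M r k * c k) = 0)"
  using assms
proof (induction R arbitrary: S M rule: finite_induct)
  case empty
  then obtain k where "k \<in> S" by fastforce
  then show ?case by (intro exI[of _ "\<lambda>j. if j = k then 1 else 0"]) auto
next
  case (insert r R)
  show ?case
  proof (cases "\<forall>k\<in>S. M r k = 0")
    case True
    have "card R < card S" using insert.prems insert.hyps by simp
    from insert.IH[OF insert.prems(1) this, of M] obtain c where c: "\<exists>k\<in>S. c k \<noteq> 0"
      "\<forall>k. k \<notin> S \<longrightarrow> c k = 0" "\<forall>s\<in>R. (\<Sum>k\<in>S. M s k * c k) = 0" by (elim exE conjE)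
    moreover have "(\<Sum>k\<in>S. M r k * c k) = 0" using True by (intro sum.neutral) simp
    ultimately have "\<forall>s\<in>insert r R. (\<Sum>k\<in>S. M s k * c k) = 0" by simp
    with c(1,2) show ?thesis by (intro exI[of _ c] conjI)
  next
    case False
    then obtain k0 where k0: "k0 \<in> S" "M r k0 \<noteq> 0" by blast
    define S' where "S' = S - {k0}"
    define M' where "M' s k = M s k - M s k0 * M r k / M r k0" for s k
    have S': "finite S'" "card R < card S'" using insert k0 by (auto simp: S'_def)
    obtain c where c: "\<exists>k\<in>S'. c k \<noteq> 0" "\<forall>k. k \<notin> S' \<longrightarrow> c k = 0" "\<forall>s\<in>R. (\<Sum>k\<in>S'. M' s k * c k) = 0"
      using insert.IH[OF S', of M'] by (elim exE conjE)
    define t where "t = - (\<Sum>k\<in>S'. M r k * c k) / M r k0"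
    define d where "d = c(k0 := t)"
    have split: "(\<Sum>k\<in>S. M s k * d k) = M s k0 * t + (\<Sum>k\<in>S'. M s k * c k)" for s
    proof -
      have "(\<Sum>k\<in>S. M s k * d k) = M s k0 * d k0 + (\<Sum>k\<in>S'. M s k * d k)"
        unfolding S'_def using insert.prems(1) k0(1) by (rule sum.remove)
      also have "(\<Sum>k\<in>S'. M s k * d k) = (\<Sum>k\<in>S'. M s k * c k)"
        by (rule sum.cong) (auto simp: d_def S'_def)
      finally show ?thesis by (simp add: d_def)
    qed
    have "(\<Sum>k\<in>S. M s k * d k) = 0" if "s \<in> insert r R" for s
    proof (cases "s = r")
      case True
      then show ?thesis unfolding split using k0(2) by (simp add: t_def)
    next
      case False
      then have "(\<Sum>k\<in>S'. M' s k * c k) = 0" using c(3) that by blast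
      then have "(\<Sum>k\<in>S'. M s k * c k) = M s k0 / M r k0 * (\<Sum>k\<in>S'. M r k * c k)"
        by (simp add: M'_def left_diff_distrib sum_subtractf sum_distrib_left mult.assoc)
      then show ?thesis unfolding split by (simp add: t_def)
    qed
    moreover have "\<exists>k\<in>S. d k \<noteq> 0" using c(1) by (auto simp: d_def S'_def)
    moreover have "\<forall>k. k \<notin> S \<longrightarrow> d k = 0" using c(2) k0(1) by (auto simp: d_def S'_def)
    ultimately show ?thesis by (intro exI[of _ d] conjI ballI)
  qed
qed

text \<open>A sequence on \<open>N\<close> consecutive integers meets about
  \<open>(N + 2 * b) / a\<close> rows. For \<open>a > 1\<close> and large \<open>N\<close> these are
  fewer than \<open>N\<close> equations, so a finitely supported kernel vector exists.\<close>

lemma frame_imp_density: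
  fixes \<alpha> \<beta> :: real
  assumes \<alpha>: "\<alpha> > 0" and \<beta>: "\<beta> > 0" and frame: "is_frame (gabor haar \<alpha> \<beta>)"
  shows "\<alpha> * \<beta> \<le> 1"
proof (rule ccontr)
  assume "\<not> \<alpha> * \<beta> \<le> 1"
  define a where "a = \<alpha> * \<beta>"
  have a: "a > 1" using \<open>\<not> \<alpha> * \<beta> \<le> 1\<close> by (simp add: a_def)
  define b where "b = \<beta> / 2"
  have b: "b > 0" using \<beta> by (simp add: b_def)
  \<comment> \<open>The bound is \<open>(N + 2 * b) / a + 3 < N\<close> solved for \<open>N\<close>;
    the 3 leaves room for rounding.\<close>
  obtain N :: nat where N: "(2 * b / a + 3) / (1 - 1 / a) < N" using reals_Archimedean2 by blast
  define S where "S = {0..<int N}"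
  define R where "R = {n::int. - b / a < n \<and> n \<le> - b / a + (N + 2 * b) / a}"
  have R: "finite R" "card R \<le> nat \<lceil>(N + 2 * b) / a\<rceil> + 1"
    using card_int_interval_le[of "- b / a" "(N + 2 * b) / a"] unfolding R_def by auto
  have "2 * b / a + 3 < N * (1 - 1 / a)" using N a by (simp add: pos_divide_less_eq)
  then have "(N + 2 * b) / a + 3 < N" by (simp add: algebra_simps add_divide_distrib)
  moreover have "real (nat \<lceil>(N + 2 * b) / a\<rceil>) < (N + 2 * b) / a + 1"
  proof -
    have "0 \<le> (N + 2 * b) / a" using a b by simp
    then show ?thesis by linarith
  qed
  ultimately have "nat \<lceil>(N + 2 * b) / a\<rceil> + 1 < N" by linarith
  then have "card R < card S" using R(2) by (simp add: S_def)
  define M :: "int \<Rightarrow> int \<Rightarrow> complex" where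
    "M n k = (if n * a \<le> k \<and> k < n * a + b then 1 else 0) - (if n * a - b \<le> k \<and> k < n * a then 1 else 0)" for n k
  obtain c where c: "\<exists>k\<in>S. c k \<noteq> 0" "\<forall>k. k \<notin> S \<longrightarrow> c k = 0" "\<forall>r\<in>R. (\<Sum>k\<in>S. M r k * c k) = 0"
    using homogeneous_system[OF R(1) _ \<open>card R < card S\<close>, of M] by (auto simp: S_def)
  have ws: "window_sum c p q = (\<Sum>k\<in>S. if p \<le> k \<and> k < q then c k else 0)" for p q :: real
    by (rule window_sum_support) (use c(2) in \<open>auto simp: S_def\<close>)
  have "haar_row a b 0 c n = (\<Sum>k\<in>S. M n k * c k)" for n
    unfolding haar_row_def ws sum_subtractf[symmetric] by (intro sum.cong) (auto simp: M_def)
  moreover have "(\<Sum>k\<in>S. M n k * c k) = 0" if "n \<notin> R" for n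
  proof (rule sum.neutral, rule ballI)
    fix k assume k: "k \<in> S"
    have "n * a \<le> - b \<or> N + b < n * a"
    proof (rule ccontr)
      assume "\<not> ?thesis"
      then have n: "- b < n * a" "n * a \<le> N + b" by auto
      have "0 < a" using a by simp
      then have "- b / a < n" "n \<le> (N + b) / a"
        using n pos_divide_less_eq[of a "- b" "of_int n"] pos_le_divide_eq[of a "of_int n" "N + b"] by blast+
      moreover have "(N + b) / a = - b / a + (N + 2 * b) / a" using a by (simp add: field_simps)
      ultimately show False using that by (simp add: R_def)
    qed
    then show "M n k * c k = 0" using k by (auto simp: M_def S_def)
  qed
  ultimately have zero: "haar_row a b 0 c n = 0" for n using c(3) by metis
  have "finite {k. c k \<noteq> 0}" by (rule finite_subset[of _ S]) (use c(2) in \<open>auto simp: S_def\<close>)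
  moreover obtain k where "c k \<noteq> 0" using c(1) by blast
  ultimately show False
    using not_frame_if_kernel[OF \<alpha> \<beta>, of c k 0] zero frame unfolding a_def b_def by blast
qed

text \<open>For \<open>\<alpha> > 1\<close> the translated supports of length 1 leave gaps. The
  offset \<open>\<beta> / 2\<close> places the integer 0 at the edge of such a gap, outside every
  half-open window, so a unit vector is in the kernel.\<close>

lemma frame_imp_covering:
  fixes \<alpha> \<beta> :: real
  assumes \<alpha>: "\<alpha> > 0" and \<beta>: "\<beta> > 0" and frame: "is_frame (gabor haar \<alpha> \<beta>)"
  shows "\<alpha> \<le> 1"
proof (rule ccontr)
  assume "\<not> \<alpha> \<le> 1"
  then have gap: "\<beta> < \<alpha> * \<beta>" using \<beta> by simp
  define c :: "int \<Rightarrow> complex" where "c k = (if k = 0 then 1 else 0)" for k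
  have ws: "window_sum c p q = (\<Sum>k\<in>{0}. if p \<le> k \<and> k < q then c k else 0)" for p q :: real
    by (rule window_sum_support) (auto simp: c_def split: if_splits)
  have "haar_row (\<alpha> * \<beta>) (\<beta> / 2) (\<beta> / 2) c n = 0" for n
  proof -
    have "\<beta> < n * (\<alpha> * \<beta>) \<or> n * (\<alpha> * \<beta>) \<le> 0"
    proof (cases "n \<ge> 1")
      case True
      then have "1 * (\<alpha> * \<beta>) \<le> n * (\<alpha> * \<beta>)" using \<alpha> \<beta> by (intro mult_right_mono) auto
      then show ?thesis using gap by linarith
    next
      case False
      then show ?thesis using \<alpha> \<beta> by (auto simp: mult_le_0_iff)
    qed
    then obtain t where t: "t = n * (\<alpha> * \<beta>)" "\<beta> < t \<or> t \<le> 0" by blast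
    show ?thesis using \<beta> t(2) unfolding haar_row_def ws t(1)[symmetric] by (auto simp: c_def)
  qed
  moreover have "finite {k. c k \<noteq> 0}" by (rule finite_subset[of _ "{0}"]) (auto simp: c_def split: if_splits)
  moreover have "c 0 \<noteq> 0" by (simp add: c_def)
  ultimately show False using not_frame_if_kernel[OF \<alpha> \<beta>, of c 0] frame by blast
qed

section \<open>Kernel vectors with infinite support\<close>

lemma window_sum_indicator_eq_0:
  fixes p q :: real
  assumes "\<And>j. j \<in> J \<Longrightarrow> p \<le> of_int j \<Longrightarrow> of_int j < q \<Longrightarrow> False"
  shows "window_sum (indicator J) p q = 0"
  unfolding window_sum_def
proof (rule sum.neutral, rule ballI)
  fix j assume "j \<in> {\<lceil>p\<rceil>..<\<lceil>q\<rceil>}"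
  then have "p \<le> of_int j" "of_int j < q" by (auto simp: ceiling_le_iff less_ceiling_iff)
  then have "j \<notin> J" using assms[of j] by blast
  then show "indicator J j = (0 :: complex)" by simp
qed

lemma window_sum_indicator_eq_1:
  fixes p q :: real
  assumes j: "j \<in> J" "p \<le> of_int j" "of_int j < q"
    and unique: "\<And>i. i \<in> J \<Longrightarrow> p \<le> of_int i \<Longrightarrow> of_int i < q \<Longrightarrow> i = j"
  shows "window_sum (indicator J) p q = 1"
proof -
  have "window_sum (indicator J) p q = (\<Sum>i\<in>{\<lceil>p\<rceil>..<\<lceil>q\<rceil>}. if i = j then 1 else 0)"
    unfolding window_sum_def
  proof (rule sum.cong[OF refl])
    fix i assume "i \<in> {\<lceil>p\<rceil>..<\<lceil>q\<rceil>}"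
    then have "p \<le> of_int i" "of_int i < q" by (auto simp: ceiling_le_iff less_ceiling_iff)
    then have "i \<in> J \<longleftrightarrow> i = j" using unique[of i] j(1) by blast
    then show "indicator J i = (if i = j then 1 else (0 :: complex))" by (simp add: indicator_def)
  qed
  also have "\<dots> = 1" using j by (simp add: ceiling_le_iff less_ceiling_iff)
  finally show ?thesis .
qed

text \<open>A bounded kernel vector is enough: truncating it to \<open>[-N, N]\<close> only disturbs the rows
  near the two ends, while its norm grows without bound.\<close>

lemma not_frame_if_bounded_kernel:
  fixes \<alpha> \<beta> y :: real
  assumes \<alpha>: "\<alpha> > 0" and \<beta>: "\<beta> > 0" and J: "infinite J"
    and zero: "\<And>n. haar_row (\<alpha> * \<beta>) (\<beta> / 2) y (indicator J) n = 0"
  shows "\<not> is_frame (gabor haar \<alpha> \<beta>)"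
proof
  assume "is_frame (gabor haar \<alpha> \<beta>)"
  then obtain A where A: "A > 0" "\<And>y c. finite {k. c k \<noteq> 0} \<Longrightarrow>
    ennreal A * esum (\<lambda>k. sqn (c k)) \<le> esum (\<lambda>n. sqn (haar_row (\<alpha> * \<beta>) (\<beta> / 2) y c n))"
    using frame_imp_rows_bounded[OF \<alpha> \<beta>] by metis
  define a b where "a = \<alpha> * \<beta>" and "b = \<beta> / 2"
  have ab: "0 < a" "0 < b" using \<alpha> \<beta> by (auto simp: a_def b_def)
  define C where "C = 4 * ((nat \<lceil>b\<rceil> + 1) * (nat \<lceil>b / a\<rceil> + 1))"
  define M where "M = \<lceil>2 * b\<rceil>"
  have M: "2 * b \<le> M" "0 < M" using ab by (auto simp: M_def)
  define D where "D = C * (2 * (nat M + 1))"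
  have sqn_ind: "esum (\<lambda>k. sqn (indicator B k)) = of_nat (card B)" if "finite B" for B :: "int set"
  proof -
    have "esum (\<lambda>k. sqn (indicator B k)) = (\<Sum>k\<in>B. sqn (indicator B k))"
      by (rule nn_integral_count_space') (use that in auto)
    also have "\<dots> = (\<Sum>k\<in>B. 1)" by (intro sum.cong) (auto simp: sqn_def)
    finally show ?thesis by simp
  qed
  have bound: "ennreal A * of_nat (card (J \<inter> {-N..N})) \<le> of_nat D" for N :: int
  proof -
    define B where "B = J \<inter> {-N..N}"
    \<comment> \<open>A window of length \<open>2 * b \<le> M\<close> that meets both
      \<open>[-N, N]\<close> and its complement sees only the points of \<open>B\<close> within
      \<open>M\<close> of an end. Their number is bounded independently of \<open>N\<close>.\<close>
    define B1 where "B1 = B \<inter> ({-N..M - N} \<union> {N - M..N})"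
    have fin: "finite B" "finite B1" by (auto simp: B_def B1_def)
    have row: "haar_row a b y (indicator B) n = 0 \<or> haar_row a b y (indicator B) n = haar_row a b y (indicator B1) n" for n
    proof -
      define s where "s = n * a - y"
      have cong: "haar_row a b y (indicator X) n = haar_row a b y (indicator Y) n"
        if "\<And>k. s - b \<le> of_int k \<Longrightarrow> of_int k < s + b \<Longrightarrow> k \<in> X \<longleftrightarrow> k \<in> Y" for X Y :: "int set"
      proof -
        have "window_sum (indicator X) p q = (window_sum (indicator Y) p q :: complex)" if "s - b \<le> p" "q \<le> s + b" for p q
          unfolding window_sum_def
        proof (rule sum.cong[OF refl])
          fix k assume "k \<in> {\<lceil>p\<rceil>..<\<lceil>q\<rceil>}"
          then have "p \<le> k" "k < q" by (auto simp: ceiling_le_iff less_ceiling_iff)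
          then have "k \<in> X \<longleftrightarrow> k \<in> Y" using \<open>\<And>k. s - b \<le> of_int k \<Longrightarrow> of_int k < s + b \<Longrightarrow> k \<in> X \<longleftrightarrow> k \<in> Y\<close>[of k] that by linarith
          then show "indicator X k = (indicator Y k :: complex)" by (simp add: indicator_def)
        qed
        then show ?thesis unfolding haar_row_def s_def[symmetric] using ab by simp
      qed
      have empty: "haar_row a b y (indicator {}) n = 0" by (simp add: haar_row_def window_sum_def)
      consider (inside) "\<And>k::int. s - b \<le> k \<Longrightarrow> k < s + b \<Longrightarrow> -N \<le> k \<and> k \<le> N"
        | (outside) "\<And>k::int. s - b \<le> k \<Longrightarrow> k < s + b \<Longrightarrow> \<not> (-N \<le> k \<and> k \<le> N)"
        | (mixed) k k' :: int where "s - b \<le> k" "k < s + b" "-N \<le> k \<and> k \<le> N"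
            "s - b \<le> k'" "k' < s + b" "\<not> (-N \<le> k' \<and> k' \<le> N)"
        by blast
      then show ?thesis
      proof cases
        case inside
        have "haar_row a b y (indicator B) n = haar_row a b y (indicator J) n"
          by (rule cong) (use inside in \<open>auto simp: B_def\<close>)
        then show ?thesis using zero[of n] by (simp add: a_def b_def)
      next
        case outside
        have "haar_row a b y (indicator B) n = haar_row a b y (indicator {}) n"
          by (rule cong) (use outside in \<open>auto simp: B_def\<close>)
        then show ?thesis using empty by simp
      next
        case mixed
        have "haar_row a b y (indicator B) n = haar_row a b y (indicator B1) n"
        proof (rule cong)
          fix j :: int assume j: "s - b \<le> j" "j < s + b"
          have "of_int \<bar>j - k'\<bar> < (of_int M :: real)" using j mixed M(1) by linarith
          then have "\<bar>j - k'\<bar> < M" by linarith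
          then show "j \<in> B \<longleftrightarrow> j \<in> B1" using mixed(6) by (auto simp: B1_def B_def)
        qed
        then show ?thesis by simp
      qed
    qed
    have "ennreal A * of_nat (card B) = ennreal A * esum (\<lambda>k. sqn (indicator B k))"
      by (simp only: sqn_ind[OF fin(1)])
    also have "\<dots> \<le> esum (\<lambda>n. sqn (haar_row a b y (indicator B) n))"
      unfolding a_def b_def by (rule A(2)) (rule finite_subset[OF _ fin(1)], auto simp: indicator_def)
    also have "\<dots> \<le> esum (\<lambda>n. sqn (haar_row a b y (indicator B1) n))"
    proof (rule esum_mono)
      fix n
      show "sqn (haar_row a b y (indicator B) n) \<le> sqn (haar_row a b y (indicator B1) n)"
        using row[of n] by (elim disjE) simp_all
    qed
    also have "\<dots> \<le> of_nat C * esum (\<lambda>k. sqn (indicator B1 k))"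
      unfolding C_def by (rule haar_row_upper_bound[OF ab])
    also have "\<dots> = of_nat (C * card B1)" by (simp add: sqn_ind[OF fin(2)])
    also have "\<dots> \<le> of_nat D"
    proof -
      have "card B1 \<le> card ({-N..M - N} \<union> {N - M..N})" unfolding B1_def by (intro card_mono) auto
      also have "\<dots> \<le> card {-N..M - N} + card {N - M..N}" by (rule card_Un_le)
      also have "\<dots> \<le> 2 * (nat M + 1)" using M(2) by simp
      finally show ?thesis unfolding D_def by (intro of_nat_mono mult_left_mono) auto
    qed
    finally show ?thesis unfolding B_def .
  qed
  \<comment> \<open>The bound does not depend on \<open>N\<close>, but some \<open>[-N, N]\<close>
    contains more than \<open>D / A\<close> points of the infinite set \<open>J\<close>.\<close>
  obtain m :: nat where m: "D / A < m" using reals_Archimedean2 by blast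
  obtain F where F: "finite F" "card F = m" "F \<subseteq> J" using infinite_arbitrarily_large[OF J] by blast
  obtain N :: int where N: "F \<subseteq> {-N..N}"
  proof
    show "F \<subseteq> {- (\<Sum>k\<in>F. \<bar>k\<bar>)..(\<Sum>k\<in>F. \<bar>k\<bar>)}"
    proof
      fix k assume "k \<in> F"
      then have "\<bar>k\<bar> \<le> (\<Sum>k\<in>F. \<bar>k\<bar>)" using F(1) by (intro member_le_sum) auto
      then show "k \<in> {- (\<Sum>k\<in>F. \<bar>k\<bar>)..(\<Sum>k\<in>F. \<bar>k\<bar>)}" by auto
    qed
  qed
  have "m \<le> card (J \<inter> {-N..N})" using F N by (metis card_mono finite_Int finite_atLeastAtMost_int Int_greatest)
  then have "ennreal A * of_nat m \<le> ennreal A * of_nat (card (J \<inter> {-N..N}))"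
    by (intro mult_left_mono of_nat_mono) auto
  also have "\<dots> \<le> of_nat D" by (rule bound)
  finally have "ennreal (A * m) \<le> ennreal D"
    using A(1) by (simp add: ennreal_mult ennreal_of_nat_eq_real_of_nat)
  then have "A * m \<le> D" using A(1) by (subst (asm) ennreal_le_iff) auto
  then show False using m A(1) by (simp add: pos_divide_less_eq mult.commute)
qed

text \<open>Changing the length of a half-window from \<open>\<mu>\<close> to
  \<open>\<beta> / 2\<close> affects only points within \<open>x\<close> of its outer end, where
  \<open>far\<close> leaves no point of \<open>J\<close>. Both halves keep the value 1 and cancel in
  the row.\<close>

lemma not_frame_if_unit_windows:
  fixes \<alpha> \<beta> y \<mu> x :: real
  assumes \<alpha>: "\<alpha> > 0" and \<beta>: "\<beta> > 0" and J: "infinite J" and x: "x = \<bar>\<beta> / 2 - \<mu>\<bar>" and \<mu>: "\<mu> > 0"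
    and one: "\<And>n::int. window_sum (indicator J) (n * (\<alpha> * \<beta>) - y) (n * (\<alpha> * \<beta>) - y + \<mu>) = 1"
      "\<And>n::int. window_sum (indicator J) (n * (\<alpha> * \<beta>) - y - \<mu>) (n * (\<alpha> * \<beta>) - y) = 1"
    and far: "\<And>(j::int) (n::int). j \<in> J \<Longrightarrow> \<not> (- x \<le> j - (n * (\<alpha> * \<beta>) - y + \<mu>) \<and> j - (n * (\<alpha> * \<beta>) - y + \<mu>) < x)"
      "\<And>(j::int) (n::int). j \<in> J \<Longrightarrow> \<not> (- x \<le> j - (n * (\<alpha> * \<beta>) - y - \<mu>) \<and> j - (n * (\<alpha> * \<beta>) - y - \<mu>) < x)"
  shows "\<not> is_frame (gabor haar \<alpha> \<beta>)"
proof (rule not_frame_if_bounded_kernel[OF \<alpha> \<beta> J])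
  fix n :: int
  define s b where "s = n * (\<alpha> * \<beta>) - y" and "b = \<beta> / 2"
  have b: "b > 0" using \<beta> by (simp add: b_def)
  note far' = far[of _ n, folded s_def]
  have "window_sum (indicator J) s (s + b) = (1 :: complex)"
  proof (cases "\<mu> \<le> b")
    case True
    have "window_sum (indicator J) (s + \<mu>) (s + b) = (0 :: complex)"
    proof (rule window_sum_indicator_eq_0)
      fix j assume "j \<in> J" "s + \<mu> \<le> of_int j" "of_int j < s + b"
      then show False using far'(1)[of j] True x unfolding b_def by linarith
    qed
    then show ?thesis using window_sum_split[of s "s + \<mu>" "s + b" "indicator J"] True \<mu> one(1)[of n]
      by (simp add: s_def)
  next
    case False
    have "window_sum (indicator J) (s + b) (s + \<mu>) = (0 :: complex)"
    proof (rule window_sum_indicator_eq_0)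
      fix j assume "j \<in> J" "s + b \<le> of_int j" "of_int j < s + \<mu>"
      then show False using far'(1)[of j] False x unfolding b_def by linarith
    qed
    then show ?thesis using window_sum_split[of s "s + b" "s + \<mu>" "indicator J"] False b one(1)[of n]
      by (simp add: s_def)
  qed
  moreover have "window_sum (indicator J) (s - b) s = (1 :: complex)"
  proof (cases "\<mu> \<le> b")
    case True
    have "window_sum (indicator J) (s - b) (s - \<mu>) = (0 :: complex)"
    proof (rule window_sum_indicator_eq_0)
      fix j assume "j \<in> J" "s - b \<le> of_int j" "of_int j < s - \<mu>"
      then show False using far'(2)[of j] True x unfolding b_def by linarith
    qed
    then show ?thesis using window_sum_split[of "s - b" "s - \<mu>" s "indicator J"] True \<mu> one(2)[of n]
      by (simp add: s_def)
  next
    case False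
    have "window_sum (indicator J) (s - \<mu>) (s - b) = (0 :: complex)"
    proof (rule window_sum_indicator_eq_0)
      fix j assume "j \<in> J" "s - \<mu> \<le> of_int j" "of_int j < s - b"
      then show False using far'(2)[of j] False x unfolding b_def by linarith
    qed
    then show ?thesis using window_sum_split[of "s - \<mu>" "s - b" s "indicator J"] False b one(2)[of n]
      by (simp add: s_def)
  qed
  ultimately show "haar_row (\<alpha> * \<beta>) (\<beta> / 2) y (indicator J) n = 0"
    by (simp add: haar_row_def s_def b_def)
qed

section \<open>Rational parameters\<close>

text \<open>Over a common denominator \<open>D\<close> the greatest common divisor is that of the
  numerators divided by \<open>D\<close>. Bezout's identity shows that every common divisor
  \<open>r\<close> divides it, so \<open>r\<close> is no larger.\<close>

lemma rat_gcd_bezout: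
  fixes x y :: real
  assumes "x \<in> \<rat>" "y \<in> \<rat>" "x > 0" "y > 0"
  obtains i j u v :: int where "rat_gcd x y > 0" "x = rat_gcd x y * i" "y = rat_gcd x y * j"
    "rat_gcd x y = u * x + v * y"
proof -
  obtain a1 b1 :: int where x: "b1 > 0" "x = of_int a1 / of_int b1" using assms(1) by (rule Rats_cases')
  obtain a2 b2 :: int where y: "b2 > 0" "y = of_int a2 / of_int b2" using assms(2) by (rule Rats_cases')
  define X Y D where "X = a1 * b2" and "Y = a2 * b1" and "D = b1 * b2"
  have D: "D > 0" using x y by (simp add: D_def)
  have XY: "x = X / D" "y = Y / D" using x y by (simp_all add: X_def Y_def D_def)
  define d where "d = gcd X Y"
  have "X \<noteq> 0" using XY(1) assms(3) by auto
  then have d: "d > 0" by (simp add: d_def)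
  define g :: real where "g = d / D"
  have g: "g > 0" using d D by (simp add: g_def)
  obtain i j where ij: "X = d * i" "Y = d * j" unfolding d_def by (meson gcd_dvd1 gcd_dvd2 dvdE)
  obtain u v where uv: "u * X + v * Y = d" unfolding d_def using bezout_int by blast
  have xg: "x = g * i" "y = g * j" unfolding XY g_def ij by simp_all
  have guv: "g = u * x + v * y"
  proof -
    have "real_of_int d = u * X + v * Y" using uv by (metis of_int_add of_int_mult)
    then show ?thesis unfolding XY g_def by (simp add: add_divide_distrib)
  qed
  have eq: "rat_gcd x y = g" unfolding rat_gcd_def
  proof (rule Greatest_equality)
    have "g \<in> \<rat>" by (simp add: g_def)
    then show "g \<in> \<rat> \<and> 0 < g \<and> x / g \<in> \<int> \<and> y / g \<in> \<int>" using g xg by simp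
    fix r assume r: "r \<in> \<rat> \<and> 0 < r \<and> x / r \<in> \<int> \<and> y / r \<in> \<int>"
    then obtain i' j' where "x / r = of_int i'" "y / r = of_int j'" by (auto elim!: Ints_cases)
    moreover have "g / r = u * (x / r) + v * (y / r)" unfolding guv by (simp add: add_divide_distrib)
    ultimately have gr: "g / r = of_int (u * i' + v * j')" by simp
    have "g / r > 0" using g r by simp
    then have "0 < u * i' + v * j'" unfolding gr by (rule of_int_0_less_iff[THEN iffD1])
    then have "1 \<le> u * i' + v * j'" by linarith
    then have "1 \<le> g / r" unfolding gr by (metis of_int_1 of_int_le_iff)
    then show "r \<le> g" using r by (simp add: le_divide_eq)
  qed
  show thesis
  proof (rule that[of i j u v], unfold eq)
    show "0 < g" by (rule g)
    show "x = g * i" "y = g * j" by (rule xg)+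
    show "g = u * x + v * y" by (rule guv)
  qed
qed

lemma unit_window_multiples:
  fixes p :: real and n :: int
  assumes n: "n \<ge> 1"
  shows "window_sum (indicator {j. n dvd j}) p (p + n) = 1"
proof -
  define z where "z = \<lceil>p / n\<rceil>"
  have n0: "(0::real) < n" using n by simp
  have "p / n \<le> z" "z < p / n + 1" unfolding z_def by linarith+
  then have "p \<le> of_int (n * z)" "of_int (n * z) < p + n"
    using n0 by (simp_all add: field_simps)
  then show ?thesis
  proof (rule window_sum_indicator_eq_1[rotated])
    fix i assume i: "i \<in> {j. n dvd j}" "p \<le> of_int i" "of_int i < p + of_int n"
    have "of_int \<bar>i - n * z\<bar> < (of_int n :: real)"
      using i(2,3) \<open>p \<le> of_int (n * z)\<close> \<open>of_int (n * z) < p + n\<close> by linarith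
    then have "\<bar>i - n * z\<bar> < n" by linarith
    moreover have "n dvd i - n * z" using i(1) by simp
    ultimately show "i = n * z" using zdvd_not_zless[of "\<bar>i - n * z\<bar>" n] by fastforce
  qed simp
qed

lemma not_frame_multiples:
  fixes \<alpha> \<beta> y :: real and n :: int
  assumes \<alpha>: "\<alpha> > 0" and \<beta>: "\<beta> > 0" and n: "n \<ge> 1"
    and far: "\<And>(z::int) (m::int). \<not> (- \<bar>\<beta> / 2 - n\<bar> \<le> z * n - (m * (\<alpha> * \<beta>) - y) \<and> z * n - (m * (\<alpha> * \<beta>) - y) < \<bar>\<beta> / 2 - n\<bar>)"
  shows "\<not> is_frame (gabor haar \<alpha> \<beta>)"
proof (rule not_frame_if_unit_windows[OF \<alpha> \<beta> _ refl, where \<mu>="of_int n" and J="{j. n dvd j}" and y=y])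
  have "range (\<lambda>z::int. n * z) \<subseteq> {j. n dvd j}" by auto
  moreover have "infinite (range (\<lambda>z::int. n * z))"
  proof -
    have "inj (\<lambda>z::int. n * z)" using n by (intro injI) simp
    then have "infinite ((\<lambda>z::int. n * z) ` UNIV)" by (simp add: finite_image_iff infinite_UNIV_int)
    then show ?thesis .
  qed
  ultimately show "infinite {j. n dvd j}" by (rule infinite_super)
  show "0 < real_of_int n" using n by simp
  fix m :: int
  show "window_sum (indicator {j. n dvd j}) (m * (\<alpha> * \<beta>) - y) (m * (\<alpha> * \<beta>) - y + n) = 1"
    by (rule unit_window_multiples[OF n])
  show "window_sum (indicator {j. n dvd j}) (m * (\<alpha> * \<beta>) - y - n) (m * (\<alpha> * \<beta>) - y) = 1"
    using unit_window_multiples[OF n, of "m * (\<alpha> * \<beta>) - y - n"] by simp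
next
  fix j m :: int assume "j \<in> {j. n dvd j}"
  then obtain z where z: "j = n * z" by auto
  have "of_int j - (m * (\<alpha> * \<beta>) - y + n) = of_int (z - 1) * n - (m * (\<alpha> * \<beta>) - y)"
    "of_int j - (m * (\<alpha> * \<beta>) - y - n) = of_int (z + 1) * n - (m * (\<alpha> * \<beta>) - y)"
    unfolding z by (simp_all add: algebra_simps)
  then show "\<not> (- \<bar>\<beta> / 2 - n\<bar> \<le> j - (m * (\<alpha> * \<beta>) - y + n) \<and> j - (m * (\<alpha> * \<beta>) - y + n) < \<bar>\<beta> / 2 - n\<bar>)"
    "\<not> (- \<bar>\<beta> / 2 - n\<bar> \<le> j - (m * (\<alpha> * \<beta>) - y - n) \<and> j - (m * (\<alpha> * \<beta>) - y - n) < \<bar>\<beta> / 2 - n\<bar>)"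
    using far[of "z - 1" m] far[of "z + 1" m] by (simp_all only:) auto
qed

text \<open>All differences between multiples of \<open>n\<close> and of
  \<open>\<alpha> * \<beta>\<close> are multiples of \<open>g\<close>. The offset
  \<open>g / 2\<close> turns them into odd multiples of \<open>g / 2\<close>, which stay out of
  reach of |\<beta> / 2 - n| < g / 2.\<close>

lemma not_frame_near_even:
  fixes \<alpha> \<beta> g :: real and n i j :: int
  assumes \<alpha>: "\<alpha> > 0" and \<beta>: "\<beta> > 0" and n: "n \<ge> 1"
    and g: "g > 0" "n = g * i" "\<alpha> * \<beta> = g * j" and close: "\<bar>\<beta> - 2 * of_int n\<bar> < g"
  shows "\<not> is_frame (gabor haar \<alpha> \<beta>)"
proof (rule not_frame_multiples[OF \<alpha> \<beta> n, where y="g / 2"])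
  fix z m :: int
  have x: "\<bar>\<beta> / 2 - n\<bar> < g / 2" using close by linarith
  define t where "t = z * i - m * j"
  have eq: "z * n - (m * (\<alpha> * \<beta>) - g / 2) = t * g + g / 2"
    unfolding t_def of_int_mult of_int_diff g(2,3) by (simp add: algebra_simps)
  have "t \<ge> 0 \<or> t \<le> -1" by linarith
  then have "t * g \<ge> 0 \<or> t * g \<le> - g"
    using g(1) mult_right_mono[of "of_int t" "-1" g] by auto
  then show "\<not> (- \<bar>\<beta> / 2 - n\<bar> \<le> z * n - (m * (\<alpha> * \<beta>) - g / 2) \<and> z * n - (m * (\<alpha> * \<beta>) - g / 2) < \<bar>\<beta> / 2 - n\<bar>)"
    unfolding eq using x by linarith
qed

text \<open>The kernel is carried by the integers in every \<open>n\<close>-th cell; with the offset \<open>1 + x\<close> each of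
  these cells contains an integer at distance at least \<open>x\<close> from both ends.\<close>

lemma not_frame_near_multiple_of_density:
  fixes \<alpha> \<beta> g :: real and n i j :: int
  assumes \<alpha>: "\<alpha> > 0" and \<beta>: "\<beta> > 0" and a1: "\<alpha> * \<beta> \<le> 1" and n: "n \<ge> 1"
    and g: "g > 0" "n * (\<alpha> * \<beta>) = g * i" "1 = g * j"
    and close: "\<bar>\<beta> - 2 * (n * (\<alpha> * \<beta>))\<bar> + 1 - \<alpha> * \<beta> < g"
  shows "\<not> is_frame (gabor haar \<alpha> \<beta>)"
proof -
  define a where "a = \<alpha> * \<beta>"
  have a: "0 < a" "a \<le> 1" using \<alpha> \<beta> a1 by (auto simp: a_def)
  define x where "x = \<bar>\<beta> / 2 - n * a\<bar>"
  have "\<bar>\<beta> - 2 * (n * a)\<bar> + 1 - a < g" using close by (simp only: a_def)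
  moreover have "\<bar>\<beta> - 2 * (n * a)\<bar> = 2 * x" unfolding x_def by (simp add: abs_if)
  ultimately have x: "0 \<le> x" "2 * x + 1 - a < g" by (simp_all add: x_def)
  \<comment> \<open>With this offset \<open>s m + x = m * a - 1\<close>, so the least integer from
    there on lies in \<open>[m * a - 1, m * a)\<close>.\<close>
  define y where "y = 1 + x"
  define s where "s m = m * a - y" for m :: int
  define J where "J = {k::int. \<exists>m. n dvd m \<and> s m \<le> k \<and> k < s m + a}"
  have cell: "\<exists>k::int. s m + x \<le> k \<and> k < s m + a - x" if dvd: "n dvd m" for m
  proof -
    obtain m' where m: "m = n * m'" using dvd by blast
    define k where "k = \<lceil>s m + x\<rceil>"
    have k: "s m + x \<le> k" "k < s m + x + 1" unfolding k_def by linarith+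
    define t where "t = k * j - m' * i"
    have "k * (g * j) = k" using g(3) by (metis mult.right_neutral)
    moreover have "of_int m * a = m' * (n * a)" unfolding m by simp
    then have "of_int m * a = m' * (g * i)" using g(2) by (simp add: a_def)
    ultimately have tg: "t * g = k - m * a" unfolding t_def by (simp add: algebra_simps)
    \<comment> \<open>As \<open>n\<close> divides \<open>m\<close>, the difference
      \<open>k - m * a\<close> is a multiple of \<open>g\<close>. If the bound failed, it would lie
      strictly between \<open>- g\<close> and 0 because \<open>2 * x + 1 - a < g\<close>.\<close>
    have "k < s m + a - x"
    proof (rule ccontr)
      assume "\<not> k < s m + a - x"
      then have "- g < t * g" "t * g < 0" using k x(2) unfolding tg s_def y_def by linarith+
      then have "of_int (- 1) < (of_int t :: real)" "of_int t < (0 :: real)"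
        using g(1) mult_less_cancel_right_pos[OF g(1), of "-1" "of_int t"] by (auto simp: mult_less_0_iff)
      then have "- 1 < t" "t < 0" unfolding of_int_less_iff of_int_less_0_iff by blast+
      then show False by linarith
    qed
    then show ?thesis using k by blast
  qed
  have unique: "k = k'" if "s m \<le> k" "k < s m + a" "s m \<le> k'" "k' < s m + a" for k k' m :: int
    using that a by linarith
  have J_pos: "s m + x \<le> k \<and> k < s m + a - x" if "n dvd m" "s m \<le> k" "k < s m + a" for k m :: int
  proof -
    obtain k' :: int where k': "s m + x \<le> k'" "k' < s m + a - x" using cell[OF \<open>n dvd m\<close>] by blast
    have "k = k'" by (rule unique[of m]) (use that k' x(1) in auto)
    then show ?thesis using k' by simp
  qed
  have s_mono: "s m + a \<le> s m'" if "m < m'" for m m' :: int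
  proof -
    have "of_int (m + 1) * a \<le> m' * a" using that a by (intro mult_right_mono) linarith+
    then show ?thesis by (simp add: s_def algebra_simps)
  qed
  have J_far: "\<not> (- x \<le> k - s m \<and> k - s m < x)" if "k \<in> J" for k m :: int
  proof -
    obtain m' where m': "n dvd m'" "s m' \<le> k" "k < s m' + a" using \<open>k \<in> J\<close> by (auto simp: J_def)
    note J_pos[OF this]
    then show ?thesis using s_mono[of m m'] s_mono[of m' m] a
      by (cases m m' rule: linorder_cases) auto
  qed
  have window: "window_sum (indicator J) (s m) (s (m + n)) = 1" for m :: int
  proof -
    \<comment> \<open>The first multiple of \<open>n\<close> from \<open>m\<close> on; among the
      \<open>n\<close> cells covered by the window it is the only index of a selected cell.\<close>
    define m0 where "m0 = n * \<lceil>m / n\<rceil>"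
    have m0: "m \<le> m0" "m0 < m + n"
    proof -
      have n0: "(0::real) < n" using n by simp
      have "real_of_int m \<le> of_int (n * \<lceil>m / n\<rceil>)" "of_int (n * \<lceil>m / n\<rceil>) < (of_int (m + n) :: real)"
        using ceiling_divide_upper[OF n0, of "of_int m"] ceiling_divide_lower[OF n0, of "of_int m"]
        by (simp_all add: algebra_simps)
      then show "m \<le> m0" "m0 < m + n" unfolding m0_def by linarith+
    qed
    have dvd: "n dvd m0" by (simp add: m0_def)
    have s0: "s m \<le> s m0" "s m0 + a \<le> s (m + n)"
      using s_mono[of m m0] s_mono[of m0 "m + n"] m0 a by (cases "m = m0"; simp)+
    obtain k :: int where k: "s m0 + x \<le> k" "k < s m0 + a - x" using cell[OF dvd] by blast
    show ?thesis
    proof (rule window_sum_indicator_eq_1)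
      show "k \<in> J" using dvd k x(1) unfolding J_def by (intro CollectI exI[of _ m0]) auto
      show "s m \<le> k" "k < s (m + n)" using s0 k x(1) by linarith+
      fix k' assume k': "k' \<in> J" "s m \<le> of_int k'" "of_int k' < s (m + n)"
      then obtain m' where m': "n dvd m'" "s m' \<le> k'" "k' < s m' + a" by (auto simp: J_def)
      have "m \<le> m'" using s_mono[of m' m] m'(3) k'(2) by (cases "m' < m") auto
      moreover have "m' < m + n" using s_mono[of "m + n" m'] m'(2) k'(3) a by (cases "m' = m + n"; cases "m + n < m'") auto
      ultimately have "\<bar>m' - m0\<bar> < n" using m0 by linarith
      moreover have "n dvd m' - m0" using m'(1) dvd by simp
      ultimately have "m' = m0" using zdvd_not_zless[of "\<bar>m' - m0\<bar>" n] by fastforce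
      then show "k' = k" using unique[of m0 k' k] m' k x(1) by simp
    qed
  qed
  have infJ: "infinite J"
  proof -
    obtain f :: "int \<Rightarrow> int" where f: "\<And>z. s (n * z) + x \<le> f z \<and> f z < s (n * z) + a - x"
      using cell[of "n * z" for z] by (metis dvd_triv_left)
    have "inj f"
    proof (rule injI)
      fix z z' assume eq: "f z = f z'"
      show "z = z'"
      proof (rule ccontr)
        assume "z \<noteq> z'"
        then consider "n * z < n * z'" | "n * z' < n * z" using n by (cases z z' rule: linorder_cases) auto
        then show False using s_mono[of "n * z" "n * z'"] s_mono[of "n * z'" "n * z"] f[of z] f[of z'] eq x(1)
          by cases auto
      qed
    qed
    moreover have "range f \<subseteq> J"
    proof
      fix k assume "k \<in> range f"
      then obtain z where "k = f z" by blast
      then show "k \<in> J" using f[of z] x(1) unfolding J_def by (intro CollectI exI[of _ "n * z"]) auto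
    qed
    moreover have "infinite (range f)"
      using \<open>inj f\<close> by (simp add: finite_image_iff infinite_UNIV_int)
    ultimately show ?thesis using infinite_super by blast
  qed
  have shift: "s m + n * a = s (m + n)" "s m - n * a = s (m - n)" for m
    by (simp_all add: s_def algebra_simps)
  show ?thesis
  proof (rule not_frame_if_unit_windows[OF \<alpha> \<beta> infJ, folded a_def, where \<mu>="n * a" and y=y and x=x, folded s_def])
    show "x = \<bar>\<beta> / 2 - n * a\<bar>" by (simp add: x_def)
    show "0 < n * a" using n a by simp
    fix m :: int
    show "window_sum (indicator J) (s m) (s m + n * a) = 1" unfolding shift by (rule window)
    show "window_sum (indicator J) (s m - n * a) (s m) = 1" unfolding shift using window[of "m - n"] by simp
  next
    fix k m :: int assume "k \<in> J"
    then show "\<not> (- x \<le> k - (s m + n * a) \<and> k - (s m + n * a) < x)"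
      "\<not> (- x \<le> k - (s m - n * a) \<and> k - (s m - n * a) < x)"
      unfolding shift by (rule J_far)+
  qed
qed

section \<open>The frame set\<close>

text \<open>If survivors existed at every depth, compactness would give a permanent one, and the
  permanent survivors form an invariant set. So a single depth \<open>L\<close> works for all
  positions, and with it a single frame constant for all fibres.\<close>

lemma frame_if_no_invariant_set:
  fixes \<alpha> \<beta> :: real
  assumes \<alpha>: "\<alpha> > 0" and \<beta>: "\<beta> > 0" and a1: "\<alpha> * \<beta> \<le> 1"
    and none: "\<And>S u. invariant_set (\<alpha> * \<beta>) (\<beta> / 2) S \<Longrightarrow> u \<in> S \<Longrightarrow> False"
  shows "is_frame (gabor haar \<alpha> \<beta>)"
proof -
  define a b where "a = \<alpha> * \<beta>" and "b = \<beta> / 2"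
  have ab: "0 < a" "a \<le> 1" "0 < b" using \<alpha> \<beta> a1 by (auto simp: a_def b_def)
  have "\<exists>L. \<forall>u. \<not> survives a b L u"
  proof (rule ccontr)
    assume "\<not> ?thesis"
    then have "\<And>L. \<exists>u. survives a b L u" by blast
    from survives_all_obtain[OF ab(2) this] obtain u where "\<forall>L. survives a b L u" by blast
    then have "u \<in> {u. \<forall>L. survives a b L u}" by blast
    then show False using none invariant_set_survivors[OF ab(2), of b] unfolding a_def b_def by blast
  qed
  then obtain L where L: "\<And>u. \<not> survives a b L u" by blast
  define C where "C = real (4 * ((nat \<lceil>b\<rceil> + 1) * (nat \<lceil>b / a\<rceil> + 1)))"
  show ?thesis
  proof (rule frame_if_rows_bounded[OF \<alpha> \<beta>, of "16 * (death_const L)\<^sup>2" C, folded a_def b_def])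
    show "0 < 16 * (death_const L)\<^sup>2" using death_const_pos[of L] by simp
    show "0 < C" unfolding C_def of_nat_0_less_iff by simp
    fix y c
    interpret cells a b y using ab by unfold_locales
    show "esum (\<lambda>n. sqn (haar_row a b y c n)) \<le> ennreal C * esum (\<lambda>k. sqn (c k))"
      using haar_row_upper_bound[OF ab(1,3), of y c] unfolding C_def ennreal_of_nat_eq_real_of_nat .
    assume "esum (\<lambda>k. sqn (c k)) < \<infinity>"
    then show "esum (\<lambda>k. sqn (c k)) \<le> ennreal (16 * (death_const L)\<^sup>2) * esum (\<lambda>n. sqn (haar_row a b y c n))"
      by (rule lower_bound_no_survivors[OF L])
  qed
qed

lemma frame_critical_odd:
  fixes \<alpha> \<beta> :: real and m :: nat
  assumes \<alpha>: "\<alpha> > 0" and \<beta>: "\<beta> = 2 * real m + 1" and a1: "\<alpha> * \<beta> = 1"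
  shows "is_frame (gabor haar \<alpha> \<beta>)"
proof -
  define b where "b = \<beta> / 2"
  have b: "b = m + 1/2" "0 < b" using \<beta> by (auto simp: b_def)
  define K where "K = real (8 * (2 * m + 1) * (2 * m + 1) * 4 ^ (m + 1))"
  define C where "C = real (4 * ((nat \<lceil>b\<rceil> + 1) * (nat \<lceil>b / 1\<rceil> + 1)))"
  have \<beta>0: "\<beta> > 0" using \<beta> by simp
  show ?thesis
  proof (rule frame_if_rows_bounded[OF \<alpha> \<beta>0, of "4 + 16 * K\<^sup>2" C, folded b_def, unfolded a1])
    show "0 < 4 + 16 * K\<^sup>2" by (intro add_pos_nonneg) auto
    show "0 < C" unfolding C_def of_nat_0_less_iff by simp
    fix y c
    show "esum (\<lambda>n. sqn (haar_row 1 b y c n)) \<le> ennreal C * esum (\<lambda>k. sqn (c k))"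
      using haar_row_upper_bound[of 1 b y c] b(2) unfolding C_def ennreal_of_nat_eq_real_of_nat by simp
    assume "esum (\<lambda>k. sqn (c k)) < \<infinity>"
    then show "esum (\<lambda>k. sqn (c k)) \<le> ennreal (4 + 16 * K\<^sup>2) * esum (\<lambda>n. sqn (haar_row 1 b y c n))"
      unfolding K_def by (rule critical_lower_bound[OF b(1)])
  qed
qed

text \<open>Dirichlet approximation bounds the absolute value, irrationality excludes 0, and the
  freedom of sign makes the value positive.\<close>

lemma irrational_small_combination:
  fixes \<theta> e :: real
  assumes "\<theta> \<notin> \<rat>" "e > 0"
  obtains p q :: int where "0 < p * \<theta> + q" "p * \<theta> + q < e"
proof -
  obtain N :: nat where N: "1 / e < N" using reals_Archimedean2 by blast
  have "0 < 1 / e" using assms(2) by simp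
  then have N0: "N > 0" using N by (intro gr0I) simp
  obtain h k :: int where hk: "0 < k" "\<bar>of_int k * \<theta> - of_int h\<bar> < 1 / N"
    using Dirichlet_approx[OF N0, of \<theta>] by metis
  have "1 / N < e" using N N0 assms(2) by (simp add: field_simps)
  then have small: "\<bar>of_int k * \<theta> - of_int h\<bar> < e" using hk(2) by linarith
  have "of_int k * \<theta> - of_int h \<noteq> 0"
  proof
    assume "of_int k * \<theta> - of_int h = 0"
    then have "\<theta> = of_int h / of_int k" using hk(1) by (simp add: field_simps)
    then show False using assms(1) by simp
  qed
  then consider "0 < k * \<theta> + of_int (- h)" | "0 < of_int (- k) * \<theta> + h" by fastforce
  then show thesis using that[of k "- h"] that[of "- k" h] small by cases auto
qed

lemma rat_mult_cancel:
  fixes x y :: real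
  assumes "x * y \<in> \<rat>" "x \<in> \<rat>" "x \<noteq> 0"
  shows "y \<in> \<rat>"
proof -
  have "x * y / x \<in> \<rat>" using assms(1,2) by (rule Rats_divide)
  then show ?thesis using assms(3) by simp
qed

theorem theorem1p1:
  fixes \<alpha> \<beta> :: real
  assumes "\<alpha> > 0" and "\<beta> > 0"
  shows "(is_frame (gabor haar \<alpha> \<beta>) \<longrightarrow> \<alpha> * \<beta> \<le> 1 \<and> \<alpha> \<le> 1) \<and>
    (\<alpha> * \<beta> \<le> 1 \<and> \<alpha> \<le> 1 \<and> \<alpha> * \<beta> \<notin> \<rat> \<longrightarrow>
      (is_frame (gabor haar \<alpha> \<beta>) \<longleftrightarrow> \<beta> \<notin> {2 * real n |n. n \<ge> 1})) \<and>
    (\<alpha> * \<beta> \<le> 1 \<and> \<alpha> \<le> 1 \<and> \<alpha> * \<beta> \<in> \<rat> \<longrightarrow>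
      (is_frame (gabor haar \<alpha> \<beta>) \<longleftrightarrow>
        (\<forall>n::nat. n \<ge> 1 \<longrightarrow>
          \<bar>\<beta> - 2 * real n\<bar> \<ge> rat_gcd (real n) (\<alpha> * \<beta>) \<and>
          \<bar>1 / \<alpha> - 2 * real n\<bar> \<ge> rat_gcd (real n) (1 / (\<alpha> * \<beta>)) - (1 / (\<alpha> * \<beta>) - 1))))"
proof (intro conjI impI)
  define a where "a = \<alpha> * \<beta>"
  note \<alpha> = assms(1) and \<beta> = assms(2)
  have a0: "a > 0" using \<alpha> \<beta> by (simp add: a_def)
  \<comment> \<open>As \<open>a / \<alpha> = \<beta>\<close>, multiplication by \<open>a\<close>
    turns the second condition into a comparison of the arc |\<beta> - 2na| + 1 - a with the
    rotation gap a gcd(n, 1/a).\<close>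
  have scale: "a * \<bar>1 / \<alpha> - 2 * t\<bar> = \<bar>\<beta> - 2 * (t * a)\<bar>" for t
  proof -
    have "a * \<bar>1 / \<alpha> - 2 * t\<bar> = \<bar>a * (1 / \<alpha> - 2 * t)\<bar>" using a0 by (simp add: abs_mult)
    also have "a * (1 / \<alpha> - 2 * t) = \<beta> - 2 * (t * a)" using \<alpha> by (simp add: a_def algebra_simps)
    finally show ?thesis .
  qed
  {
    assume "is_frame (gabor haar \<alpha> \<beta>)"
    then show "\<alpha> * \<beta> \<le> 1" "\<alpha> \<le> 1"
      using frame_imp_density[OF \<alpha> \<beta>] frame_imp_covering[OF \<alpha> \<beta>] by auto
  next
    assume h: "\<alpha> * \<beta> \<le> 1 \<and> \<alpha> \<le> 1 \<and> \<alpha> * \<beta> \<notin> \<rat>"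
    then have irr: "a \<notin> \<rat>" and a1: "a \<le> 1" and ab: "a \<le> 2 * (\<beta> / 2)"
      using \<beta> mult_right_mono[of \<alpha> 1 \<beta>] by (auto simp: a_def)
    then have a1': "a < 1" by (metis Rats_1 less_eq_real_def)
    show "is_frame (gabor haar \<alpha> \<beta>) \<longleftrightarrow> \<beta> \<notin> {2 * real n |n. n \<ge> 1}"
    proof
      assume frame: "is_frame (gabor haar \<alpha> \<beta>)"
      show "\<beta> \<notin> {2 * real n |n. n \<ge> 1}"
      proof
        assume "\<beta> \<in> {2 * real n |n. n \<ge> 1}"
        then obtain n where n: "\<beta> = 2 * real n" "n \<ge> 1" by blast
        \<comment> \<open>For \<open>\<beta> / 2 = n\<close> the interval to be avoided is empty, so
          the multiples of \<open>n\<close> form a kernel for any offset.\<close>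
        have "\<not> is_frame (gabor haar \<alpha> \<beta>)"
          by (rule not_frame_multiples[OF \<alpha> \<beta>, of "int n" 0]) (use n in auto)
        then show False using frame by simp
      qed
    next
      assume not_even: "\<beta> \<notin> {2 * real n |n. n \<ge> 1}"
      show "is_frame (gabor haar \<alpha> \<beta>)"
      proof (rule frame_if_no_invariant_set[OF \<alpha> \<beta>])
        show "\<alpha> * \<beta> \<le> 1" using a1 by (simp add: a_def)
        fix S u assume S: "invariant_set (\<alpha> * \<beta>) (\<beta> / 2) S" "u \<in> S"
        show False
        proof (rule invariant_set_cases[OF a1' ab S(1)[folded a_def] S(2)])
          fix n :: nat assume n: "n \<ge> 1"
            and small: "\<And>(p::int) (q::int). p * real n + q * a > 0 \<Longrightarrow> 2 * \<bar>\<beta> / 2 - n\<bar> < p * real n + q * a"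
          define d where "d = \<bar>\<beta> - 2 * real n\<bar>"
          have "\<beta> \<noteq> 2 * real n" using not_even n by blast
          then have "d > 0" by (simp add: d_def)
          then have "d / n > 0" using n by simp
          moreover have "a / n \<notin> \<rat>"
          proof
            assume "a / n \<in> \<rat>"
            then have "a / n * real n \<in> \<rat>" by (intro Rats_mult) auto
            then show False using n irr by simp
          qed
          \<comment> \<open>Multiplied by \<open>n\<close>, this is a positive combination of
            \<open>n\<close> and \<open>a\<close> below \<open>d\<close>, whereas
            \<open>small\<close> makes all of them exceed \<open>d\<close>.\<close>
          ultimately obtain p q :: int where pq: "0 < p * (a / n) + q" "p * (a / n) + q < d / n"
            using irrational_small_combination by metis
          have eq: "q * real n + p * a = real n * (p * (a / n) + q)" using n by (simp add: field_simps)
          have "0 < q * real n + p * a" unfolding eq using pq(1) n by simp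
          then have "2 * \<bar>\<beta> / 2 - n\<bar> < real n * (p * (a / n) + q)" using small[of q p] unfolding eq by simp
          also have "\<dots> < real n * (d / n)" using pq(2) n by (intro mult_strict_left_mono) auto
          also have "\<dots> = d" using n by simp
          finally show False by (simp add: d_def abs_if split: if_splits)
        next
          fix n :: nat assume n: "n \<ge> 1"
            and small: "\<And>(p::int) (q::int). p * (n * a) + q > 0 \<Longrightarrow> 2 * \<bar>\<beta> / 2 - n * a\<bar> + 1 - a < p * (n * a) + q"
          \<comment> \<open>This alternative is impossible: the avoided arc has length at least
            \<open>1 - a > 0\<close>, and an irrational rotation has arbitrarily small gaps.\<close>
          have "n * a \<notin> \<rat>"
            using irr rat_mult_cancel[of "real n" a] n by auto
          then obtain p q :: int where pq: "0 < p * (n * a) + q" "p * (n * a) + q < 1 - a"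
            using irrational_small_combination[of "n * a" "1 - a"] a1' by auto
          have "2 * \<bar>\<beta> / 2 - n * a\<bar> + (1 - a) < 1 - a"
            using less_trans[OF small[OF pq(1)] pq(2)] by (simp only: add_diff_eq)
          then have "2 * \<bar>\<beta> / 2 - n * a\<bar> < 0" by (simp only: add_less_same_cancel2)
          then show False by simp
        qed
      qed
    qed
  next
    assume h: "\<alpha> * \<beta> \<le> 1 \<and> \<alpha> \<le> 1 \<and> \<alpha> * \<beta> \<in> \<rat>"
    then have rat: "a \<in> \<rat>" and a1: "a \<le> 1" and ab: "a \<le> 2 * (\<beta> / 2)"
      using \<beta> mult_right_mono[of \<alpha> 1 \<beta>] by (auto simp: a_def)
    show "is_frame (gabor haar \<alpha> \<beta>) \<longleftrightarrow> (\<forall>n::nat. n \<ge> 1 \<longrightarrow>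
          \<bar>\<beta> - 2 * real n\<bar> \<ge> rat_gcd (real n) (\<alpha> * \<beta>) \<and>
          \<bar>1 / \<alpha> - 2 * real n\<bar> \<ge> rat_gcd (real n) (1 / (\<alpha> * \<beta>)) - (1 / (\<alpha> * \<beta>) - 1))"
      unfolding a_def[symmetric]
    proof
      assume frame: "is_frame (gabor haar \<alpha> \<beta>)"
      show "\<forall>n::nat. n \<ge> 1 \<longrightarrow> \<bar>\<beta> - 2 * real n\<bar> \<ge> rat_gcd (real n) a \<and>
          \<bar>1 / \<alpha> - 2 * real n\<bar> \<ge> rat_gcd (real n) (1 / a) - (1 / a - 1)"
      proof (intro allI impI conjI)
        fix n :: nat assume n: "n \<ge> 1"
        show "\<bar>\<beta> - 2 * real n\<bar> \<ge> rat_gcd (real n) a"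
        proof (rule ccontr)
          assume "\<not> ?thesis"
          then have close: "\<bar>\<beta> - 2 * of_int (int n)\<bar> < rat_gcd (real n) a" by simp
          have "real n \<in> \<rat>" "a \<in> \<rat>" "real n > 0" "a > 0" using n rat a0 by auto
          then obtain i j u v :: int where g: "rat_gcd (real n) a > 0" "real n = rat_gcd (real n) a * i"
            "a = rat_gcd (real n) a * j" "rat_gcd (real n) a = u * real n + v * a"
            by (rule rat_gcd_bezout)
          have "\<not> is_frame (gabor haar \<alpha> \<beta>)"
          proof (rule not_frame_near_even[OF \<alpha> \<beta> _ g(1) _ _ close])
            show "1 \<le> int n" using n by simp
            show "of_int (int n) = rat_gcd (real n) a * i" using g(2) by simp
            show "\<alpha> * \<beta> = rat_gcd (real n) a * j" using g(3) by (simp only: a_def)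
          qed
          then show False using frame by simp
        qed
        show "\<bar>1 / \<alpha> - 2 * real n\<bar> \<ge> rat_gcd (real n) (1 / a) - (1 / a - 1)"
        proof (rule ccontr)
          assume "\<not> ?thesis"
          then have "a * \<bar>1 / \<alpha> - 2 * real n\<bar> < a * (rat_gcd (real n) (1 / a) - (1 / a - 1))"
            using a0 by (intro mult_strict_left_mono) auto
          then have "\<bar>\<beta> - 2 * (real n * a)\<bar> < a * (rat_gcd (real n) (1 / a) - (1 / a - 1))"
            unfolding scale .
          then have close: "\<bar>\<beta> - 2 * (of_int (int n) * a)\<bar> + 1 - a < a * rat_gcd (real n) (1 / a)"
            using a0 by (simp add: right_diff_distrib)
          have "real n \<in> \<rat>" "1 / a \<in> \<rat>" "real n > 0" "1 / a > 0" using rat a0 n by auto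
          then obtain i j u v :: int where g: "rat_gcd (real n) (1 / a) > 0"
            "real n = rat_gcd (real n) (1 / a) * i" "1 / a = rat_gcd (real n) (1 / a) * j"
            "rat_gcd (real n) (1 / a) = u * real n + v * (1 / a)"
            by (rule rat_gcd_bezout)
          define G where "G = rat_gcd (real n) (1 / a)"
          have "\<not> is_frame (gabor haar \<alpha> \<beta>)"
          proof (rule not_frame_near_multiple_of_density[OF \<alpha> \<beta> _ _ _ _ _ close[unfolded a_def]])
            show "1 \<le> int n" using n by simp
            show "\<alpha> * \<beta> \<le> 1" using a1 by (simp add: a_def)
            show "0 < \<alpha> * \<beta> * rat_gcd (real n) (1 / (\<alpha> * \<beta>))" using a0 g(1) by (simp add: a_def)
            have "real n * a = a * G * i" using g(2) unfolding G_def[symmetric] by simp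
            then show "of_int (int n) * (\<alpha> * \<beta>) = \<alpha> * \<beta> * rat_gcd (real n) (1 / (\<alpha> * \<beta>)) * i"
              by (simp add: a_def G_def)
            have "1 = a * (1 / a)" using a0 by simp
            also have "1 / a = G * j" using g(3) unfolding G_def .
            finally show "1 = \<alpha> * \<beta> * rat_gcd (real n) (1 / (\<alpha> * \<beta>)) * j"
              by (simp only: a_def G_def mult.assoc)
          qed
          then show False using frame by simp
        qed
      qed
    next
      assume cond: "\<forall>n::nat. n \<ge> 1 \<longrightarrow> \<bar>\<beta> - 2 * real n\<bar> \<ge> rat_gcd (real n) a \<and>
          \<bar>1 / \<alpha> - 2 * real n\<bar> \<ge> rat_gcd (real n) (1 / a) - (1 / a - 1)"
      show "is_frame (gabor haar \<alpha> \<beta>)"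
      proof (cases "a = 1")
        case True
        have gcd1: "1 \<le> rat_gcd (real n) 1" if n: "n \<ge> 1" for n :: nat
        proof -
          have "real n \<in> \<rat>" "(1::real) \<in> \<rat>" "real n > 0" "(1::real) > 0" using n by auto
          then obtain i j u v :: int where "rat_gcd (real n) 1 > 0" "real n = rat_gcd (real n) 1 * i"
            "1 = rat_gcd (real n) 1 * j" "rat_gcd (real n) 1 = u * real n + of_int v * 1"
            by (rule rat_gcd_bezout)
          then have g: "rat_gcd (real n) 1 = of_int (u * int n + v)" "rat_gcd (real n) 1 > 0" by auto
          then have "0 < u * int n + v" by linarith
          then show ?thesis unfolding g(1) by linarith
        qed
        \<comment> \<open>The choice puts \<open>\<beta> - 2 * n\<close> into
          \<open>[-1, 1)\<close>. The first condition, with a gcd of at least 1, leaves only the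
          value -1, so \<beta> is odd.\<close>
        define z where "z = \<lfloor>(\<beta> + 1) / 2\<rfloor>"
        define n where "n = nat z"
        have "1 \<le> \<beta>" using ab True by simp
        then have "1 \<le> z" unfolding z_def by (simp add: le_floor_iff)
        then have n: "n \<ge> 1" "real n = z" by (auto simp: n_def)
        have "of_int z \<le> (\<beta> + 1) / 2" "(\<beta> + 1) / 2 < of_int z + 1" unfolding z_def by linarith+
        then have n2: "2 * real n \<le> \<beta> + 1" "\<beta> + 1 < 2 * real n + 2" unfolding n(2) by auto
        have "1 \<le> \<bar>\<beta> - 2 * real n\<bar>" using cond n(1) gcd1[OF n(1)] True by fastforce
        then have "\<beta> = 2 * real n - 1" using n2 by linarith
        then have "\<beta> = 2 * real (n - 1) + 1" using n(1) by simp
        then show ?thesis by (rule frame_critical_odd[OF \<alpha>]) (use True in \<open>simp add: a_def\<close>)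
      next
        case False
        then have a1': "a < 1" using a1 by simp
        show ?thesis
        proof (rule frame_if_no_invariant_set[OF \<alpha> \<beta>])
          show "\<alpha> * \<beta> \<le> 1" using a1 by (simp add: a_def)
          fix S u assume S: "invariant_set (\<alpha> * \<beta>) (\<beta> / 2) S" "u \<in> S"
          show False
          proof (rule invariant_set_cases[OF a1' ab S(1)[folded a_def] S(2)])
            fix n :: nat assume n: "n \<ge> 1"
              and small: "\<And>(p::int) (q::int). p * real n + q * a > 0 \<Longrightarrow> 2 * \<bar>\<beta> / 2 - n\<bar> < p * real n + q * a"
            have "real n \<in> \<rat>" "a \<in> \<rat>" "real n > 0" "a > 0" using n rat a0 by auto
            then obtain i j p q :: int where g: "rat_gcd (real n) a > 0" "real n = rat_gcd (real n) a * i"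
              "a = rat_gcd (real n) a * j" "rat_gcd (real n) a = p * real n + q * a"
              by (rule rat_gcd_bezout)
            \<comment> \<open>By Bezout the gcd is itself one of the positive combinations that
              bound the arc.\<close>
            have "2 * \<bar>\<beta> / 2 - n\<bar> < rat_gcd (real n) a" using small[of p q] g(1) unfolding g(4) by simp
            moreover have "\<bar>\<beta> - 2 * real n\<bar> = 2 * \<bar>\<beta> / 2 - n\<bar>" by (simp add: abs_if)
            ultimately have "\<bar>\<beta> - 2 * real n\<bar> < rat_gcd (real n) a" by simp
            then show False using cond n by fastforce
          next
            fix n :: nat assume n: "n \<ge> 1"
              and small: "\<And>(p::int) (q::int). p * (n * a) + q > 0 \<Longrightarrow> 2 * \<bar>\<beta> / 2 - n * a\<bar> + 1 - a < p * (n * a) + q"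
            define G where "G = rat_gcd (real n) (1 / a)"
            have "real n \<in> \<rat>" "1 / a \<in> \<rat>" "real n > 0" "1 / a > 0" using rat a0 n by auto
            then obtain i j p q :: int where g: "G > 0" "G = p * real n + q * (1 / a)"
              "real n = G * i" "1 / a = G * j"
              unfolding G_def by (rule rat_gcd_bezout)
            have aG: "a * G = p * (n * a) + q" unfolding g(2) using a0 by (simp add: algebra_simps)
            have "0 < p * (n * a) + q" unfolding aG[symmetric] using a0 g(1) by simp
            from small[OF this] have s: "2 * \<bar>\<beta> / 2 - n * a\<bar> + 1 - a < a * G" unfolding aG .
            have "G - (1 / a - 1) \<le> \<bar>1 / \<alpha> - 2 * real n\<bar>" using cond n unfolding G_def by blast
            then have "a * (G - (1 / a - 1)) \<le> a * \<bar>1 / \<alpha> - 2 * real n\<bar>" using a0 by (intro mult_left_mono) auto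
            then have "a * G - 1 + a \<le> \<bar>\<beta> - 2 * (real n * a)\<bar>"
              unfolding scale using a0 by (simp add: right_diff_distrib)
            moreover have "\<bar>\<beta> - 2 * (real n * a)\<bar> = 2 * \<bar>\<beta> / 2 - n * a\<bar>" by (simp add: abs_if)
            ultimately show False using s by simp
          qed
        qed
      qed
    qed
  }
qed

end
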